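(* Let $V_0$, $\mathcal{P}$, $G_{\mathcal P}$ and the levels be as described in the context, and for $n\ge 1$ let $a_n,b_n,c_n,d_n,e_n$ denote the numbers of vertices of type $A$, $B$, $C$, $D$, $E$, respectively, on level $n$. Then $a_1=b_1=c_1=d_1=e_1=0$ and for all $n\ge 1$: \[ \begin{aligned} a_{n+1}&= a_n+b_n+3,\\ b_{n+1}&= a_n+2b_n,\\ c_{n+1}&= \tfrac13 a_n+c_n+\tfrac23 d_n,\\ d_{n+1}&= \tfrac12 b_n+\tfrac32c_n+2d_n+\tfrac52e_n,\\ e_{n+1}&= 3 c_n+4d_n+6 e_n . \end{aligned} \]
   Context: Consider the regular cubic honeycomb $\{4,3,5\}$ of hyperbolic 3-space: a tiling by congruent cubes with five cubes around each edge, so that the vertex figure is an icosahedron (20 cubes and 12 edges at each vertex). Fix a cube $Q_0$ of the honeycomb and a vertex $V_0$ of $Q_0$. The three faces of $Q_0$ containing $V_0$ lie in three pairwise perpendicular planes of the honeycomb (each such plane is tiled by squares of the honeycomb as the hyperbolic plane tiling $\{4,5\}$). Equivalently to the construction in the paper: for each of the three faces of $Q_0$ not containing $V_0$ take the neighbouring cube across it and keep reflecting across the face opposite the previous one, obtaining three infinite rows of cubes; $\mathcal P$ is the convex part of the honeycomb bounded by the planes spanned by pairs of these rows, i.e. the union of the cubes of the honeycomb lying in the closed "octant" bounded by the three planes through $V_0$ and containing $Q_0$. Let $G_{\mathcal P}$ be the graph whose vertices and edges are the vertices and edges of the honeycomb lying in $\mathcal P$. Level $n$ is the set of vertices of $G_{\mathcal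 P}$ at graph distance exactly $n$ from $V_0$ (level 0 is $\{V_0\}$). For a vertex $V$ on level $n\ge1$, its ascendants are its neighbours in $G_{\mathcal P}$ on level $n-1$. Vertex types on level $n\ge 1$: the vertices lying on the intersection line of two of the three bounding planes (there are exactly 3 of them on each level $n\ge1$) are of type "1"; the other vertices lying on one of the bounding planes are of type $A$ if they have 2 ascendants and of type $B$ if they have 1 ascendant; the vertices not lying on any bounding plane are of type $C$, $D$ or $E$ if they have 3, 2 or 1 ascendants, respectively.
   Formalization: Faces of a cube of {4,3,5} meet at 72°, and no geodesic plane is tiled by its squares; so the three bounding "planes" are taken to be the {4,5} sheets of squares through the faces of Q0 at V0, and P is the set of cubes reachable from Q0 without crossing these sheets. *)

theory Defs
  imports "HOL-Analysis.Analysis"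
begin

text \<open>
  Hyperbolic 3-space is the upper sheet of the hyperboloid in Minkowski space, with the time
  coordinate first. A plane of hyperbolic space is given by a unit spacelike normal vector.
\<close>

type_synonym mvec = "real \<times> (real ^ 3)"

definition mink :: "mvec \<Rightarrow> mvec \<Rightarrow> real" where
  "mink p q = snd p \<bullet> snd q - fst p * fst q"

definition hyp3 :: "mvec set" where
  "hyp3 = {p. mink p p = -1 \<and> fst p > 0}"

definition reflection :: "mvec \<Rightarrow> mvec \<Rightarrow> mvec" where
  "reflection n p = p - (2 * mink p n) *\<^sub>R n"

text \<open>
  A cube is represented by the set \<open>Q\<close> of the outward unit normals of its six faces; the point
  set is \<open>solid Q\<close>.
\<close>

definition solid :: "mvec set \<Rightarrow> mvec set" where
  "solid Q = {p \<in> hyp3. \<forall>n\<in>Q. mink p n \<le> 0}"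

definition face :: "mvec set \<Rightarrow> mvec \<Rightarrow> mvec set" where
  "face Q n = {p \<in> solid Q. mink p n = 0}"

definition cube_verts :: "mvec set \<Rightarrow> mvec set" where
  "cube_verts Q = {p \<in> solid Q. card {n \<in> Q. mink p n = 0} = 3}"

text \<open>Edges are represented by the ordered pairs of their end points.\<close>

definition cube_edges :: "mvec set \<Rightarrow> (mvec \<times> mvec) set" where
  "cube_edges Q = {(u, v). u \<in> cube_verts Q \<and> v \<in> cube_verts Q \<and> u \<noteq> v \<and>
     card {n \<in> Q. mink u n = 0 \<and> mink v n = 0} = 2}"

text \<open>
  The regular cube centred at \<open>(1, 0)\<close> with dihedral angle \<open>2 * pi / 5\<close>: the product of the
  outward normals of two adjacent faces is \<open>- cos (2 * pi / 5)\<close>. This angle is the one for which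
  five cubes fit around each edge, so the successive mirror images of the cube in its faces form
  the honeycomb \<open>{4,3,5}\<close>.
\<close>

definition base_cube :: "mvec set" where
  "base_cube = {(sqrt (cos (2 * pi / 5)), c *\<^sub>R axis i 1) | c i.
     c = sqrt (1 + cos (2 * pi / 5)) \<or> c = - sqrt (1 + cos (2 * pi / 5))}"

inductive_set honeycomb :: "mvec set set" where
  base: "base_cube \<in> honeycomb"
| reflect: "Q \<in> honeycomb \<Longrightarrow> n \<in> Q \<Longrightarrow> reflection n ` Q \<in> honeycomb"

text \<open>
  The plane \<open>{4,5}\<close> of the honeycomb spanned by the face \<open>n\<close> of the cube \<open>Q\<close>: the cube together
  with this face is reflected repeatedly in the side faces, that is, the faces that share an edge
  with the distinguished one. The cubes obtained form a layer over the plane. As the number of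
  cubes around an edge is odd, no totally geodesic plane is a union of squares of the honeycomb:
  at each edge of the plane there are two cubes on the side of \<open>Q\<close> and three on the other side.
\<close>

inductive_set layer :: "mvec set \<Rightarrow> mvec \<Rightarrow> (mvec set \<times> mvec) set"
  for Q :: "mvec set" and n :: mvec where
  base: "(Q, n) \<in> layer Q n"
| reflect: "(R, m) \<in> layer Q n \<Longrightarrow> k \<in> R \<Longrightarrow> k \<noteq> m \<Longrightarrow> face R k \<inter> face R m \<noteq> {} \<Longrightarrow>
    (reflection k ` R, reflection k m) \<in> layer Q n"

definition plane_squares :: "mvec set \<Rightarrow> mvec \<Rightarrow> mvec set set" where
  "plane_squares Q n = {face R m | R m. (R, m) \<in> layer Q n}"

definition corner_faces :: "mvec set \<Rightarrow> mvec \<Rightarrow> mvec set" where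
  "corner_faces Q V = {n \<in> Q. mink V n = 0}"

text \<open>
  The cubes of the part of the honeycomb that is bounded by the three planes spanned by the faces
  of \<open>Q\<close> at \<open>V\<close> and contains \<open>Q\<close>: those that can be reached from \<open>Q\<close> without crossing a square of
  the three planes.
\<close>

inductive_set octant :: "mvec set \<Rightarrow> mvec \<Rightarrow> mvec set set"
  for Q :: "mvec set" and V :: mvec where
  base: "Q \<in> octant Q V"
| cross: "R \<in> octant Q V \<Longrightarrow> m \<in> R \<Longrightarrow>
    (\<forall>n \<in> corner_faces Q V. face R m \<notin> plane_squares Q n) \<Longrightarrow> reflection m ` R \<in> octant Q V"

definition GP_verts :: "mvec set \<Rightarrow> mvec \<Rightarrow> mvec set" where
  "GP_verts Q V = (\<Union>R \<in> octant Q V. cube_verts R)"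

definition GP_edges :: "mvec set \<Rightarrow> mvec \<Rightarrow> (mvec \<times> mvec) set" where
  "GP_edges Q V = (\<Union>R \<in> octant Q V. cube_edges R)"

definition level :: "mvec set \<Rightarrow> mvec \<Rightarrow> nat \<Rightarrow> mvec set" where
  "level Q V n = {W \<in> GP_verts Q V.
     (V, W) \<in> GP_edges Q V ^^ n \<and> (\<forall>m<n. (V, W) \<notin> GP_edges Q V ^^ m)}"

definition ascendants :: "mvec set \<Rightarrow> mvec \<Rightarrow> nat \<Rightarrow> mvec \<Rightarrow> mvec set" where
  "ascendants Q V n W = {U \<in> level Q V (n - 1). (U, W) \<in> GP_edges Q V}"

definition planes_at :: "mvec set \<Rightarrow> mvec \<Rightarrow> mvec \<Rightarrow> mvec set" where
  "planes_at Q V W = {n \<in> corner_faces Q V. W \<in> \<Union> (plane_squares Q n)}"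

text \<open>
  Vertices on two of the bounding planes are those of type ``1''; hence the vertices of type
  \<open>A\<close> and \<open>B\<close> are the ones on exactly one bounding plane.
\<close>

definition type_A :: "mvec set \<Rightarrow> mvec \<Rightarrow> nat \<Rightarrow> mvec set" where
  "type_A Q V n = {W \<in> level Q V n. card (planes_at Q V W) = 1 \<and> card (ascendants Q V n W) = 2}"

definition type_B :: "mvec set \<Rightarrow> mvec \<Rightarrow> nat \<Rightarrow> mvec set" where
  "type_B Q V n = {W \<in> level Q V n. card (planes_at Q V W) = 1 \<and> card (ascendants Q V n W) = 1}"

definition type_C :: "mvec set \<Rightarrow> mvec \<Rightarrow> nat \<Rightarrow> mvec set" where
  "type_C Q V n = {W \<in> level Q V n. planes_at Q V W = {} \<and> card (ascendants Q V n W) = 3}"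

definition type_D :: "mvec set \<Rightarrow> mvec \<Rightarrow> nat \<Rightarrow> mvec set" where
  "type_D Q V n = {W \<in> level Q V n. planes_at Q V W = {} \<and> card (ascendants Q V n W) = 2}"

definition type_E :: "mvec set \<Rightarrow> mvec \<Rightarrow> nat \<Rightarrow> mvec set" where
  "type_E Q V n = {W \<in> level Q V n. planes_at Q V W = {} \<and> card (ascendants Q V n W) = 1}"

definition num_A :: "mvec set \<Rightarrow> mvec \<Rightarrow> nat \<Rightarrow> real" where
  "num_A Q V n = real (card (type_A Q V n))"

definition num_B :: "mvec set \<Rightarrow> mvec \<Rightarrow> nat \<Rightarrow> real" where
  "num_B Q V n = real (card (type_B Q V n))"

definition num_C :: "mvec set \<Rightarrow> mvec \<Rightarrow> nat \<Rightarrow> real" where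
  "num_C Q V n = real (card (type_C Q V n))"

definition num_D :: "mvec set \<Rightarrow> mvec \<Rightarrow> nat \<Rightarrow> real" where
  "num_D Q V n = real (card (type_D Q V n))"

definition num_E :: "mvec set \<Rightarrow> mvec \<Rightarrow> nat \<Rightarrow> real" where
  "num_E Q V n = real (card (type_E Q V n))"

end

theory Submission
  imports Defs
begin

text \<open>
  The mid-planes of the cubes are mirrors of the honeycomb. In suitable coordinates their unit
  normals are the norm-one vectors of a lattice over \<open>\<int>[phi]\<close>, \<open>phi\<close> the golden ratio, on which the
  Galois conjugate of the Minkowski form is positive definite; hence the mirrors are discrete, and
  an edge crosses exactly one of them, its bisector. Folding paths at mirrors then shows that
  crossing the bisector of an edge away from \<open>V0\<close> raises the graph distance from \<open>V0\<close> by one and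
  crossing it towards \<open>V0\<close> lowers it by one.

  The twelve bisectors at a vertex form an icosahedron: adjacent ones are orthogonal, all others
  bound disjoint half-spaces. So the bisectors that separate a vertex \<open>w\<close> from \<open>V0\<close> (the ascendants)
  form a simplex of this icosahedron, and an upper neighbour of \<open>w\<close> in the direction \<open>j\<close> has one
  ascendant more than the number of ascending directions of \<open>w\<close> adjacent to \<open>j\<close>.

  The layer of cubes over a bounding plane is bisected by a single mirror \<open>a\<close>, one of the three
  mid-planes of the cube at \<open>V0\<close>. The vertices of the octant are those that lie, for each such \<open>a\<close>,
  behind \<open>a\<close> or directly in front of it, and the directions of the octant at such a vertex are the
  planes through it and their common neighbours in the icosahedron. The recurrences count the edges
  between consecutive levels by the types of both ends.
\<close>


section \<open>The ring generated by the golden ratio\<close>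

text \<open>The mid-planes form the dual honeycomb {5,3,4}: the twelve bisectors at a vertex of
  {4,3,5} cut out a right-angled dodecahedron around it. The edge graph is thus the Cayley graph of
  a right-angled reflection group whose generators commute along the edges of an icosahedron. This
  is why walls alone decide whether an edge ascends, and why the descending walls at a vertex
  commute pairwise.

  The obstacle is the odd number of cubes around an edge. A face plane continues into the interior
  of cubes, so the bounding surfaces are bent along every edge and the octant is given only
  combinatorially, by squares that must not be crossed. Mid-planes have no such defect, and no
  vertex lies on one of them.

  The scale is rigid: \<open>phi / 2\<close> is the squared hyperbolic sine of half an edge, and the
  squared cosine \<open>1 + phi / 2\<close> is a threshold below which the arithmetic of \<int>[phi]
  still separates mirrors. The fractions in the recurrences arise by dividing edge counts by the
  number of ascendants at the upper end.\<close>

definition phi :: real where "phi = (1 + sqrt 5) / 2"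
definition psi :: real where "psi = 1 - phi"

lemma phi_sq: "phi * phi = phi + 1"
proof -
  have "sqrt 5 * sqrt 5 = (5::real)" by simp
  then show ?thesis unfolding phi_def by (simp add: field_simps)
qed

lemma phi_bounds: "809 / 500 < phi" "phi < 16181 / 10000"
proof -
  have "2236 / 1000 < sqrt 5" by (rule real_less_rsqrt) (simp add: power2_eq_square)
  moreover have "sqrt 5 < 22362 / 10000" by (rule real_less_lsqrt) (simp_all add: power2_eq_square)
  ultimately show "809 / 500 < phi" "phi < 16181 / 10000" unfolding phi_def by (simp_all add: field_simps)
qed

lemma phi_pos: "0 < phi" using phi_bounds by simp

lemma psi_sq: "psi * psi = psi + 1"
  using phi_sq unfolding psi_def by (simp add: algebra_simps)

lemma sqrt_5_irrational: "sqrt 5 \<notin> \<rat>"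
proof
  assume "sqrt 5 \<in> \<rat>"
  then obtain m n :: nat where n: "n \<noteq> 0" and eq: "\<bar>sqrt 5\<bar> = real m / real n" and "coprime m n"
    by (rule Rats_abs_nat_div_natE)
  then have "sqrt 5 * real n = real m" by (simp add: field_simps)
  then have "(sqrt 5 * real n) * (sqrt 5 * real n) = real m * real m" by simp
  then have "real m * real m = (sqrt 5 * sqrt 5) * (real n * real n)" by (simp only: ac_simps)
  then have "real (m * m) = real (5 * (n * n))" by simp
  then have mn: "m * m = 5 * (n * n)" using of_nat_eq_iff by blast
  have five: "5 dvd k" if "5 dvd k * k" for k :: nat
    using that prime_dvd_mult_iff[of 5 k k] by simp
  have "5 dvd m" using five mn by simp
  then obtain k where "m = 5 * k" by blast
  then have "n * n = 5 * (k * k)" using mn by simp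
  then have "5 dvd n" using five by simp
  then show False using \<open>5 dvd m\<close> \<open>coprime m n\<close> by (metis coprime_common_divisor_nat numeral_eq_one_iff semiring_norm(86))
qed

lemma int_phi_eq_0:
  assumes "of_int a + of_int b * phi = (0::real)"
  shows "a = 0 \<and> b = 0"
proof -
  have "b = 0"
  proof (rule ccontr)
    assume "b \<noteq> 0"
    then have "phi = - of_int a / of_int b" using assms by (simp add: field_simps)
    then have "phi \<in> \<rat>" by (metis Rats_of_int Rats_divide Rats_minus_iff)
    then have "2 * phi - 1 \<in> \<rat>" by simp
    moreover have "2 * phi - 1 = sqrt 5" by (simp add: phi_def field_simps)
    ultimately have "sqrt 5 \<in> \<rat>" by simp
    then show False using sqrt_5_irrational by simp
  qed
  then show ?thesis using assms by simp
qed

text \<open>The graph of the nontrivial automorphism of \<int>[phi], which sends \<open>phi\<close>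
  to \<open>psi\<close>. As a relation on reals it needs no choice of coefficients; irrationality
  makes it single-valued in both directions.\<close>

definition conj_pair :: "real \<Rightarrow> real \<Rightarrow> bool" where
  "conj_pair x y \<longleftrightarrow> (\<exists>a b::int. x = of_int a + of_int b * phi \<and> y = of_int a + of_int b * psi)"

definition Zphi :: "real set" where "Zphi = {x. \<exists>y. conj_pair x y}"

lemma conj_pair_of_int: "conj_pair (of_int n) (of_int n)"
  unfolding conj_pair_def by (intro exI[of _ n] exI[of _ 0]) simp

lemma conj_pair_phi: "conj_pair phi psi"
  unfolding conj_pair_def by (intro exI[of _ 0] exI[of _ 1]) simp

lemma conj_pair_add: "conj_pair x x' \<Longrightarrow> conj_pair y y' \<Longrightarrow> conj_pair (x + y) (x' + y')"
  unfolding conj_pair_def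
proof (elim exE conjE)
  fix a b c d :: int
  assume "x = of_int a + of_int b * phi" "x' = of_int a + of_int b * psi"
    "y = of_int c + of_int d * phi" "y' = of_int c + of_int d * psi"
  then show "\<exists>a b::int. x + y = of_int a + of_int b * phi \<and> x' + y' = of_int a + of_int b * psi"
    by (intro exI[of _ "a + c"] exI[of _ "b + d"]) (simp add: algebra_simps)
qed

lemma conj_pair_mult: "conj_pair x x' \<Longrightarrow> conj_pair y y' \<Longrightarrow> conj_pair (x * y) (x' * y')"
  unfolding conj_pair_def
proof (elim exE conjE)
  fix a b c d :: int
  assume e: "x = of_int a + of_int b * phi" "x' = of_int a + of_int b * psi"
    "y = of_int c + of_int d * phi" "y' = of_int c + of_int d * psi"
  have "(of_int a + of_int b * z) * (of_int c + of_int d * z) =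
      of_int (a * c + b * d) + of_int (a * d + b * c + b * d) * z" if "z * z = z + 1" for z :: real
  proof -
    have "(of_int a + of_int b * z) * (of_int c + of_int d * z) =
      of_int a * of_int c + (of_int a * of_int d + of_int b * of_int c) * z + of_int b * of_int d * (z * z)"
      by (simp add: algebra_simps)
    then show ?thesis unfolding that by (simp add: algebra_simps)
  qed
  from this[OF phi_sq] this[OF psi_sq]
  show "\<exists>a b::int. x * y = of_int a + of_int b * phi \<and> x' * y' = of_int a + of_int b * psi"
    unfolding e by blast
qed

lemma conj_pair_minus: "conj_pair x x' \<Longrightarrow> conj_pair (- x) (- x')"
  using conj_pair_mult[OF conj_pair_of_int[of "-1"]] by fastforce

lemma conj_pair_diff: "conj_pair x x' \<Longrightarrow> conj_pair y y' \<Longrightarrow> conj_pair (x - y) (x' - y')"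
  using conj_pair_add[OF _ conj_pair_minus, of x x' y y'] by simp

lemma conj_pair_unique: "conj_pair x y \<Longrightarrow> conj_pair x z \<Longrightarrow> y = z"
  unfolding conj_pair_def
proof (elim exE conjE)
  fix a b c d :: int
  assume e: "x = of_int a + of_int b * phi" "y = of_int a + of_int b * psi"
    "x = of_int c + of_int d * phi" "z = of_int c + of_int d * psi"
  then have "of_int (a - c) + of_int (b - d) * phi = (0::real)" by (simp add: algebra_simps)
  from int_phi_eq_0[OF this] show "y = z" using e by simp
qed

lemma conj_pair_inj: "conj_pair x z \<Longrightarrow> conj_pair y z \<Longrightarrow> x = y"
  unfolding conj_pair_def
proof (elim exE conjE)
  fix a b c d :: int
  assume e: "x = of_int a + of_int b * phi" "z = of_int a + of_int b * psi"
    "y = of_int c + of_int d * phi" "z = of_int c + of_int d * psi"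
  then have "of_int (a - c + b - d) + of_int (d - b) * phi = (0::real)"
    by (simp add: psi_def algebra_simps)
  from int_phi_eq_0[OF this] show "x = y" using e by simp
qed

lemma Zphi_of_int [simp]: "of_int n \<in> Zphi" unfolding Zphi_def using conj_pair_of_int by blast
lemma Zphi_0 [simp]: "0 \<in> Zphi" using Zphi_of_int[of 0] by simp
lemma Zphi_1 [simp]: "1 \<in> Zphi" using Zphi_of_int[of 1] by simp
lemma Zphi_numeral [simp]: "numeral n \<in> Zphi" using Zphi_of_int[of "numeral n"] by simp
lemma Zphi_phi [simp]: "phi \<in> Zphi" unfolding Zphi_def using conj_pair_phi by blast
lemma Zphi_add [simp]: "x \<in> Zphi \<Longrightarrow> y \<in> Zphi \<Longrightarrow> x + y \<in> Zphi"
  unfolding Zphi_def using conj_pair_add by blast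
lemma Zphi_mult [simp]: "x \<in> Zphi \<Longrightarrow> y \<in> Zphi \<Longrightarrow> x * y \<in> Zphi"
  unfolding Zphi_def using conj_pair_mult by blast
lemma Zphi_minus [simp]: "x \<in> Zphi \<Longrightarrow> - x \<in> Zphi"
  unfolding Zphi_def using conj_pair_minus by blast
lemma Zphi_diff [simp]: "x \<in> Zphi \<Longrightarrow> y \<in> Zphi \<Longrightarrow> x - y \<in> Zphi"
  unfolding Zphi_def using conj_pair_diff by blast

text \<open>2 is not a unit in \<int>[phi]: the integer coefficient of \<open>1 + 2 * z\<close> is
  odd.\<close>

lemma odd_Zphi_nonzero:
  assumes "z \<in> Zphi" shows "1 + 2 * z \<noteq> 0"
proof
  assume "1 + 2 * z = 0"
  moreover obtain a b :: int where "z = of_int a + of_int b * phi"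
    using assms unfolding Zphi_def conj_pair_def by blast
  ultimately have "of_int (1 + 2 * a) + of_int (2 * b) * phi = (0::real)"
    by (simp add: algebra_simps)
  from int_phi_eq_0[OF this] have "1 + 2 * a = 0" by simp
  then show False by presburger
qed

text \<open>\<open>t - t'\<close> is an integer multiple of \<open>2 * phi - 1\<close>, the square
  root of 5, so the coefficient of \<open>phi\<close> is -1, 0 or 1. The bounds have to exclude
  \<open>phi\<close> itself, whose conjugate is also smaller than 1 in absolute value; they do
  because \<open>1 + phi / 2 < phi * phi\<close>.\<close>

lemma small_conj_pair:
  assumes "conj_pair t t'" "\<bar>t'\<bar> \<le> 1" "t * t < 1 + phi / 2"
  shows "t = 0 \<or> t = 1 \<or> t = -1"
proof -
  obtain a b :: int where t: "t = of_int a + of_int b * phi" "t' = of_int a + of_int b * psi"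
    using assms(1) unfolding conj_pair_def by blast
  \<comment> \<open>A rational upper bound for the square root of \<open>1 + phi / 2\<close>, which
    is about 1.345.\<close>
  have "\<bar>t\<bar> < 27 / 20"
    by (rule power2_less_imp_less, insert assms(3) phi_bounds) (simp_all add: power2_eq_square)
  moreover have "t - t' = of_int b * (2 * phi - 1)" using t by (simp add: psi_def algebra_simps)
  ultimately have bb: "\<bar>of_int b * (2 * phi - 1)\<bar> < 47 / 20" using assms(2) by linarith
  have "\<bar>b\<bar> < 2"
  proof (rule ccontr)
    assume "\<not> \<bar>b\<bar> < 2"
    then have "2 \<le> \<bar>of_int b :: real\<bar>" by linarith
    then have "2 * (2 * phi - 1) \<le> \<bar>of_int b * (2 * phi - 1)\<bar>"
      unfolding abs_mult using phi_bounds by (intro mult_mono) auto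
    from order.strict_trans1[OF this bb] show False using phi_bounds by simp
  qed
  then consider "b = 0" | "b = 1" | "b = -1" by linarith
  then show ?thesis
  proof cases
    case 1
    then have "\<bar>a\<bar> \<le> 1" using assms(2) t by simp
    then have "a = 0 \<or> a = 1 \<or> a = -1" by linarith
    then show ?thesis using t 1 by auto
  next
    case 2
    then have "- 1 < (of_int a :: real)" "(of_int a :: real) < 0"
      using t assms(2) \<open>\<bar>t\<bar> < 27 / 20\<close> phi_bounds by (auto simp: psi_def abs_le_iff abs_less_iff)
    then have "of_int (-1) < (of_int a :: real)" "of_int a < (of_int 0 :: real)" by simp_all
    then have "-1 < a" "a < 0" by (simp_all only: of_int_less_iff)
    then show ?thesis by simp
  next
    case 3
    then have "0 < (of_int a :: real)" "(of_int a :: real) < 1"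
      using t assms(2) \<open>\<bar>t\<bar> < 27 / 20\<close> phi_bounds by (auto simp: psi_def abs_le_iff abs_less_iff)
    then have "of_int 0 < (of_int a :: real)" "of_int a < (of_int 1 :: real)" by simp_all
    then have "0 < a" "a < 1" by (simp_all only: of_int_less_iff)
    then show ?thesis by simp
  qed
qed

section \<open>Mirrors\<close>

lemma mink_add_left: "mink (p + q) r = mink p r + mink q r"
  and mink_add_right: "mink r (p + q) = mink r p + mink r q"
  and mink_diff_left: "mink (p - q) r = mink p r - mink q r"
  and mink_diff_right: "mink r (p - q) = mink r p - mink r q"
  and mink_scale_left: "mink (c *\<^sub>R p) r = c * mink p r"
  and mink_scale_right: "mink r (c *\<^sub>R p) = c * mink r p"
  and mink_minus_left: "mink (- p) r = - mink p r"
  and mink_minus_right: "mink r (- p) = - mink r p"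
  and mink_zero_left: "mink 0 r = 0"
  and mink_zero_right: "mink r 0 = 0"
  by (simp_all add: mink_def algebra_simps inner_simps)

lemmas mink_simps = mink_add_left mink_add_right mink_diff_left mink_diff_right
  mink_scale_left mink_scale_right mink_minus_left mink_minus_right mink_zero_left mink_zero_right

lemma mink_commute: "mink p q = mink q p"
  by (simp add: mink_def inner_commute mult.commute)

lemma mink_sum_right: "mink r (\<Sum>x\<in>A. f x) = (\<Sum>x\<in>A. mink r (f x))"
  by (induction A rule: infinite_finite_induct) (simp_all add: mink_simps)

lemma mink_coords:
  "mink p q = snd p $ 1 * snd q $ 1 + snd p $ 2 * snd q $ 2 + snd p $ 3 * snd q $ 3 - fst p * fst q"
  by (simp add: mink_def inner_vec_def sum_3)

lemma mink_nondegenerate: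
  assumes "\<And>q. mink p q = 0" shows "p = 0"
proof -
  have "mink p (- fst p, snd p) = 0" by fact
  then have "snd p \<bullet> snd p + fst p * fst p = 0" by (simp add: mink_def)
  then have "snd p = 0 \<and> fst p = 0"
    by (metis add_nonneg_eq_0_iff inner_eq_zero_iff inner_ge_zero mult_eq_0_iff zero_le_square)
  then show ?thesis by (simp add: prod_eq_iff)
qed

text \<open>The form has a single negative direction, already used up by \<open>m\<close>;
  Cauchy-Schwarz on the spatial parts makes this quantitative.\<close>

lemma orthogonal_timelike_nonneg:
  assumes "mink m m < 0" "mink p m = 0"
  shows "0 \<le> mink p p"
proof -
  let ?a = "norm (snd m)" and ?b = "norm (snd p)"
  have 1: "?a * ?a < fst m * fst m" using assms(1) by (simp add: mink_def dot_square_norm power2_eq_square)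
  have "\<bar>fst p * fst m\<bar> \<le> ?b * ?a" using assms(2) Cauchy_Schwarz_ineq2[of "snd p" "snd m"]
    by (simp add: mink_def)
  then have "(fst p * fst m) * (fst p * fst m) \<le> (?b * ?a) * (?b * ?a)"
    by (metis abs_ge_zero abs_mult_self_eq mult_mono')
  then have 2: "(fst p * fst p) * (fst m * fst m) \<le> (?b * ?b) * (?a * ?a)"
    by (simp add: ac_simps)
  also have "\<dots> \<le> (?b * ?b) * (fst m * fst m)" using 1 by (intro mult_left_mono) auto
  finally have 3: "(fst p * fst p) * (fst m * fst m) \<le> (?b * ?b) * (fst m * fst m)" .
  have "0 < fst m * fst m" using 1 by (rule order.strict_trans1[rotated]) simp
  then have "fst p * fst p \<le> ?b * ?b" using 3 by (simp only: mult_le_cancel_right_pos)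
  then show ?thesis by (simp add: mink_def dot_square_norm power2_eq_square)
qed

lemma causal_sign:
  assumes "p \<in> hyp3" "mink q q \<le> 0" "0 \<le> fst q"
  shows "mink p q \<le> 0"
proof -
  have causal: "norm (snd r) \<le> fst r" if "mink r r \<le> 0" "0 \<le> fst r" for r :: mvec
    by (rule power2_le_imp_le, insert that) (simp_all add: mink_def dot_square_norm power2_eq_square)
  have p: "norm (snd p) \<le> fst p" using causal assms(1) by (simp add: hyp3_def)
  have q: "norm (snd q) \<le> fst q" using causal assms(2,3) by simp
  have "snd p \<bullet> snd q \<le> norm (snd p) * norm (snd q)" by (rule norm_cauchy_schwarz)
  also have "\<dots> \<le> fst p * fst q" using p q order_trans[OF norm_ge_zero p] by (intro mult_mono) simp_all
  finally show ?thesis by (simp add: mink_def)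
qed

lemma mink_hyp3_neg:
  assumes "p \<in> hyp3" "q \<in> hyp3" shows "mink p q < 0"
proof -
  have "mink q q \<le> 0" "0 \<le> fst q" using assms by (auto simp: hyp3_def)
  then have "mink p q \<le> 0" using causal_sign assms by blast
  moreover have "mink p q \<noteq> 0"
  proof
    assume "mink p q = 0"
    then have "mink q p = 0" by (simp add: mink_commute)
    then have "0 \<le> mink q q" using orthogonal_timelike_nonneg[of p q] assms(1) by (auto simp: hyp3_def)
    then show False using assms by (auto simp: hyp3_def)
  qed
  ultimately show ?thesis by simp
qed

text \<open>If two unit normals have product at most -1, then \<open>h + k\<close> is causal, so its
  product with points of the hyperboloid cannot take both signs. A point before both planes and a
  point behind both would give opposite signs.\<close>

lemma disjoint_half_spaces:
  assumes "p \<in> hyp3" "w \<in> hyp3" "mink h h = 1" "mink k k = 1" "mink h k \<le> -1"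
    "mink w h < 0" "mink w k < 0" "0 < mink p h" "0 < mink p k"
  shows False
proof -
  let ?q = "h + k"
  have q: "mink ?q ?q \<le> 0" using assms(3-5) by (simp add: mink_simps mink_commute[of k h])
  then have q': "mink (- ?q) (- ?q) \<le> 0" by (simp only: mink_minus_left mink_minus_right minus_minus)
  show False
  proof (cases "0 \<le> fst ?q")
    case True
    then show False using causal_sign[OF assms(1) q] assms(8,9) by (simp add: mink_simps)
  next
    case False
    then have "mink w (- ?q) \<le> 0" using causal_sign[OF assms(2) q'] by simp
    then show False using assms(6,7) by (simp add: mink_simps)
  qed
qed

lemma reflection_linear: "linear (reflection n)"
  unfolding reflection_def by (rule linearI) (simp_all add: mink_simps algebra_simps)

lemma reflection_mink:
  assumes "mink n n = 1"
  shows "mink (reflection n p) (reflection n q) = mink p q"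
proof -
  have "mink n q = mink q n" by (rule mink_commute)
  then show ?thesis using assms by (simp add: reflection_def mink_simps)
qed

lemma reflection_invol:
  assumes "mink n n = 1" shows "reflection n (reflection n p) = p"
proof -
  have "mink (reflection n p) n = - mink p n" using assms by (simp add: reflection_def mink_simps)
  then show ?thesis unfolding reflection_def[of n "reflection n p"] by (simp add: reflection_def)
qed

lemma reflection_orthogonal: "mink p n = 0 \<Longrightarrow> reflection n p = p"
  by (simp add: reflection_def)

text \<open>The factor \<open>sqrt phi\<close> in the time coordinate turns the form into
  \<open>x * x + y * y + z * z - phi * (t * t)\<close> over \<int>[phi]; conjugation then replaces
  \<open>phi\<close> by the negative number \<open>psi\<close>.\<close>

definition lat :: "mvec set" where
  "lat = {p. (\<exists>t\<in>Zphi. fst p = sqrt phi * t) \<and> (\<forall>i. snd p $ i \<in> Zphi)}"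

lemma lat_add:
  assumes "p \<in> lat" "q \<in> lat" shows "p + q \<in> lat"
proof -
  obtain s t where "s \<in> Zphi" "t \<in> Zphi" "fst p = sqrt phi * s" "fst q = sqrt phi * t"
    using assms unfolding lat_def by blast
  then have "s + t \<in> Zphi" "fst (p + q) = sqrt phi * (s + t)" by (simp_all add: distrib_left)
  then show ?thesis using assms unfolding lat_def by auto
qed

lemma lat_scale:
  assumes "c \<in> Zphi" "p \<in> lat" shows "c *\<^sub>R p \<in> lat"
proof -
  obtain t where "t \<in> Zphi" "fst p = sqrt phi * t" using assms unfolding lat_def by blast
  then have "c * t \<in> Zphi" "fst (c *\<^sub>R p) = sqrt phi * (c * t)" using assms by simp_all
  then show ?thesis using assms unfolding lat_def by auto
qed

lemma lat_minus: "p \<in> lat \<Longrightarrow> - p \<in> lat"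
  using lat_scale[of "-1" p] by simp

lemma lat_diff: "p \<in> lat \<Longrightarrow> q \<in> lat \<Longrightarrow> p - q \<in> lat"
  using lat_add[OF _ lat_minus, of p q] by simp

lemma sqrt_phi_sq: "sqrt phi * sqrt phi = phi" using phi_pos by simp

lemma lat_mink: 
  assumes "p \<in> lat" "q \<in> lat" shows "mink p q \<in> Zphi"
proof -
  obtain s t where "s \<in> Zphi" "t \<in> Zphi" and e: "fst p = sqrt phi * s" "fst q = sqrt phi * t"
    using assms unfolding lat_def by blast
  have "fst p * fst q = phi * (s * t)" unfolding e by (metis mult.assoc mult.left_commute sqrt_phi_sq)
  then show ?thesis using assms \<open>s \<in> Zphi\<close> \<open>t \<in> Zphi\<close> by (simp add: mink_coords lat_def)
qed

definition mirrors :: "mvec set" where "mirrors = {h \<in> lat. mink h h = 1}"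

lemma mirrors_minus: "h \<in> mirrors \<Longrightarrow> - h \<in> mirrors"
  by (simp add: mirrors_def lat_minus mink_simps)

lemma mirrors_reflection:
  assumes "h \<in> mirrors" "k \<in> mirrors" shows "reflection k h \<in> mirrors"
proof -
  have "mink h k \<in> Zphi" using assms lat_mink by (simp add: mirrors_def)
  then have "reflection k h \<in> lat" unfolding reflection_def using assms
    by (intro lat_diff lat_scale) (auto simp: mirrors_def)
  then show ?thesis using assms reflection_mink by (simp add: mirrors_def)
qed

text \<open>The Galois conjugate of the Minkowski form is positive definite on \<open>lat\<close>; this makes the
  set of mirrors discrete.\<close>

lemma mirrors_discrete:
  assumes h: "h \<in> mirrors" and k: "k \<in> mirrors" and small: "mink h k * mink h k < 1 + phi / 2"
  shows "mink h k = 0 \<or> h = k \<or> h = - k"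
proof -
  obtain s t where st: "s \<in> Zphi" "t \<in> Zphi" "fst h = sqrt phi * s" "fst k = sqrt phi * t"
    using assms unfolding mirrors_def lat_def by blast
  obtain x where x: "\<And>i. conj_pair (snd h $ i) (x i)"
    using h unfolding mirrors_def lat_def Zphi_def by simp metis
  obtain y where y: "\<And>i. conj_pair (snd k $ i) (y i)"
    using k unfolding mirrors_def lat_def Zphi_def by simp metis
  obtain s' t' where st': "conj_pair s s'" "conj_pair t t'" using st unfolding Zphi_def by blast
  have form: "fst p * fst q = phi * (a * b)" if "fst p = sqrt phi * a" "fst q = sqrt phi * b"
    for p q :: mvec and a b unfolding that by (metis mult.assoc mult.left_commute sqrt_phi_sq)
  have hk: "conj_pair (mink h k) (x 1 * y 1 + x 2 * y 2 + x 3 * y 3 - psi * (s' * t'))"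
    unfolding mink_coords form[OF st(3,4)] by (intro conj_pair_diff conj_pair_add conj_pair_mult x y st' conj_pair_phi)
  have hh: "conj_pair (mink h h) (x 1 * x 1 + x 2 * x 2 + x 3 * x 3 - psi * (s' * s'))"
    unfolding mink_coords form[OF st(3,3)] by (intro conj_pair_diff conj_pair_add conj_pair_mult x y st' conj_pair_phi)
  have kk: "conj_pair (mink k k) (y 1 * y 1 + y 2 * y 2 + y 3 * y 3 - psi * (t' * t'))"
    unfolding mink_coords form[OF st(4,4)] by (intro conj_pair_diff conj_pair_add conj_pair_mult x y st' conj_pair_phi)
  have one: "conj_pair 1 1" using conj_pair_of_int[of 1] by simp
  have hh1: "x 1 * x 1 + x 2 * x 2 + x 3 * x 3 - psi * (s' * s') = 1"
    using conj_pair_unique[OF hh] one h by (simp add: mirrors_def)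
  have kk1: "y 1 * y 1 + y 2 * y 2 + y 3 * y 3 - psi * (t' * t') = 1"
    using conj_pair_unique[OF kk] one k by (simp add: mirrors_def)
  define u where "u = x 1 * y 1 + x 2 * y 2 + x 3 * y 3 - psi * (s' * t')"
  have psi: "psi < 0" using phi_bounds by (simp add: psi_def)
  \<comment> \<open>For \<open>e = 1\<close> and \<open>e = -1\<close> these are the conjugate norms
    of \<open>h - k\<close> and \<open>h + k\<close>; that both are nonnegative bounds the conjugate
    product \<open>u\<close> by 1 in absolute value.\<close>
  have sq: "(x 1 - e * y 1)^2 + (x 2 - e * y 2)^2 + (x 3 - e * y 3)^2 + (- psi) * (s' - e * t')^2 = 2 - 2 * e * u"
    if "e * e = 1" for e
  proof -
    have "(x 1 - e * y 1)^2 + (x 2 - e * y 2)^2 + (x 3 - e * y 3)^2 + (- psi) * (s' - e * t')^2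
      = (x 1 * x 1 + x 2 * x 2 + x 3 * x 3 - psi * (s' * s'))
       + (e * e) * (y 1 * y 1 + y 2 * y 2 + y 3 * y 3 - psi * (t' * t')) - 2 * e * u"
      unfolding u_def power2_eq_square by (simp add: algebra_simps)
    then show ?thesis unfolding hh1 kk1 that by simp
  qed
  have nn: "0 \<le> (x 1 - e * y 1)^2 + (x 2 - e * y 2)^2 + (x 3 - e * y 3)^2 + (- psi) * (s' - e * t')^2" for e
    using psi by (intro add_nonneg_nonneg mult_nonneg_nonneg) auto
  have "\<bar>u\<bar> \<le> 1" using nn[of 1] nn[of "-1"] sq[of 1] sq[of "-1"] by (simp add: abs_le_iff)
  then have cases: "mink h k = 0 \<or> mink h k = 1 \<or> mink h k = -1"
    using small_conj_pair[OF hk _ small] by (simp add: u_def)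
  \<comment> \<open>The case of equality: the definite norm of the difference vanishes, so all
    conjugate coordinates agree, and conjugation is injective.\<close>
  have eq: "h = e *\<^sub>R k" if e: "mink h k = e" "e = 1 \<or> e = -1" for e
  proof -
    have ge: "conj_pair e e" using e(2) conj_pair_of_int[of 1] conj_pair_of_int[of "-1"] by auto
    then have "u = e" using conj_pair_unique[OF hk] e(1) by (simp add: u_def)
    then have z: "(x 1 - e * y 1)^2 + (x 2 - e * y 2)^2 + (x 3 - e * y 3)^2 + (- psi) * (s' - e * t')^2 = 0"
      using sq[of e] e(2) by auto
    have "0 \<le> (- psi) * (s' - e * t')^2" using psi by (intro mult_nonneg_nonneg) auto
    then have z': "(x 1 - e * y 1)^2 = 0" "(x 2 - e * y 2)^2 = 0" "(x 3 - e * y 3)^2 = 0" "(- psi) * (s' - e * t')^2 = 0"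
      using z zero_le_power2[of "x 1 - e * y 1"] zero_le_power2[of "x 2 - e * y 2"]
        zero_le_power2[of "x 3 - e * y 3"] by linarith+
    then have "x 1 = e * y 1" "x 2 = e * y 2" "x 3 = e * y 3" "s' = e * t'" using psi by auto
    moreover have "snd h $ i = e * snd k $ i" if "x i = e * y i" for i
      using x[of i] conj_pair_mult[OF ge y[of i]] that conj_pair_inj by auto
    moreover have "s = e * t" if "s' = e * t'" using st' conj_pair_mult[OF ge st'(2)] that conj_pair_inj by auto
    ultimately have "fst h = e * fst k" "\<forall>i. snd h $ i = e * snd k $ i"
      using st by (auto simp: forall_3)
    then show ?thesis by (simp add: prod_eq_iff vec_eq_iff)
  qed
  show ?thesis using cases eq[of 1] eq[of "-1"] by auto
qed

text \<open>The hyperbolic sine of half the edge length.\<close>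

definition sh :: real where "sh = sqrt (phi / 2)"

lemma sh_pos: "0 < sh" and sh_sq: "sh * sh = phi / 2"
  using phi_pos by (simp_all add: sh_def)

text \<open>The mirrors that bisect the edges at \<open>v\<close>, as unit normals pointing away from \<open>v\<close>.\<close>

definition dirs :: "mvec \<Rightarrow> mvec set" where "dirs v = {h \<in> mirrors. mink v h = - sh}"

definition step :: "mvec \<Rightarrow> mvec \<Rightarrow> mvec" where "step v k = v + (2 * sh) *\<^sub>R k"

lemma step_eq_reflection: "k \<in> dirs v \<Longrightarrow> step v k = reflection k v"
  by (simp add: step_def dirs_def reflection_def)

lemma mink_step: "mink (step v k) h = mink v h + 2 * sh * mink k h"
  by (simp add: step_def mink_simps)

text \<open>A crossed mirror has product less than \<open>sh * t\<close> in absolute value with the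
  midpoint of the edge. The part of \<open>h\<close> orthogonal to \<open>k\<close> and to this
  midpoint is not timelike, which forces \<open>t * t < 1 + sh * sh\<close>: exactly the threshold
  of \<open>mirrors_discrete\<close>.\<close>

lemma edge_crosses_one_mirror:
  assumes v: "v \<in> hyp3" and k: "k \<in> dirs v" and h: "h \<in> mirrors"
    and near: "mink v h < 0" and far: "0 < mink (step v k) h"
  shows "h = k"
proof -
  define t where "t = mink h k"
  \<comment> \<open>The midpoint of the edge, up to normalisation.\<close>
  define m where "m = v + sh *\<^sub>R k"
  have km: "k \<in> mirrors" "mink v k = - sh" "mink k k = 1" using k by (auto simp: dirs_def mirrors_def)
  have mm: "mink m m = - (1 + sh * sh)" using v km
    by (simp add: m_def mink_simps mink_commute[of k v] hyp3_def algebra_simps)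
  have mk: "mink m k = 0" using km by (simp add: m_def mink_simps)
  define a where "a = mink h m"
  have a: "a = mink v h + sh * t" by (simp add: a_def m_def t_def mink_simps mink_commute)
  have far': "0 < mink v h + 2 * sh * t" using far by (simp add: mink_step t_def mink_commute[of k h])
  then have "0 < sh * t" "\<bar>a\<bar> < sh * t" using near a by linarith+
  then have "a * a < (sh * t) * (sh * t)"
    by (metis abs_ge_zero abs_mult_self_eq mult_strict_mono')
  then have a2: "a * a < sh * sh * (t * t)" by (simp add: ac_simps)
  \<comment> \<open>The component of \<open>h\<close> orthogonal to \<open>k\<close> and
    \<open>m\<close>; the coefficient of \<open>m\<close> has a plus sign because
    \<open>mink m m\<close> is negative.\<close>
  define r where "r = h - t *\<^sub>R k + (a / (1 + sh * sh)) *\<^sub>R m"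
  have pos: "0 < 1 + sh * sh" using sh_pos by (simp add: add_pos_pos)
  have km0: "mink k m = 0" using mk mink_commute[of k m] by simp
  have kh: "mink k h = t" by (simp add: t_def mink_commute)
  have mh: "mink m h = a" by (simp add: a_def mink_commute)
  have "a / (1 + sh * sh) * mink m m = - a" using pos unfolding mm by (simp add: field_simps)
  then have "mink r m = 0" using km0 by (simp add: r_def mink_simps a_def[symmetric])
  then have "0 \<le> mink r r" using orthogonal_timelike_nonneg[of m r] mm pos by simp
  also have "mink r r = mink r h - t * mink r k" 
    using \<open>mink r m = 0\<close> by (subst (2) r_def) (simp add: mink_simps)
  also have "mink r k = 0" using mk km by (simp add: r_def mink_simps t_def)
  also have "mink r h - t * 0 = 1 - t * t + a * a / (1 + sh * sh)"
    using h by (simp add: r_def mink_simps mirrors_def kh mh)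
  finally have "t * t \<le> 1 + a * a / (1 + sh * sh)" by simp
  then have "(t * t) * (1 + sh * sh) \<le> (1 + sh * sh) + a * a" using pos by (simp add: field_simps)
  then have "t * t < 1 + sh * sh" using a2 by (simp add: algebra_simps)
  then have "t = 0 \<or> h = k \<or> h = - k" using mirrors_discrete[OF h km(1)] by (simp add: t_def sh_sq)
  moreover have "t \<noteq> 0" using \<open>0 < sh * t\<close> by auto
  moreover have "h \<noteq> - k" using near km sh_pos by (auto simp: mink_simps)
  ultimately show ?thesis by blast
qed

section \<open>Vertices\<close>

text \<open>The icosahedron graph: vertex 0, its neighbours 1 to 5, the neighbours 6 to 10 of vertex 11.\<close>

definition ico_table :: "nat list list" where
  "ico_table = [[1,2,3,4,5], [0,2,5,6,10], [0,1,3,6,7], [0,2,4,7,8], [0,3,5,8,9], [0,1,4,9,10],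
     [1,2,7,10,11], [2,3,6,8,11], [3,4,7,9,11], [4,5,8,10,11], [1,5,6,9,11], [6,7,8,9,10]]"

definition adj :: "nat \<Rightarrow> nat \<Rightarrow> bool" where "adj i j \<longleftrightarrow> j \<in> set (ico_table ! i)"

text \<open>Only the Gram matrix enters, so isometries carry the property from vertex to
  vertex.\<close>

definition icosahedral :: "mvec set \<Rightarrow> bool" where
  "icosahedral N \<longleftrightarrow> (\<exists>f. N = f ` {..<12} \<and>
     (\<forall>i\<in>{..<12}. \<forall>j\<in>{..<12}. i \<noteq> j \<longrightarrow>
        (if adj i j then mink (f i) (f j) = 0 else mink (f i) (f j) \<le> -1)))"

text \<open>The oddness condition keeps all vertices off the mirrors.\<close>

definition vert :: "mvec set" where
  "vert = {v \<in> hyp3. (1 / sh) *\<^sub>R v \<in> lat \<and> (\<forall>h\<in>mirrors. \<exists>z\<in>Zphi. mink v h = sh * (1 + 2 * z)) \<and>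
     icosahedral (dirs v)}"

lemma vert_hyp3: "v \<in> vert \<Longrightarrow> v \<in> hyp3" by (simp add: vert_def)

lemma vert_off_mirror:
  assumes "v \<in> vert" "h \<in> mirrors" shows "mink v h \<noteq> 0"
proof -
  obtain z where "z \<in> Zphi" "mink v h = sh * (1 + 2 * z)" using assms by (auto simp: vert_def)
  then show ?thesis using odd_Zphi_nonzero[of z] sh_pos by auto
qed

text \<open>Points of opposite sheets have positive product, so one negative product decides the
  sheet.\<close>

lemma hyp3_from_neg:
  assumes "v \<in> hyp3" "mink u u = -1" "mink v u < 0" shows "u \<in> hyp3"
proof -
  have "0 < fst u"
  proof (rule ccontr)
    assume "\<not> 0 < fst u"
    moreover have "fst u \<noteq> 0"
    proof
      assume "fst u = 0"
      then have "mink u u = snd u \<bullet> snd u" by (simp add: mink_def)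
      then show False using assms(2) inner_ge_zero[of "snd u"] by linarith
    qed
    ultimately have "- u \<in> hyp3" using assms(2) by (simp add: hyp3_def mink_simps)
    from mink_hyp3_neg[OF assms(1) this] show False using assms(3) by (simp add: mink_simps)
  qed
  then show ?thesis using assms(2) by (simp add: hyp3_def)
qed

lemma dirs_mirrors: "k \<in> dirs v \<Longrightarrow> k \<in> mirrors"
  and dirs_mink: "k \<in> dirs v \<Longrightarrow> mink v k = - sh"
  and dirs_unit: "k \<in> dirs v \<Longrightarrow> mink k k = 1"
  by (auto simp: dirs_def mirrors_def)

lemma dirs_reflection:
  assumes k: "k \<in> mirrors" shows "dirs (reflection k v) = reflection k ` dirs v"
proof -
  have kk: "mink k k = 1" using k by (simp add: mirrors_def)
  show ?thesis
  proof (intro equalityI subsetI)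
    fix h assume h: "h \<in> dirs (reflection k v)"
    have "reflection k h \<in> mirrors" using h k mirrors_reflection dirs_mirrors by blast
    moreover have "mink v (reflection k h) = - sh"
      using h reflection_mink[OF kk, of "reflection k v" h] reflection_invol[OF kk]
      by (simp add: dirs_def)
    ultimately have "reflection k h \<in> dirs v" by (simp add: dirs_def)
    then show "h \<in> reflection k ` dirs v"
      using reflection_invol[OF kk, of h] by (metis imageI)
  next
    fix h assume "h \<in> reflection k ` dirs v"
    then obtain h' where "h' \<in> dirs v" "h = reflection k h'" by blast
    then show "h \<in> dirs (reflection k v)" using kk k
      by (simp add: dirs_def mirrors_reflection reflection_mink)
  qed
qed

lemma icosahedral_reflection:
  assumes "mink k k = 1" "icosahedral N" shows "icosahedral (reflection k ` N)"
proof -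
  obtain f where f: "N = f ` {..<12}"
     "\<forall>i\<in>{..<12}. \<forall>j\<in>{..<12}. i \<noteq> j \<longrightarrow>
        (if adj i j then mink (f i) (f j) = 0 else mink (f i) (f j) \<le> -1)"
    using assms(2) unfolding icosahedral_def by blast
  have "reflection k ` N = (reflection k \<circ> f) ` {..<12}" using f(1) by (simp add: image_comp)
  moreover have "mink ((reflection k \<circ> f) i) ((reflection k \<circ> f) j) = mink (f i) (f j)" for i j
    using assms(1) by (simp add: reflection_mink)
  ultimately show ?thesis unfolding icosahedral_def using f(2) by metis
qed

text \<open>Every condition in \<open>vert\<close> is invariant under reflections in mirrors, so the
  arithmetic and the icosahedron have to be verified at a single vertex only.\<close>

lemma reflection_vert:
  assumes v: "v \<in> vert" and k: "k \<in> mirrors" shows "reflection k v \<in> vert"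
proof -
  have kk: "mink k k = 1" using k by (simp add: mirrors_def)
  have vv: "mink v v = -1" using v by (simp add: vert_def hyp3_def)
  have "mink (reflection k v) (reflection k v) = -1" using vv reflection_mink[OF kk] by simp
  moreover have "mink v (reflection k v) = - 1 - 2 * (mink v k * mink v k)"
    using vv by (simp add: reflection_def mink_simps)
  then have "mink v (reflection k v) < 0" using zero_le_square[of "mink v k"] by linarith
  ultimately have "reflection k v \<in> hyp3" using hyp3_from_neg v vert_hyp3 by blast
  moreover have "(1 / sh) *\<^sub>R reflection k v \<in> lat"
  proof -
    have p: "(1 / sh) *\<^sub>R v \<in> lat" "k \<in> lat" using v k by (auto simp: vert_def mirrors_def)
    have "(1 / sh) *\<^sub>R reflection k v = (1 / sh) *\<^sub>R v - (2 * mink ((1 / sh) *\<^sub>R v) k) *\<^sub>R k"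
      by (simp add: reflection_def mink_simps scaleR_right_diff_distrib)
    then show ?thesis using p lat_mink[OF p] by (simp add: lat_diff lat_scale)
  qed
  moreover have "\<exists>z\<in>Zphi. mink (reflection k v) h = sh * (1 + 2 * z)" if h: "h \<in> mirrors" for h
  proof -
    have "mink (reflection k v) h = mink v (reflection k h)"
      using reflection_mink[OF kk, of v "reflection k h"] reflection_invol[OF kk] by simp
    then show ?thesis using v mirrors_reflection[OF h k] by (simp add: vert_def)
  qed
  moreover have "icosahedral (dirs (reflection k v))"
    using v icosahedral_reflection[OF kk] by (simp add: dirs_reflection[OF k] vert_def)
  ultimately show ?thesis by (simp add: vert_def)
qed

lemma step_vert: "v \<in> vert \<Longrightarrow> k \<in> dirs v \<Longrightarrow> step v k \<in> vert"
  using reflection_vert step_eq_reflection dirs_mirrors by metis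

lemma step_back:
  assumes "k \<in> dirs v" shows "- k \<in> dirs (step v k)" "step (step v k) (- k) = v"
proof -
  have "mink (step v k) (- k) = - sh" using dirs_mink[OF assms] dirs_unit[OF assms]
    by (simp add: mink_step mink_simps)
  then show "- k \<in> dirs (step v k)" using assms by (simp add: dirs_def mirrors_minus)
  show "step (step v k) (- k) = v" by (simp add: step_def)
qed

lemma dirs_step_orthogonal:
  assumes "k \<in> dirs v" "j \<in> dirs v" "mink k j = 0" shows "j \<in> dirs (step v k)"
  using assms by (simp add: dirs_def mink_step)

lemma finite_dirs: "v \<in> vert \<Longrightarrow> finite (dirs v)"
  by (auto simp: vert_def icosahedral_def)

lemma dirs_dichotomy:
  assumes "v \<in> vert" "j \<in> dirs v" "k \<in> dirs v"
  shows "j = k \<or> mink j k = 0 \<or> mink j k \<le> -1"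
proof -
  obtain f where f: "dirs v = f ` {..<12}"
     "\<forall>i\<in>{..<12}. \<forall>j\<in>{..<12}. i \<noteq> j \<longrightarrow>
        (if adj i j then mink (f i) (f j) = 0 else mink (f i) (f j) \<le> -1)"
    using assms(1) unfolding vert_def icosahedral_def by blast
  obtain a b where "j = f a" "k = f b" "a \<in> {..<12}" "b \<in> {..<12}" using assms f(1) by blast
  then show ?thesis using f(2) by (cases "a = b"; cases "adj a b") auto
qed

section \<open>An explicit vertex and its twelve directions\<close>

definition lvec :: "real \<Rightarrow> real \<Rightarrow> real \<Rightarrow> real \<Rightarrow> mvec" where
  "lvec t x y z = (sqrt phi * t, vector [x, y, z])"

lemma lvec_mink: "mink (lvec t x y z) (lvec t' x' y' z') = x * x' + y * y' + z * z' - phi * (t * t')"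
proof -
  have "sqrt phi * t * (sqrt phi * t') = phi * (t * t')" by (metis mult.assoc mult.left_commute sqrt_phi_sq)
  then show ?thesis by (simp add: mink_coords lvec_def vector_3)
qed

lemma lvec_lat: "t \<in> Zphi \<Longrightarrow> x \<in> Zphi \<Longrightarrow> y \<in> Zphi \<Longrightarrow> z \<in> Zphi \<Longrightarrow> lvec t x y z \<in> lat"
  by (auto simp: lat_def lvec_def forall_3 vector_3)

lemma lvec_cases: "\<exists>t x y z. p = lvec t x y z"
proof -
  have "p = lvec (fst p / sqrt phi) (snd p $ 1) (snd p $ 2) (snd p $ 3)"
    using phi_pos by (simp add: lvec_def prod_eq_iff vec_eq_iff forall_3 vector_3)
  then show ?thesis by blast
qed

lemma lvec_lat_cases:
  assumes "p \<in> lat"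
  obtains t x y z where "p = lvec t x y z" "t \<in> Zphi" "x \<in> Zphi" "y \<in> Zphi" "z \<in> Zphi"
proof -
  obtain t where "t \<in> Zphi" "fst p = sqrt phi * t" using assms by (auto simp: lat_def)
  moreover from this have "p = lvec t (snd p $ 1) (snd p $ 2) (snd p $ 3)"
    by (simp add: lvec_def prod_eq_iff vec_eq_iff forall_3 vector_3)
  ultimately show thesis using that assms by (auto simp: lat_def)
qed

text \<open>The order is that of \<open>ico_table\<close>. The first three entries point along the
  edges of \<open>base_cube\<close> at \<open>base_vert\<close>.\<close>

definition base_dirs :: "mvec list" where
  "base_dirs = [lvec 0 (-1) 0 0, lvec 0 0 (-1) 0, lvec 0 0 0 (-1), lvec 1 0 phi 0,
     lvec phi 0 phi phi, lvec 1 0 0 phi, lvec 1 phi 0 0, lvec phi phi phi 0,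
     lvec (1 + phi) phi (1 + phi) phi, lvec (1 + phi) phi phi (1 + phi), lvec phi phi 0 phi,
     lvec (1 + phi) (1 + phi) phi phi]"

definition base_vert :: mvec where "base_vert = sh *\<^sub>R lvec phi 1 1 1"

lemma lessThan_12: "{..<12::nat} = {0,1,2,3,4,5,6,7,8,9,10,11}"
  by (simp add: lessThan_nat_numeral lessThan_Suc insert_commute)

lemma phi_sq_left: "phi * (phi * x) = phi * x + x"
  by (metis distrib_right mult.assoc mult_1 phi_sq)

lemma base_dirs_gram:
  "\<forall>i\<in>{..<12}. \<forall>j\<in>{..<12}. i \<noteq> j \<longrightarrow> (if adj i j then mink (base_dirs ! i) (base_dirs ! j) = 0
     else mink (base_dirs ! i) (base_dirs ! j) \<le> -1)"
  unfolding lessThan_12 base_dirs_def adj_def ico_table_def using phi_bounds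
  by (simp add: lvec_mink algebra_simps phi_sq phi_sq_left)

lemma base_dirs_unit: "\<forall>h\<in>set base_dirs. mink h h = 1"
  unfolding base_dirs_def by (simp add: lvec_mink algebra_simps phi_sq phi_sq_left)

lemma base_dirs_lat: "\<forall>h\<in>set base_dirs. h \<in> lat"
  unfolding base_dirs_def by (simp add: lvec_lat)

lemma base_dirs_dirs: "set base_dirs \<subseteq> dirs base_vert"
  using base_dirs_unit base_dirs_lat
  unfolding base_dirs_def dirs_def mirrors_def base_vert_def
  by (simp add: lvec_mink mink_simps algebra_simps phi_sq phi_sq_left)

lemma base_vert_hyp3: "base_vert \<in> hyp3"
proof -
  have "mink base_vert base_vert = -1"
    unfolding base_vert_def mink_simps lvec_mink mult.assoc[symmetric] sh_sq
    by (simp add: algebra_simps phi_sq phi_sq_left)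
  moreover have "0 < fst base_vert" using sh_pos phi_pos by (simp add: base_vert_def lvec_def)
  ultimately show ?thesis by (simp add: hyp3_def)
qed

text \<open>Modulo 2 squaring is additive, and \<open>(phi + 1) * (phi + 1)\<close> is congruent to
  \<open>- phi\<close>, so the square of \<open>w\<close> is congruent to the norm of
  \<open>h\<close>, which is 1. In \<int>[phi] modulo 2, the field with four elements, only 1 has
  square 1.\<close>

lemma base_vert_odd:
  assumes "h \<in> mirrors" shows "\<exists>z\<in>Zphi. mink base_vert h = sh * (1 + 2 * z)"
proof -
  obtain t x y z where h: "h = lvec t x y z" and Z: "t \<in> Zphi" "x \<in> Zphi" "y \<in> Zphi" "z \<in> Zphi"
    using assms unfolding mirrors_def by (blast elim: lvec_lat_cases)
  define w where "w = x + y + z - (phi + 1) * t"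
  have m: "mink base_vert h = sh * w"
    by (simp add: base_vert_def h mink_simps lvec_mink w_def algebra_simps phi_sq phi_sq_left)
  have "w \<in> Zphi" using Z by (simp add: w_def)
  then obtain a b :: int where w: "w = of_int a + of_int b * phi" by (auto simp: Zphi_def conj_pair_def)
  have n: "x * x + y * y + z * z - phi * (t * t) = 1" using assms by (simp add: mirrors_def h lvec_mink)
  define e where "e = x * y + y * z + x * z - (phi + 1) * (t * (x + y + z)) + (2 * phi + 1) * (t * t)"
  have "w * w = 1 + 2 * e"
  proof -
    have "w * w = (x * x + y * y + z * z - phi * (t * t)) + 2 * e"
      unfolding w_def e_def by (simp add: algebra_simps phi_sq phi_sq_left)
    then show ?thesis using n by simp
  qed
  moreover have "e \<in> Zphi" using Z by (simp add: e_def)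
  then obtain c d :: int where e: "e = of_int c + of_int d * phi" by (auto simp: Zphi_def conj_pair_def)
  ultimately have "of_int (a * a + b * b - 1 - 2 * c) + of_int (2 * a * b + b * b - 2 * d) * phi = (0::real)"
    unfolding w e by (simp add: algebra_simps phi_sq phi_sq_left)
  from int_phi_eq_0[OF this]
  have eqs: "a * a + b * b - 1 - 2 * c = 0" "2 * a * b + b * b - 2 * d = 0" by auto
  have "even (b * b)" using eqs(2) by (metis dvd_add_right_iff dvd_triv_left mult.assoc eq_iff_diff_eq_0)
  then have "even b" by simp
  have "odd (a * a)"
  proof
    assume "even (a * a)"
    then have "even (a * a + b * b - 2 * c)" using \<open>even (b * b)\<close> by simp
    moreover have "a * a + b * b - 2 * c = 1" using eqs(1) by simp
    ultimately show False by simp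
  qed
  then have "odd a" by simp
  obtain a' b' where "a = 1 + 2 * a'" "b = 2 * b'"
    using \<open>odd a\<close> \<open>even b\<close> by (metis evenE oddE add.commute)
  then have "w = 1 + 2 * (of_int a' + of_int b' * phi)" using w by simp
  then show ?thesis using m by (intro bexI[of _ "of_int a' + of_int b' * phi"]) simp_all
qed

text \<open>An unlisted direction has nonpositive product with all twelve listed ones. These
  inequalities, the norm and the product with \<open>base_vert\<close> force \<open>t = phi\<close>
  and spatial coordinates among 0 and \<open>phi\<close> with sum \<open>2 * phi\<close>; then two
  of them equal \<open>phi\<close>, against the bound on the sum of two.\<close>

lemma base_dirs_complete: "dirs base_vert \<subseteq> set base_dirs"
proof
  fix h assume h: "h \<in> dirs base_vert"
  show "h \<in> set base_dirs"
  proof (rule ccontr)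
    assume no: "h \<notin> set base_dirs"
    have nonpos: "mink h k \<le> 0" if k: "k \<in> set base_dirs" for k
    proof (rule ccontr)
      assume pos: "\<not> mink h k \<le> 0"
      have kn: "k \<in> dirs base_vert" using k base_dirs_dirs by blast
      \<comment> \<open>Up to 1/2 discreteness applies directly; beyond 1/2 the edge along
        \<open>k\<close> already crosses \<open>h\<close>.\<close>
      show False
      proof (cases "mink h k \<le> 1 / 2")
        case True
        then have "mink h k * mink h k \<le> (1 / 2) * (1 / 2)" using pos by (intro mult_mono) auto
        then have "mink h k * mink h k < 1 + phi / 2" using phi_pos by simp
        from mirrors_discrete[OF dirs_mirrors[OF h] dirs_mirrors[OF kn] this]
        have "h = k \<or> h = - k" using pos by auto
        then show False using True pos dirs_unit[OF kn] by (auto simp: mink_simps)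
      next
        case False
        have "0 < sh * (2 * mink h k - 1)" using False sh_pos by simp
        then have "0 < mink (step base_vert k) h"
          using h by (simp add: mink_step dirs_def mink_commute[of k h] algebra_simps)
        moreover have "mink base_vert h < 0" using h sh_pos by (simp add: dirs_def)
        ultimately have "h = k" using edge_crosses_one_mirror[OF base_vert_hyp3 kn] h dirs_mirrors by blast
        then show False using no k by simp
      qed
    qed
    obtain t x y z where hh: "h = lvec t x y z" using lvec_cases by blast
    have "sh * (x + y + z - (phi + 1) * t) = sh * (-1)"
      using dirs_mink[OF h]
      by (simp add: base_vert_def hh mink_simps lvec_mink algebra_simps phi_sq phi_sq_left)
    then have "x + y + z - (phi + 1) * t = -1" using sh_pos unfolding mult_cancel_left by simp
    then have lin: "x + y + z = (phi + 1) * t - 1" by simp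
    have norm: "x * x + y * y + z * z = 1 + phi * (t * t)"
      using dirs_unit[OF h] by (simp add: hh lvec_mink)
    have all: "\<forall>k\<in>set base_dirs. mink h k \<le> 0" using nonpos by blast
    have ineq: "0 \<le> x" "0 \<le> y" "0 \<le> z" "phi * y \<le> phi * t" "phi * z \<le> phi * t" "phi * x \<le> phi * t"
       "phi * (y + z) \<le> phi * (phi * t)" "phi * (x + y) \<le> phi * (phi * t)" "phi * (x + z) \<le> phi * (phi * t)"
       "(phi + 1) * x + phi * (y + z) \<le> phi * ((phi + 1) * t)"
       "(phi + 1) * y + phi * (x + z) \<le> phi * ((phi + 1) * t)"
       "(phi + 1) * z + phi * (x + y) \<le> phi * ((phi + 1) * t)"
      using all unfolding base_dirs_def hh by (simp_all add: lvec_mink algebra_simps)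
    have ub: "x \<le> t" "y \<le> t" "z \<le> t" "y + z \<le> phi * t" "x + y \<le> phi * t" "x + z \<le> phi * t"
      using ineq(4-9) phi_pos by simp_all
    have le_phi: "u \<le> phi" if "(phi + 1) * u + phi * (x + y + z - u) \<le> phi * ((phi + 1) * t)" for u
      using that unfolding lin by (simp add: algebra_simps)
    have ub': "x \<le> phi" "y \<le> phi" "z \<le> phi"
      using ineq(10-12) by (auto intro!: le_phi simp: algebra_simps)
    have t0: "0 < t"
    proof -
      have "0 < (phi + 1) * t" using lin ineq(1-3) by linarith
      then show ?thesis using phi_pos by (simp add: zero_less_mult_iff)
    qed
    \<comment> \<open>The coordinates are bounded both by \<open>t\<close> and by
      \<open>phi\<close>. Bounding the squares by the first gives \<open>phi \<le> t\<close>, by the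
      second \<open>t \<le> phi\<close>, and equality then holds in every estimate.\<close>
    have "x * x + y * y + z * z \<le> x * t + y * t + z * t"
      using ub ineq by (intro add_mono mult_left_mono) auto
    also have "\<dots> = (x + y + z) * t" by (simp add: algebra_simps)
    finally have "0 \<le> (t - phi) * (t + phi - 1)"
      unfolding norm lin by (simp add: algebra_simps phi_sq phi_sq_left)
    moreover have "0 < t + phi - 1" using t0 phi_bounds by simp
    ultimately have t1: "phi \<le> t" by (simp add: zero_le_mult_iff)
    have "x * x + y * y + z * z \<le> x * phi + y * phi + z * phi"
      using ub' ineq by (intro add_mono mult_left_mono) auto
    also have "\<dots> = (x + y + z) * phi" by (simp add: algebra_simps)
    finally have "phi * ((t - phi) * (t - 1)) \<le> 0"
      unfolding norm lin by (simp add: algebra_simps phi_sq phi_sq_left)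
    then have "(t - phi) * (t - 1) \<le> 0" using phi_pos by (simp add: mult_le_0_iff)
    moreover have "1 < t" using t1 phi_bounds by linarith
    ultimately have "t \<le> phi" by (simp add: mult_le_0_iff)
    then have t: "t = phi" using t1 by simp
    have sum: "x + y + z = 2 * phi" unfolding lin t by (simp add: algebra_simps phi_sq)
    have "x * (phi - x) + y * (phi - y) + z * (phi - z) = (x + y + z) * phi - (x * x + y * y + z * z)"
      by (simp add: algebra_simps)
    also have "\<dots> = 0" unfolding sum norm t by (simp add: algebra_simps phi_sq phi_sq_left)
    finally have z0: "x * (phi - x) + y * (phi - y) + z * (phi - z) = 0" .
    have nn: "0 \<le> x * (phi - x)" "0 \<le> y * (phi - y)" "0 \<le> z * (phi - z)" using ub' ineq by simp_all
    then have "x * (phi - x) = 0" "y * (phi - y) = 0" "z * (phi - z) = 0" using z0 by linarith+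
    then have c: "x = 0 \<or> x = phi" "y = 0 \<or> y = phi" "z = 0 \<or> z = phi" by auto
    have b: "y + z \<le> phi + 1" "x + y \<le> phi + 1" "x + z \<le> phi + 1" using ub(4-6) by (simp_all add: t phi_sq)
    show False using c b sum phi_bounds by auto
  qed
qed

lemma base_vert_vert: "base_vert \<in> vert"
proof -
  have "dirs base_vert = (!) base_dirs ` {..<12}"
  proof -
    have "length base_dirs = 12" by (simp add: base_dirs_def)
    then have "set base_dirs = (!) base_dirs ` {..<12}" by (metis atLeast0LessThan list.set_map map_nth set_upt)
    then show ?thesis using base_dirs_dirs base_dirs_complete by blast
  qed
  then have "icosahedral (dirs base_vert)" unfolding icosahedral_def using base_dirs_gram by blast
  moreover have "(1 / sh) *\<^sub>R base_vert \<in> lat" using sh_pos by (simp add: base_vert_def lvec_lat)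
  ultimately show ?thesis using base_vert_hyp3 base_vert_odd by (simp add: vert_def)
qed

section \<open>Cubes\<close>

lemma mink_orthogonal_independent:
  assumes "finite B" "\<And>b. b \<in> B \<Longrightarrow> mink b b \<noteq> 0"
    and "\<And>b c. b \<in> B \<Longrightarrow> c \<in> B \<Longrightarrow> b \<noteq> c \<Longrightarrow> mink b c = 0"
  shows "independent B"
proof
  assume "dependent B"
  then obtain u v where v: "v \<in> B" "u v \<noteq> 0" and s: "(\<Sum>b\<in>B. u b *\<^sub>R b) = 0"
    using dependent_finite[OF assms(1)] by blast
  have "0 = mink v (\<Sum>b\<in>B. u b *\<^sub>R b)" by (simp add: s mink_simps)
  also have "\<dots> = (\<Sum>b\<in>B. u b * mink v b)" by (simp add: mink_sum_right mink_simps)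
  also have "\<dots> = (\<Sum>b\<in>B. if b = v then u v * mink v v else 0)"
    using assms(3) v(1) by (intro sum.cong) auto
  also have "\<dots> = u v * mink v v" using assms(1) v(1) by simp
  finally show False using v assms(2) by simp
qed

text \<open>A triangle of the icosahedron of directions, which stands for a cube with corner
  \<open>v\<close>.\<close>

definition tri :: "mvec \<Rightarrow> mvec set \<Rightarrow> bool" where
  "tri v K \<longleftrightarrow> K \<subseteq> dirs v \<and> card K = 3 \<and> (\<forall>j\<in>K. \<forall>k\<in>K. j \<noteq> k \<longrightarrow> mink j k = 0)"

text \<open>The centre of the cube up to scale: multiplied by \<open>sh\<close> it is the average of
  the eight corners \<open>v + 2 * sh * \<Sum>J\<close> with \<open>J \<subseteq> K\<close>.\<close>

definition ctr :: "mvec \<Rightarrow> mvec set \<Rightarrow> mvec" where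
  "ctr v K = (1 / sh) *\<^sub>R v + \<Sum>K"

text \<open>The cube at \<open>v\<close> whose edges at \<open>v\<close> have the directions \<open>K\<close>. Its faces through \<open>v\<close> are the
  ones with \<open>s = -1\<close>; the coefficients are the powers \<open>phi\<^sup>2 = phi + 1\<close> and \<open>phi\<^sup>3 = 2 * phi + 1\<close>.\<close>

definition nrm :: "mvec \<Rightarrow> mvec set \<Rightarrow> real \<Rightarrow> mvec \<Rightarrow> mvec" where
  "nrm v K s k = (1 / (sqrt 2 * (phi + 1))) *\<^sub>R (ctr v K + (s * (2 * phi + 1)) *\<^sub>R k)"

definition cube :: "mvec \<Rightarrow> mvec set \<Rightarrow> mvec set" where
  "cube v K = {nrm v K s k | s k. k \<in> K \<and> (s = 1 \<or> s = -1)}"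

lemma tri_finite: "tri v K \<Longrightarrow> finite K"
  unfolding tri_def by (metis card.infinite zero_neq_numeral)

lemma tri_dirs: "tri v K \<Longrightarrow> k \<in> K \<Longrightarrow> k \<in> dirs v" by (auto simp: tri_def)

lemma tri_orthogonal: "tri v K \<Longrightarrow> j \<in> K \<Longrightarrow> k \<in> K \<Longrightarrow> j \<noteq> k \<Longrightarrow> mink j k = 0"
  by (auto simp: tri_def)

lemma tri_unit: "tri v K \<Longrightarrow> k \<in> K \<Longrightarrow> mink k k = 1" using tri_dirs dirs_unit by blast

lemma tri_mink: "tri v K \<Longrightarrow> j \<in> K \<Longrightarrow> k \<in> K \<Longrightarrow> mink j k = (if j = k then 1 else 0)"
  using tri_unit tri_orthogonal by auto

lemma tri_mink_sum:
  assumes "tri v K" "J \<subseteq> K" "k \<in> K" shows "mink k (\<Sum>J) = (if k \<in> J then 1 else 0)"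
proof -
  have "finite J" using assms tri_finite finite_subset by blast
  have "mink k (\<Sum>J) = (\<Sum>j\<in>J. mink k j)" using mink_sum_right[of k id J] by simp
  also have "\<dots> = (\<Sum>j\<in>J. if j = k then 1 else 0)"
  proof (rule sum.cong[OF refl])
    fix j assume "j \<in> J"
    then have "j \<in> K" using assms(2) by blast
    then show "mink k j = (if j = k then 1 else 0)" using tri_mink[OF assms(1,3)] by simp
  qed
  also have "\<dots> = (if k \<in> J then 1 else 0)" using \<open>finite J\<close> by simp
  finally show ?thesis .
qed

lemma tri_mink_vertex_sum:
  assumes "tri v K" "J \<subseteq> K" shows "mink v (\<Sum>J) = - sh * card J"
proof -
  have "mink v (\<Sum>J) = (\<Sum>j\<in>J. mink v j)" using mink_sum_right[of v id J] by simp
  also have "\<dots> = (\<Sum>j\<in>J. - sh)" using assms tri_dirs dirs_mink by (intro sum.cong) blast+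
  finally show ?thesis by simp
qed

lemma ctr_mink:
  assumes "tri v K" "k \<in> K" shows "mink k (ctr v K) = 0"
  using tri_mink_sum[OF assms(1) subset_refl assms(2)] dirs_mink[OF tri_dirs[OF assms]] sh_pos assms(2)
    mink_commute[of k v]
  by (simp add: ctr_def mink_simps)

lemma ctr_vertex:
  assumes "v \<in> hyp3" "tri v K" shows "mink v (ctr v K) = - (2 * phi + 1) * sh"
proof -
  have "mink v v = -1" using assms by (simp add: hyp3_def)
  then have 1: "mink v (ctr v K) = - (1 / sh) - 3 * sh"
    using tri_mink_vertex_sum[OF assms(2) subset_refl] assms(2) by (simp add: ctr_def mink_simps tri_def)
  have "sh * (- (1 / sh) - 3 * sh) = - 1 - 3 * (sh * sh)" using sh_pos by (simp add: algebra_simps)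
  also have "\<dots> = - (2 * phi + 1) * (sh * sh)" unfolding sh_sq by (simp add: algebra_simps phi_sq)
  also have "\<dots> = sh * (- (2 * phi + 1) * sh)" by simp
  finally show ?thesis unfolding 1 using sh_pos by (simp only: mult_cancel_left) auto
qed

lemma ctr_norm:
  assumes "v \<in> hyp3" "tri v K" shows "mink (ctr v K) (ctr v K) = - (2 * phi + 1)"
proof -
  have s: "mink (\<Sum>K) (ctr v K) = 0"
  proof -
    have "mink (\<Sum>K) (ctr v K) = mink (ctr v K) (\<Sum>K)" by (rule mink_commute)
    also have "\<dots> = (\<Sum>k\<in>K. mink (ctr v K) k)" using mink_sum_right[of "ctr v K" id K] by simp
    also have "\<dots> = (\<Sum>k\<in>K. 0)" using ctr_mink[OF assms(2)] by (intro sum.cong) (auto simp: mink_commute)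
    finally show ?thesis by simp
  qed
  have "mink (ctr v K) (ctr v K) = (1 / sh) * mink v (ctr v K) + mink (\<Sum>K) (ctr v K)"
    by (subst (1) ctr_def) (simp add: mink_simps)
  then show ?thesis using s ctr_vertex[OF assms] sh_pos by simp
qed

lemma ctr_neg:
  assumes "v \<in> hyp3" "tri v K" "x \<in> hyp3" shows "mink x (ctr v K) < 0"
proof -
  define a where "a = 1 / sqrt (2 * phi + 1)"
  have a: "0 < a" using phi_pos by (simp add: a_def)
  have "a * a * (2 * phi + 1) = 1" using phi_pos by (simp add: a_def)
  then have "mink (a *\<^sub>R ctr v K) (a *\<^sub>R ctr v K) = -1"
    using ctr_norm[OF assms(1,2)] by (simp add: mink_simps mult.assoc[symmetric]) (simp add: algebra_simps)
  moreover have "mink v (a *\<^sub>R ctr v K) < 0"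
    using a ctr_vertex[OF assms(1,2)] sh_pos phi_pos by (simp add: mink_simps mult_pos_neg mult_neg_pos)
  ultimately have "a *\<^sub>R ctr v K \<in> hyp3" using hyp3_from_neg assms(1) by blast
  from mink_hyp3_neg[OF assms(3) this] show ?thesis using a by (simp add: mink_simps mult_less_0_iff)
qed

text \<open>The centre and the three directions form an orthogonal basis of the four-dimensional
  space. The minus sign comes from the timelike centre, whose norm is
  \<open>- (2 * phi + 1)\<close>.\<close>

lemma cube_expansion:
  assumes "v \<in> hyp3" "tri v K"
  shows "x = (- (mink x (ctr v K) / (2 * phi + 1))) *\<^sub>R ctr v K + (\<Sum>k\<in>K. mink x k *\<^sub>R k)"
proof -
  let ?c = "ctr v K" and ?B = "insert (ctr v K) K"
  have fin: "finite K" using tri_finite assms by blast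
  have cn: "mink ?c ?c \<noteq> 0" using ctr_norm[OF assms] phi_pos by simp
  then have "?c \<notin> K" using ctr_mink[OF assms(2)] by blast
  then have card: "card ?B = 4" using fin assms(2) by (simp add: tri_def)
  have "independent ?B"
  proof (rule mink_orthogonal_independent)
    show "finite ?B" using fin by simp
    show "mink b b \<noteq> 0" if "b \<in> ?B" for b
      using that cn tri_unit[OF assms(2), of b] by (cases "b = ?c") simp_all
    show "mink b c = 0" if "b \<in> ?B" "c \<in> ?B" "b \<noteq> c" for b c
      using that ctr_mink[OF assms(2), of b] ctr_mink[OF assms(2), of c]
        tri_orthogonal[OF assms(2), of b c] mink_commute[of ?c c] by (cases "b = ?c"; cases "c = ?c") simp_all
  qed
  moreover have "dim (UNIV :: mvec set) \<le> card ?B" using card by (simp add: dim_UNIV)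
  ultimately have span: "UNIV \<subseteq> span ?B" by (intro card_ge_dim_independent) auto
  define r where "r = x - ((- (mink x ?c / (2 * phi + 1))) *\<^sub>R ?c + (\<Sum>k\<in>K. mink x k *\<^sub>R k))"
  have sum0: "mink b (\<Sum>k\<in>K. mink x k *\<^sub>R k) = (\<Sum>k\<in>K. mink x k * mink b k)" for b
    by (simp add: mink_sum_right mink_simps)
  have "mink ?c r = 0"
  proof -
    have "mink ?c (\<Sum>k\<in>K. mink x k *\<^sub>R k) = 0" unfolding sum0
      using ctr_mink[OF assms(2)] by (intro sum.neutral) (auto simp: mink_commute)
    moreover have "mink x ?c / (2 * phi + 1) * (- (2 * phi + 1)) = - mink x ?c" using phi_pos by (simp add: field_simps)
    ultimately show ?thesis
      using ctr_norm[OF assms] mink_commute[of ?c x] by (simp add: r_def mink_simps del: minus_add_distrib)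
  qed
  moreover have "mink b r = 0" if b: "b \<in> K" for b
  proof -
    have "(\<Sum>k\<in>K. mink x k * mink b k) = (\<Sum>k\<in>K. if k = b then mink x b else 0)"
      using tri_mink[OF assms(2) b] by (intro sum.cong) auto
    then have "mink b (\<Sum>k\<in>K. mink x k *\<^sub>R k) = mink x b" unfolding sum0 using fin b by simp
    then show ?thesis using ctr_mink[OF assms(2) b] mink_commute[of b x] by (simp add: r_def mink_simps)
  qed
  ultimately have B: "mink b r = 0" if "b \<in> ?B" for b using that by blast
  have "mink q r = 0" for q
  proof -
    have "q \<in> span ?B" using span by blast
    then show ?thesis
      by (induction rule: span_induct_alt) (simp_all add: mink_simps B)
  qed
  then have "r = 0" using mink_nondegenerate[of r] mink_commute by metis
  then show ?thesis by (simp add: r_def)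
qed

lemma nrm_mink_eq: "mink x (nrm v K s k) = (1 / (sqrt 2 * (phi + 1))) * (mink x (ctr v K) + s * (2 * phi + 1) * mink x k)"
  by (simp add: nrm_def mink_simps)

lemma nrm_zero_iff: "mink x (nrm v K s k) = 0 \<longleftrightarrow> mink x (ctr v K) + s * (2 * phi + 1) * mink x k = 0"
  using phi_pos by (simp add: nrm_mink_eq)

lemma nrm_nonpos_iff: "mink x (nrm v K s k) \<le> 0 \<longleftrightarrow> mink x (ctr v K) + s * (2 * phi + 1) * mink x k \<le> 0"
proof -
  have "0 < 1 / (sqrt 2 * (phi + 1))" using phi_pos by simp
  then show ?thesis unfolding nrm_mink_eq by (simp only: mult_le_0_iff) auto
qed

lemma nrm_inject:
  assumes "tri v K" "j \<in> K" "k \<in> K" "s = 1 \<or> s = -1" "t = 1 \<or> t = -1" "nrm v K s j = nrm v K t k"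
  shows "s = t \<and> j = k"
proof -
  have "mink j (nrm v K s j) = mink j (nrm v K t k)" using assms(6) by simp
  then have "s * (2 * phi + 1) * mink j j = t * (2 * phi + 1) * mink j k"
    using phi_pos by (simp add: nrm_mink_eq)
  then have "s * mink j j = t * mink j k" using phi_pos by simp
  then show ?thesis using assms(4,5) tri_mink[OF assms(1,2)] assms(2,3) by (auto split: if_splits)
qed

text \<open>Seen from the other end of the edge \<open>k\<close>, the same cube has
  \<open>- k\<close> in place of \<open>k\<close>; the centre does not move.\<close>

lemma ctr_step:
  assumes "tri v K" "k \<in> K" shows "ctr (step v k) (insert (- k) (K - {k})) = ctr v K"
proof -
  have nk: "- k \<notin> K"
  proof
    assume "- k \<in> K"
    then have "mink v (- k) = - sh" using assms tri_dirs dirs_mink by blast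
    then show False using dirs_mink[OF tri_dirs[OF assms]] sh_pos by (simp add: mink_simps)
  qed
  have fin: "finite K" using assms tri_finite by blast
  have "\<Sum>(insert (- k) (K - {k})) = - k + (\<Sum>K - k)"
    using fin nk assms(2) by (simp add: sum_diff1)
  moreover have "(1 / sh) *\<^sub>R step v k = (1 / sh) *\<^sub>R v + 2 *\<^sub>R k" using sh_pos by (simp add: step_def algebra_simps)
  ultimately show ?thesis by (simp add: ctr_def algebra_simps scaleR_2)
qed

lemma nrm_step:
  assumes "tri v K" "k \<in> K"
  shows "nrm (step v k) (insert (- k) (K - {k})) s j = nrm v K s j"
  by (simp add: nrm_def ctr_step[OF assms])

lemma nrm_minus: "nrm v K s (- k) = nrm v K (- s) k"
  by (simp add: nrm_def)

lemma tri_step: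
  assumes "v \<in> vert" "tri v K" "k \<in> K" shows "tri (step v k) (insert (- k) (K - {k}))"
proof -
  have fin: "finite K" using assms tri_finite by blast
  have kn: "k \<in> dirs v" using assms tri_dirs by blast
  have "- k \<notin> K"
  proof
    assume "- k \<in> K"
    then have "mink v (- k) = - sh" using assms tri_dirs dirs_mink by blast
    then show False using dirs_mink[OF kn] sh_pos by (simp add: mink_simps)
  qed
  moreover have "card (K - {k}) = 2" using assms by (simp add: tri_def)
  ultimately have "card (insert (- k) (K - {k})) = 3" using fin by simp
  moreover have "insert (- k) (K - {k}) \<subseteq> dirs (step v k)"
    using step_back(1)[OF kn] dirs_step_orthogonal[OF kn] tri_dirs[OF assms(2)] tri_orthogonal[OF assms(2,3)] by blast
  moreover have "mink i j = 0" if "i \<in> insert (- k) (K - {k})" "j \<in> insert (- k) (K - {k})" "i \<noteq> j" for i j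
    using that tri_orthogonal[OF assms(2), of i j] tri_orthogonal[OF assms(2), of i k]
      tri_orthogonal[OF assms(2), of k j] assms(3)
    by (cases "i = - k"; cases "j = - k") (auto simp: mink_simps)
  ultimately show ?thesis by (simp add: tri_def)
qed

lemma cube_step:
  assumes "tri v K" "k \<in> K" shows "cube (step v k) (insert (- k) (K - {k})) = cube v K"
proof (intro equalityI subsetI)
  fix n assume "n \<in> cube (step v k) (insert (- k) (K - {k}))"
  then obtain s j where j: "n = nrm v K s j" "j \<in> insert (- k) (K - {k})" "s = 1 \<or> s = -1"
    unfolding cube_def nrm_step[OF assms] by blast
  show "n \<in> cube v K"
  proof (cases "j = - k")
    case True
    then have "n = nrm v K (- s) k" using j nrm_minus by simp
    moreover have "- s = 1 \<or> - s = -1" using j by auto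
    ultimately show ?thesis unfolding cube_def using assms(2) by blast
  next
    case False
    then show ?thesis unfolding cube_def using j by blast
  qed
next
  fix n assume "n \<in> cube v K"
  then obtain s j where j: "n = nrm v K s j" "j \<in> K" "s = 1 \<or> s = -1"
    unfolding cube_def by blast
  show "n \<in> cube (step v k) (insert (- k) (K - {k}))"
  proof (cases "j = k")
    case True
    then have "n = nrm v K (- s) (- k)" using j nrm_minus by simp
    moreover have "- s = 1 \<or> - s = -1" using j by auto
    ultimately show ?thesis unfolding cube_def nrm_step[OF assms] by blast
  next
    case False
    then show ?thesis unfolding cube_def nrm_step[OF assms] using j by blast
  qed
qed

lemma cube_corner:
  assumes "v \<in> vert" "tri v K" "J \<subseteq> K"
  shows "\<exists>K'. v + (2 * sh) *\<^sub>R \<Sum>J \<in> vert \<and> tri (v + (2 * sh) *\<^sub>R \<Sum>J) K' \<and> cube (v + (2 * sh) *\<^sub>R \<Sum>J) K' = cube v K"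
proof -
  have "finite J" using assms tri_finite finite_subset by blast
  then show ?thesis using assms
  proof (induction J arbitrary: v K rule: finite_induct)
    case empty
    then show ?case by auto
  next
    case (insert j J)
    let ?v = "step v j" and ?K = "insert (- j) (K - {j})"
    have j: "j \<in> K" "j \<in> dirs v" using insert.prems tri_dirs by blast+
    have "?v \<in> vert" "tri ?v ?K" "J \<subseteq> ?K"
      using step_vert tri_step insert j by auto
    from insert.IH[OF this] obtain K' where
      "?v + (2 * sh) *\<^sub>R \<Sum>J \<in> vert" "tri (?v + (2 * sh) *\<^sub>R \<Sum>J) K'" "cube (?v + (2 * sh) *\<^sub>R \<Sum>J) K' = cube v K"
      using cube_step[OF insert.prems(2) j(1)] by auto
    moreover have "?v + (2 * sh) *\<^sub>R \<Sum>J = v + (2 * sh) *\<^sub>R \<Sum>(insert j J)"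
      using insert.hyps by (simp add: step_def algebra_simps)
    ultimately show ?case by auto
  qed
qed

section \<open>Corners, edges and faces of a cube\<close>

lemma corner_mink:
  assumes "v \<in> hyp3" "tri v K" "J \<subseteq> K"
  shows "mink (v + (2 * sh) *\<^sub>R \<Sum>J) (ctr v K) = - (2 * phi + 1) * sh"
    and "k \<in> K \<Longrightarrow> mink (v + (2 * sh) *\<^sub>R \<Sum>J) k = (if k \<in> J then sh else - sh)"
proof -
  have "mink (\<Sum>J) (ctr v K) = mink (ctr v K) (\<Sum>J)" by (rule mink_commute)
  also have "\<dots> = (\<Sum>j\<in>J. mink (ctr v K) j)" using mink_sum_right[of "ctr v K" id J] by simp
  also have "\<dots> = 0" using ctr_mink[OF assms(2)] assms(3) by (intro sum.neutral) (auto simp: mink_commute)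
  finally show "mink (v + (2 * sh) *\<^sub>R \<Sum>J) (ctr v K) = - (2 * phi + 1) * sh"
    using ctr_vertex[OF assms(1,2)] by (simp add: mink_simps)
  show "mink (v + (2 * sh) *\<^sub>R \<Sum>J) k = (if k \<in> J then sh else - sh)" if "k \<in> K"
    using tri_mink_sum[OF assms(2,3) that] dirs_mink[OF tri_dirs[OF assms(2) that]] mink_commute[of "\<Sum>J" k]
    by (simp add: mink_simps)
qed

lemma corner_nrm:
  assumes "v \<in> hyp3" "tri v K" "J \<subseteq> K" "k \<in> K" "s = 1 \<or> s = -1"
  shows "mink (v + (2 * sh) *\<^sub>R \<Sum>J) (nrm v K s k) \<le> 0"
    and "mink (v + (2 * sh) *\<^sub>R \<Sum>J) (nrm v K s k) = 0 \<longleftrightarrow> s = (if k \<in> J then 1 else -1)"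
proof -
  let ?x = "v + (2 * sh) *\<^sub>R \<Sum>J"
  define e :: real where "e = (if k \<in> J then 1 else -1)"
  have "mink ?x k = e * sh" using corner_mink(2)[OF assms(1-4)] by (simp add: e_def)
  then have eq: "mink ?x (ctr v K) + s * (2 * phi + 1) * mink ?x k = ((2 * phi + 1) * sh) * (s * e - 1)"
    using corner_mink(1)[OF assms(1-3)] by (simp add: algebra_simps)
  have pos: "0 < (2 * phi + 1) * sh" using sh_pos phi_pos by simp
  have e: "e = 1 \<or> e = -1" by (auto simp: e_def)
  then have "s * e - 1 \<le> 0" "s * e - 1 = 0 \<longleftrightarrow> s = e" using assms(5) by auto
  then show "mink ?x (nrm v K s k) \<le> 0" "mink ?x (nrm v K s k) = 0 \<longleftrightarrow> s = (if k \<in> J then 1 else -1)"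
    unfolding nrm_nonpos_iff nrm_zero_iff eq e_def[symmetric] using pos
    by (auto simp: mult_le_0_iff)
qed

lemma corner_zero_normals:
  assumes "v \<in> hyp3" "tri v K" "J \<subseteq> K"
  shows "{n \<in> cube v K. mink (v + (2 * sh) *\<^sub>R \<Sum>J) n = 0} = (\<lambda>k. nrm v K (if k \<in> J then 1 else -1) k) ` K"
  (is "?L = ?R")
proof (intro equalityI subsetI)
  fix n assume "n \<in> ?L"
  then obtain s k where "n = nrm v K s k" "k \<in> K" "s = 1 \<or> s = -1" "mink (v + (2 * sh) *\<^sub>R \<Sum>J) n = 0"
    by (auto simp: cube_def)
  then show "n \<in> ?R" using corner_nrm(2)[OF assms, of k s] by auto
next
  fix n assume "n \<in> ?R"
  then obtain k where k: "k \<in> K" "n = nrm v K (if k \<in> J then 1 else -1) k" by blast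
  have "(if k \<in> J then 1 else - 1 :: real) = 1 \<or> (if k \<in> J then 1 else - 1 :: real) = -1" by simp
  then show "n \<in> ?L" using k corner_nrm(2)[OF assms k(1), of "if k \<in> J then 1 else -1"]
    unfolding cube_def by blast
qed

text \<open>Three faces through a point fix its products with the three directions up to signs and a
  common factor. The norm -1 determines the factor as \<open>sh\<close>, and the signs select
  \<open>J\<close>.\<close>

lemma cube_verts_cube:
  assumes "v \<in> vert" "tri v K"
  shows "cube_verts (cube v K) = {v + (2 * sh) *\<^sub>R \<Sum>J | J. J \<subseteq> K}"
proof (intro equalityI subsetI)
  have h: "v \<in> hyp3" using assms vert_hyp3 by blast
  have fin: "finite K" using assms tri_finite by blast
  fix x assume "x \<in> cube_verts (cube v K)"
  then have x: "x \<in> hyp3" "card {n \<in> cube v K. mink x n = 0} = 3"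
    by (auto simp: cube_verts_def solid_def)
  define X where "X = mink x (ctr v K)"
  have X: "X < 0" using ctr_neg[OF h assms(2) x(1)] by (simp add: X_def)
  \<comment> \<open>Opposite faces have no common point, so the three faces through \<open>x\<close>
    belong to three different directions: \<open>Z\<close> is all of \<open>K\<close>, and
    \<open>g\<close> records which of the two faces is met.\<close>
  define Z where "Z = {k \<in> K. \<exists>s. (s = 1 \<or> s = -1) \<and> mink x (nrm v K s k) = 0}"
  define g where "g k = (SOME s. (s = 1 \<or> s = -1) \<and> mink x (nrm v K s k) = 0)" for k
  have g: "(g k = 1 \<or> g k = -1) \<and> mink x (nrm v K (g k) k) = 0" if "k \<in> Z" for k
  proof -
    have "\<exists>s. (s = 1 \<or> s = -1) \<and> mink x (nrm v K s k) = 0" using that unfolding Z_def mem_Collect_eq by (rule conjunct2)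
    then show ?thesis unfolding g_def by (rule someI_ex)
  qed
  have sub: "{n \<in> cube v K. mink x n = 0} \<subseteq> (\<lambda>k. nrm v K (g k) k) ` Z"
  proof
    fix n assume "n \<in> {n \<in> cube v K. mink x n = 0}"
    then obtain s k where sk: "n = nrm v K s k" "k \<in> K" "s = 1 \<or> s = -1" "mink x (nrm v K s k) = 0"
      by (auto simp: cube_def)
    then have kZ: "k \<in> Z" by (auto simp: Z_def)
    have "s = g k"
    proof (rule ccontr)
      assume "s \<noteq> g k"
      then have "s = - g k" using g[OF kZ] sk(3) by auto
      then have "X = 0" using g[OF kZ] sk(4) unfolding nrm_zero_iff X_def by auto
      then show False using X by simp
    qed
    then show "n \<in> (\<lambda>k. nrm v K (g k) k) ` Z" using sk kZ by blast
  qed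
  have finZ: "finite Z" using fin by (simp add: Z_def)
  have "3 \<le> card ((\<lambda>k. nrm v K (g k) k) ` Z)"
    using card_mono[OF finite_imageI[OF finZ] sub] x(2) by simp
  also have "\<dots> \<le> card Z" using finZ by (rule card_image_le)
  finally have "3 \<le> card Z" .
  then have "card K \<le> card Z" using assms(2) by (simp add: tri_def)
  moreover have "Z \<subseteq> K" unfolding Z_def by (rule Collect_subset)
  ultimately have ZK: "Z = K" using card_seteq[OF fin] by blast
  define y where "y = - X / (2 * phi + 1)"
  have y: "0 < y" using X phi_pos by (simp add: y_def divide_neg_pos)
  have yk: "mink x k = g k * y" if "k \<in> K" for k
  proof -
    have "X + g k * (2 * phi + 1) * mink x k = 0" using g[of k] that ZK by (simp add: nrm_zero_iff X_def)
    moreover have "g k = 1 \<or> g k = -1" using g[of k] that ZK by auto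
    ultimately show ?thesis using phi_pos by (elim disjE) (simp_all add: y_def field_simps)
  qed
  have "x = y *\<^sub>R ctr v K + (\<Sum>k\<in>K. mink x k *\<^sub>R k)"
    using cube_expansion[OF h assms(2), of x] by (simp add: y_def X_def)
  also have "(\<Sum>k\<in>K. mink x k *\<^sub>R k) = (\<Sum>k\<in>K. (g k * y) *\<^sub>R k)" using yk by (intro sum.cong) auto
  finally have xe: "x = y *\<^sub>R ctr v K + (\<Sum>k\<in>K. (g k * y) *\<^sub>R k)" .
  have "-1 = mink x x" using x by (simp add: hyp3_def)
  also have "\<dots> = mink x (y *\<^sub>R ctr v K + (\<Sum>k\<in>K. (g k * y) *\<^sub>R k))" using xe by simp
  also have "\<dots> = y * X + (\<Sum>k\<in>K. (g k * y) * mink x k)"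
    by (simp add: mink_simps mink_sum_right X_def)
  also have "(\<Sum>k\<in>K. (g k * y) * mink x k) = (\<Sum>k\<in>K. y * y)"
  proof (rule sum.cong[OF refl])
    fix k assume k: "k \<in> K"
    have "g k = 1 \<or> g k = -1" using g[of k] k ZK by simp
    then show "(g k * y) * mink x k = y * y" using yk[OF k] by auto
  qed
  also have "\<dots> = 3 * (y * y)" using assms(2) by (simp add: tri_def)
  also have "X = - (2 * phi + 1) * y" using phi_pos by (simp add: y_def field_simps)
  finally have "(2 * phi - 2) * (y * y) = 1" by (simp add: algebra_simps)
  then have "phi * ((2 * phi - 2) * (y * y)) = phi" by simp
  then have "2 * (y * y) = phi" by (simp add: algebra_simps phi_sq_left)
  then have "y * y = sh * sh" by (simp add: sh_sq)
  then have yS: "y = sh" using y sh_pos by (simp add: square_eq_iff)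
  define J where "J = {k \<in> K. g k = 1}"
  have "(\<Sum>k\<in>K. (g k * sh) *\<^sub>R k) = (\<Sum>k\<in>K. (if g k = 1 then (2 * sh) *\<^sub>R k else 0) - sh *\<^sub>R k)"
  proof (rule sum.cong[OF refl])
    fix k assume k: "k \<in> K"
    have "g k = 1 \<or> g k = -1" using g[of k] k ZK by simp
    then show "(g k * sh) *\<^sub>R k = (if g k = 1 then (2 * sh) *\<^sub>R k else 0) - sh *\<^sub>R k"
      by (auto simp: scaleR_left_diff_distrib[symmetric])
  qed
  also have "\<dots> = (\<Sum>k\<in>J. (2 * sh) *\<^sub>R k) - (\<Sum>k\<in>K. sh *\<^sub>R k)"
    using fin by (simp add: sum_subtractf sum.inter_filter[symmetric] J_def)
  also have "\<dots> = (2 * sh) *\<^sub>R \<Sum>J - sh *\<^sub>R \<Sum>K" by (simp add: scaleR_sum_right)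
  finally have "x = v + (2 * sh) *\<^sub>R \<Sum>J"
    using xe sh_pos by (simp add: yS ctr_def algebra_simps)
  then show "x \<in> {v + (2 * sh) *\<^sub>R \<Sum>J | J. J \<subseteq> K}" by (auto simp: J_def)
next
  have h: "v \<in> hyp3" using assms vert_hyp3 by blast
  fix x assume "x \<in> {v + (2 * sh) *\<^sub>R \<Sum>J | J. J \<subseteq> K}"
  then obtain J where J: "J \<subseteq> K" "x = v + (2 * sh) *\<^sub>R \<Sum>J" by blast
  have "x \<in> hyp3" using cube_corner[OF assms J(1)] J(2) vert_hyp3 by blast
  moreover have "\<forall>n\<in>cube v K. mink x n \<le> 0"
    using corner_nrm(1)[OF h assms(2) J(1)] J(2) by (auto simp: cube_def)
  moreover have "card {n \<in> cube v K. mink x n = 0} = 3"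
  proof -
    have "inj_on (\<lambda>k. nrm v K (if k \<in> J then 1 else -1) k) K"
    proof (rule inj_onI)
      fix i j assume ij: "i \<in> K" "j \<in> K"
        "nrm v K (if i \<in> J then 1 else -1) i = nrm v K (if j \<in> J then 1 else -1) j"
      have "(if i \<in> J then 1 else -1 :: real) = 1 \<or> (if i \<in> J then 1 else -1 :: real) = -1"
        "(if j \<in> J then 1 else -1 :: real) = 1 \<or> (if j \<in> J then 1 else -1 :: real) = -1" by simp_all
      from nrm_inject[OF assms(2) ij(1,2) this ij(3)] show "i = j" ..
    qed
    then show ?thesis unfolding J(2) corner_zero_normals[OF h assms(2) J(1)]
      using assms(2) by (simp add: card_image tri_def)
  qed
  ultimately show "x \<in> cube_verts (cube v K)" by (simp add: cube_verts_def solid_def)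
qed

lemma cube_verts_cases:
  assumes "v \<in> vert" "tri v K" "x \<in> cube_verts (cube v K)"
  obtains K' where "x \<in> vert" "tri x K'" "cube v K = cube x K'"
proof -
  obtain J where "J \<subseteq> K" "x = v + (2 * sh) *\<^sub>R \<Sum>J" using assms cube_verts_cube by blast
  then show thesis using cube_corner[OF assms(1,2)] that by metis
qed

lemma cube_vertex: "v \<in> vert \<Longrightarrow> tri v K \<Longrightarrow> v \<in> cube_verts (cube v K)"
  unfolding cube_verts_cube by (auto intro!: exI[of _ "{}"])

lemma cube_vertex_step: "v \<in> vert \<Longrightarrow> tri v K \<Longrightarrow> k \<in> K \<Longrightarrow> step v k \<in> cube_verts (cube v K)"
  unfolding cube_verts_cube by (auto intro!: exI[of _ "{k}"] simp: step_def)

lemma nrm_vertex_iff: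
  assumes "v \<in> vert" "tri v K" "k \<in> K" "s = 1 \<or> s = -1"
  shows "mink v (nrm v K s k) = 0 \<longleftrightarrow> s = -1"
  using corner_nrm(2)[OF vert_hyp3[OF assms(1)] assms(2) empty_subsetI assms(3,4)] by simp

text \<open>The corner given by \<open>J\<close> shares \<open>3 - card J\<close> faces with
  \<open>v\<close>, so an edge means a one-element \<open>J\<close>.\<close>

lemma cube_edges_cube:
  assumes "v \<in> vert" "tri v K"
  shows "(v, y) \<in> cube_edges (cube v K) \<longleftrightarrow> (\<exists>k\<in>K. y = step v k)"
proof -
  have h: "v \<in> hyp3" using assms vert_hyp3 by blast
  have fin: "finite K" using assms tri_finite by blast
  have card: "card {n \<in> cube v K. mink v n = 0 \<and> mink (v + (2 * sh) *\<^sub>R \<Sum>J) n = 0} = 3 - card J"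
    if J: "J \<subseteq> K" for J
  proof -
    have 1: "{n \<in> cube v K. mink v n = 0} = nrm v K (-1) ` K"
      using corner_zero_normals[OF h assms(2) empty_subsetI] by simp
    have "{n \<in> cube v K. mink v n = 0 \<and> mink (v + (2 * sh) *\<^sub>R \<Sum>J) n = 0} =
        {n \<in> nrm v K (-1) ` K. mink (v + (2 * sh) *\<^sub>R \<Sum>J) n = 0}" unfolding 1[symmetric] by blast
    also have "\<dots> = nrm v K (-1) ` (K - J)"
      using corner_nrm(2)[OF h assms(2) J, of _ "-1"] by auto
    also have "card \<dots> = card (K - J)"
      using nrm_inject[OF assms(2)] by (intro card_image inj_onI) blast
    also have "\<dots> = 3 - card J" using J assms(2) fin by (simp add: card_Diff_subset finite_subset tri_def)
    finally show ?thesis .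
  qed
  show ?thesis
  proof
    assume "(v, y) \<in> cube_edges (cube v K)"
    then have y: "y \<in> cube_verts (cube v K)" "card {n \<in> cube v K. mink v n = 0 \<and> mink y n = 0} = 2"
      by (auto simp: cube_edges_def)
    then obtain J where J: "J \<subseteq> K" "y = v + (2 * sh) *\<^sub>R \<Sum>J" using cube_verts_cube[OF assms] by blast
    then have "card J = 1" using card[OF J(1)] y(2) by simp
    then obtain k where "J = {k}" by (rule card_1_singletonE)
    then show "\<exists>k\<in>K. y = step v k" using J by (auto simp: step_def)
  next
    assume "\<exists>k\<in>K. y = step v k"
    then obtain k where k: "k \<in> K" "y = step v k" by blast
    have "card {n \<in> cube v K. mink v n = 0 \<and> mink y n = 0} = 2"
      using card[of "{k}"] k by (simp add: step_def)
    moreover have "k \<noteq> 0" using tri_unit[OF assms(2) k(1)] by (auto simp: mink_simps)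
    then have "v \<noteq> y" using k sh_pos by (simp add: step_def)
    ultimately show "(v, y) \<in> cube_edges (cube v K)"
      using cube_vertex[OF assms] cube_vertex_step[OF assms k(1)] k by (simp add: cube_edges_def)
  qed
qed

lemma cube_edges_verts: "(x, y) \<in> cube_edges Q \<Longrightarrow> x \<in> cube_verts Q \<and> y \<in> cube_verts Q"
  by (simp add: cube_edges_def)

lemma cube_face_cases:
  assumes "v \<in> vert" "tri v K" "m \<in> cube v K"
  obtains x K' k where "x \<in> vert" "tri x K'" "cube v K = cube x K'" "k \<in> K'" "m = nrm x K' (-1) k"
proof -
  obtain s k where sk: "m = nrm v K s k" "k \<in> K" "s = 1 \<or> s = -1" using assms(3) by (auto simp: cube_def)
  show thesis
  proof (cases "s = -1")
    case True
    then show thesis using that[of v K k] assms sk by simp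
  next
    case False
    let ?K = "insert (- k) (K - {k})"
    have "m = nrm (step v k) ?K (-1) (- k)"
      using False sk by (simp add: nrm_step[OF assms(2) sk(2)] nrm_minus)
    then show thesis
      using that[of "step v k" ?K "- k"] step_vert[OF assms(1) tri_dirs[OF assms(2) sk(2)]]
        tri_step[OF assms(1,2) sk(2)] cube_step[OF assms(2) sk(2)] by simp
  qed
qed

lemma nrm_unit:
  assumes "v \<in> hyp3" "tri v K" "k \<in> K" "s = 1 \<or> s = -1" shows "mink (nrm v K s k) (nrm v K s k) = 1"
proof -
  let ?w = "ctr v K + (s * (2 * phi + 1)) *\<^sub>R k"
  have "mink ?w ?w = - (2 * phi + 1) + (s * s) * ((2 * phi + 1) * (2 * phi + 1))"
    using ctr_mink[OF assms(2,3)] ctr_norm[OF assms(1,2)] tri_unit[OF assms(2,3)] mink_commute[of "ctr v K" k]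
    by (simp add: mink_simps algebra_simps)
  also have "s * s = 1" using assms(4) by auto
  finally have w: "mink ?w ?w = 2 * ((phi + 1) * (phi + 1))" by (simp add: algebra_simps phi_sq phi_sq_left)
  have "mink (nrm v K s k) (nrm v K s k) = (1 / (sqrt 2 * (phi + 1))) * (1 / (sqrt 2 * (phi + 1))) * mink ?w ?w"
    by (simp only: nrm_def mink_scale_left mink_scale_right mult.assoc)
  also have "(1 / (sqrt 2 * (phi + 1))) * (1 / (sqrt 2 * (phi + 1))) = 1 / ((sqrt 2 * sqrt 2) * ((phi + 1) * (phi + 1)))"
    by (simp only: times_divide_times_eq ac_simps mult_1)
  finally show ?thesis unfolding w using phi_pos by simp
qed

text \<open>The image of \<open>k\<close> under the reflection in the face that contains the edges
  \<open>K - {k}\<close> at \<open>v\<close>; in the icosahedron, the apex of the other triangle at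
  the edge \<open>K - {k}\<close>. The coefficient \<open>phi - 1\<close> is
  \<open>2 * cos (2 * pi / 5)\<close>.\<close>

definition flip :: "mvec \<Rightarrow> mvec set \<Rightarrow> mvec \<Rightarrow> mvec" where
  "flip v K k = (phi - 1) *\<^sub>R ((1 / sh) *\<^sub>R v + \<Sum>(K - {k})) - k"

lemma reflection_nrm:
  assumes v: "v \<in> vert" and K: "tri v K" and k: "k \<in> K"
  shows "reflection (nrm v K (-1) k) v = v"
    and "j \<in> K - {k} \<Longrightarrow> reflection (nrm v K (-1) k) j = j"
    and "reflection (nrm v K (-1) k) k = flip v K k"
proof -
  have h: "v \<in> hyp3" using v vert_hyp3 by blast
  show "reflection (nrm v K (-1) k) v = v"
    using nrm_vertex_iff[OF v K k, of "-1"] by (intro reflection_orthogonal) simp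
  show "reflection (nrm v K (-1) k) j = j" if "j \<in> K - {k}"
    using that ctr_mink[OF K] tri_orthogonal[OF K _ k] by (intro reflection_orthogonal) (simp add: nrm_zero_iff)
  define c where "c = 1 / (sqrt 2 * (phi + 1))"
  \<comment> \<open>Only the square of the normalising factor enters, so its \<open>sqrt 2\<close>
    disappears and the reflected direction stays in the lattice.\<close>
  have cc: "2 * (2 * phi + 1) * (c * c) = phi - 1"
  proof -
    have "c * c = 1 / ((sqrt 2 * sqrt 2) * ((phi + 1) * (phi + 1)))"
      unfolding c_def by (simp only: times_divide_times_eq ac_simps mult_1)
    also have "(sqrt 2 * sqrt 2) * ((phi + 1) * (phi + 1)) = 2 * (3 * phi + 2)" by (simp add: algebra_simps phi_sq)
    finally have e: "c * c = 1 / (2 * (3 * phi + 2))" .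
    show ?thesis unfolding e using phi_pos by (simp add: field_simps phi_sq phi_sq_left)
  qed
  have mk: "mink k (nrm v K (-1) k) = - (2 * phi + 1) * c"
    using ctr_mink[OF K k] tri_unit[OF K k] by (simp add: nrm_mink_eq c_def)
  have n_eq: "nrm v K (-1) k = c *\<^sub>R (ctr v K - (2 * phi + 1) *\<^sub>R k)" by (simp only: nrm_def c_def mult_minus1 scaleR_minus_left add_uminus_conv_diff)
  have "reflection (nrm v K (-1) k) k = k + (2 * (2 * phi + 1) * (c * c)) *\<^sub>R (ctr v K - (2 * phi + 1) *\<^sub>R k)"
  proof -
    have coef: "2 * (- (2 * phi + 1) * c) * c = - (2 * (2 * phi + 1) * (c * c))" by (simp add: algebra_simps)
    show ?thesis unfolding reflection_def mk unfolding n_eq scaleR_scaleR coef scaleR_minus_left by simp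
  qed
  also have "\<dots> = (phi - 1) *\<^sub>R ctr v K - ((phi - 1) * (2 * phi + 1) - 1) *\<^sub>R k"
  proof -
    have "k + p *\<^sub>R (c - q *\<^sub>R k) = p *\<^sub>R c - (p * q - 1) *\<^sub>R k" for p q :: real and c :: mvec
      by (simp add: algebra_simps)
    then show ?thesis unfolding cc .
  qed
  also have "(phi - 1) * (2 * phi + 1) - 1 = phi" by (simp add: algebra_simps phi_sq phi_sq_left)
  also have "(phi - 1) *\<^sub>R ctr v K - phi *\<^sub>R k = flip v K k"
    using tri_finite[OF K] k by (simp add: flip_def ctr_def sum_diff1 algebra_simps)
  finally show "reflection (nrm v K (-1) k) k = flip v K k" .
qed

text \<open>Face reflections are not taken from \<open>mirrors\<close>, so that they preserve
  directions has to be shown: membership in \<open>lat\<close> is read off the formula, while the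
  norm and the products with \<open>v\<close> and \<open>K - {k}\<close> come from the
  isometry.\<close>

lemma flip_props:
  assumes v: "v \<in> vert" and K: "tri v K" and k: "k \<in> K"
  shows "flip v K k \<in> dirs v" "mink (flip v K k) k = - phi"
    "j \<in> K - {k} \<Longrightarrow> mink (flip v K k) j = 0" "flip v K k \<notin> K" "tri v (insert (flip v K k) (K - {k}))"
proof -
  let ?n = "nrm v K (-1) k" and ?f = "flip v K k"
  have h: "v \<in> hyp3" using v vert_hyp3 by blast
  have n: "mink ?n ?n = 1" using nrm_unit[OF h K k] by simp
  have fin: "finite K" using K tri_finite by blast
  have "\<Sum>J \<in> lat" if "J \<subseteq> K" for J
  proof -
    have "finite J" using that fin finite_subset by blast
    then show ?thesis using that
    proof (induction rule: finite_induct)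
      case empty
      have "k - k \<in> lat" using dirs_mirrors[OF tri_dirs[OF K k]] by (intro lat_diff) (simp_all add: mirrors_def)
      then show ?case by simp
    next
      case (insert x F)
      then have "x \<in> lat" using dirs_mirrors[OF tri_dirs[OF K, of x]] by (simp add: mirrors_def)
      then show ?case using insert by (simp add: lat_add)
    qed
  qed
  then have sl: "\<Sum>(K - {k}) \<in> lat" by blast
  have vl: "(1 / sh) *\<^sub>R v \<in> lat" using v by (simp add: vert_def)
  have kl: "k \<in> lat" using dirs_mirrors[OF tri_dirs[OF K k]] by (simp add: mirrors_def)
  have "?f \<in> lat" unfolding flip_def by (rule lat_diff[OF lat_scale[OF _ lat_add[OF vl sl]] kl]) simp
  moreover have "mink ?f ?f = 1"
    using reflection_mink[OF n, of k k] reflection_nrm(3)[OF v K k] tri_unit[OF K k] by simp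
  moreover have "mink v ?f = - sh"
    using reflection_mink[OF n, of v k] reflection_nrm[OF v K k] dirs_mink[OF tri_dirs[OF K k]] by simp
  ultimately show fn: "?f \<in> dirs v" by (simp add: dirs_def mirrors_def)
  have "mink (\<Sum>(K - {k})) k = 0"
    using tri_mink_sum[OF K _ k, of "K - {k}"] mink_commute by simp
  then show fk: "mink ?f k = - phi"
    using dirs_mink[OF tri_dirs[OF K k]] tri_unit[OF K k] sh_pos by (simp add: flip_def mink_simps)
  have orth: "mink ?f j = 0" if "j \<in> K - {k}" for j
    using reflection_mink[OF n, of k j] reflection_nrm(2)[OF v K k, of j] reflection_nrm(3)[OF v K k]
      tri_orthogonal[OF K k, of j] that by auto
  then show "j \<in> K - {k} \<Longrightarrow> mink ?f j = 0" .
  show notin: "?f \<notin> K"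
  proof
    assume "?f \<in> K"
    then have "?f = k" using orth[of ?f] tri_unit[OF K] by fastforce
    then show False using fk tri_unit[OF K k] phi_pos by simp
  qed
  have "card (insert ?f (K - {k})) = 3" using notin fin K k by (simp add: tri_def)
  moreover have "mink i j = 0" if "i \<in> insert ?f (K - {k})" "j \<in> insert ?f (K - {k})" "i \<noteq> j" for i j
    using that orth[of i] orth[of j] tri_orthogonal[OF K, of i j] mink_commute[of i ?f]
    by (cases "i = ?f"; cases "j = ?f") simp_all
  ultimately show "tri v (insert ?f (K - {k}))" using fn K by (simp add: tri_def) blast
qed

lemma reflection_nrm_nrm:
  assumes v: "v \<in> vert" and K: "tri v K" and k: "k \<in> K"
  shows "reflection (nrm v K (-1) k) (nrm v K s j) =
    nrm v (insert (flip v K k) (K - {k})) s (reflection (nrm v K (-1) k) j)"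
proof -
  let ?r = "reflection (nrm v K (-1) k)"
  have fin: "finite K" using K tri_finite by blast
  have "?r (\<Sum>(K - {k})) = (\<Sum>j\<in>K - {k}. ?r j)"
    using linear_sum[OF reflection_linear, of _ id "K - {k}"] by simp
  also have "\<dots> = \<Sum>(K - {k})" using reflection_nrm(2)[OF v K k] by (intro sum.cong) auto
  finally have s: "?r (\<Sum>(K - {k})) = \<Sum>(K - {k})" .
  have "ctr v K = (1 / sh) *\<^sub>R v + (\<Sum>(K - {k}) + k)" using fin k by (simp add: ctr_def sum_diff1)
  then have "?r (ctr v K) = (1 / sh) *\<^sub>R v + (\<Sum>(K - {k}) + flip v K k)"
    using s reflection_nrm(1,3)[OF v K k]
    by (simp add: linear_add[OF reflection_linear] linear_scale[OF reflection_linear])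
  also have "\<dots> = ctr v (insert (flip v K k) (K - {k}))"
    using fin flip_props(4)[OF v K k] by (simp add: ctr_def)
  finally show ?thesis
    by (simp add: nrm_def linear_add[OF reflection_linear] linear_scale[OF reflection_linear])
qed

text \<open>Crossing a face at \<open>v\<close> flips one triangle, so passing from cube to cube
  around a vertex becomes a walk on the triangles of the icosahedron.\<close>

lemma reflection_cube:
  assumes v: "v \<in> vert" and K: "tri v K" and k: "k \<in> K"
  shows "reflection (nrm v K (-1) k) ` cube v K = cube v (insert (flip v K k) (K - {k}))"
proof -
  let ?r = "reflection (nrm v K (-1) k)" and ?K = "insert (flip v K k) (K - {k})"
  have im: "?r ` K = ?K"
    using reflection_nrm(2,3)[OF v K k] k by force
  have "?r ` cube v K = {?r (nrm v K s j) | s j. j \<in> K \<and> (s = 1 \<or> s = -1)}"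
    unfolding cube_def by blast
  also have "\<dots> = {nrm v ?K s (?r j) | s j. j \<in> K \<and> (s = 1 \<or> s = -1)}"
    unfolding reflection_nrm_nrm[OF v K k] ..
  also have "\<dots> = {nrm v ?K s j | s j. j \<in> ?r ` K \<and> (s = 1 \<or> s = -1)}" by blast
  finally show ?thesis unfolding im cube_def .
qed

section \<open>The dihedral angle and the base cube\<close>

lemma cos_2_pi_5: "cos (2 * pi / 5) = (phi - 1) / 2"
proof -
  define c where "c = cos (2 * pi / 5)"
  \<comment> \<open>The angle satisfies \<open>cos (3 * x) = cos (2 * x)\<close>. This cubic
    equation for the cosine has the root 1, and the remaining quadratic has the roots
    \<open>(phi - 1) / 2\<close> and \<open>- phi / 2\<close>.\<close>
  have "cos (3 * (2 * pi / 5)) = cos (2 * pi - 2 * (2 * pi / 5))" by (rule arg_cong[of _ _ cos]) (simp add: field_simps)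
  also have "\<dots> = cos (2 * (2 * pi / 5))" by (rule cos_2pi_minus)
  finally have "4 * c ^ 3 - 3 * c = 2 * c ^ 2 - 1" unfolding cos_treble_cos cos_double_cos c_def .
  moreover have "4 * ((c - 1) * (c * c + c / 2 - 1 / 4)) = 4 * c ^ 3 - 3 * c - (2 * c ^ 2 - 1)"
    by (simp add: field_simps power2_eq_square power3_eq_cube)
  ultimately have "(c - 1) * (c * c + c / 2 - 1 / 4) = 0" by simp
  moreover have "c * c + c / 2 - 1 / 4 = (c - (phi - 1) / 2) * (c + phi / 2)"
    by (simp add: field_simps phi_sq phi_sq_left)
  ultimately have "(c - 1) * ((c - (phi - 1) / 2) * (c + phi / 2)) = 0" by simp
  moreover have "0 < c" unfolding c_def by (rule cos_gt_zero) (simp_all add: field_simps)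
  moreover have "c \<noteq> 1"
  proof -
    have "cos (2 * pi / 5) < cos 0" by (rule cos_monotone_0_pi) (simp_all add: field_simps)
    then show ?thesis by (simp add: c_def)
  qed
  moreover have "c + phi / 2 \<noteq> 0" using \<open>0 < c\<close> phi_pos by simp
  ultimately show ?thesis by (simp add: c_def)
qed

definition base_tri :: "mvec set" where "base_tri = {lvec 0 (-1) 0 0, lvec 0 0 (-1) 0, lvec 0 0 0 (-1)}"

lemma tri_base: "tri base_vert base_tri"
proof -
  have "base_tri \<subseteq> dirs base_vert" using base_dirs_dirs by (auto simp: base_tri_def base_dirs_def)
  moreover have d: "lvec 0 (-1) 0 0 \<noteq> lvec 0 0 (-1) 0" "lvec 0 (-1) 0 0 \<noteq> lvec 0 0 0 (-1)" "lvec 0 0 (-1) 0 \<noteq> lvec 0 0 0 (-1)"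
    by (auto simp: lvec_def vec_eq_iff forall_3 vector_3)
  then have "card base_tri = 3" by (simp add: base_tri_def)
  ultimately show ?thesis by (auto simp: tri_def base_tri_def lvec_mink)
qed

text \<open>After normalisation by \<open>c\<close> the time and space parts of the normals have the
  squares \<open>(phi - 1) / 2\<close> and \<open>1 + (phi - 1) / 2\<close>, the numbers under the
  square roots in \<open>base_cube\<close>.\<close>

lemma base_cube_cube: "base_cube = cube base_vert base_tri"
proof -
  have d: "lvec 0 (-1) 0 0 \<noteq> lvec 0 0 (-1) 0" "lvec 0 (-1) 0 0 \<noteq> lvec 0 0 0 (-1)" "lvec 0 0 (-1) 0 \<noteq> lvec 0 0 0 (-1)"
    by (auto simp: lvec_def vec_eq_iff forall_3 vector_3)
  have ctr: "ctr base_vert base_tri = (sqrt phi * phi, 0)"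
    using d sh_pos by (simp add: ctr_def base_vert_def base_tri_def lvec_def prod_eq_iff vec_eq_iff forall_3 vector_3)
  define a where "a = sqrt (cos (2 * pi / 5))"
  define b where "b = sqrt (1 + cos (2 * pi / 5))"
  define c where "c = 1 / (sqrt 2 * (phi + 1))"
  have c: "0 < c" "c * c = 1 / (2 * ((phi + 1) * (phi + 1)))"
  proof -
    show "0 < c" using phi_pos by (simp add: c_def)
    have "c * c = 1 / ((sqrt 2 * sqrt 2) * ((phi + 1) * (phi + 1)))"
      unfolding c_def by (simp only: times_divide_times_eq ac_simps mult_1)
    then show "c * c = 1 / (2 * ((phi + 1) * (phi + 1)))" by simp
  qed
  have pp: "(phi + 1) * (phi + 1) = 3 * phi + 2" by (simp add: algebra_simps phi_sq)
  have a: "c * (sqrt phi * phi) = a"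
  proof -
    have "(c * (sqrt phi * phi)) ^ 2 = c * c * (sqrt phi * sqrt phi * (phi * phi))"
      by (simp only: power2_eq_square ac_simps)
    also have "\<dots> = (phi - 1) / 2" unfolding c(2) pp sqrt_phi_sq phi_sq
      using phi_pos by (simp add: field_simps phi_sq phi_sq_left)
    finally show ?thesis unfolding a_def cos_2_pi_5
      using c(1) phi_pos by (intro real_sqrt_unique[symmetric]) simp_all
  qed
  have b: "c * (2 * phi + 1) = b"
  proof -
    have "(c * (2 * phi + 1)) ^ 2 = c * c * ((2 * phi + 1) * (2 * phi + 1))"
      by (simp only: power2_eq_square ac_simps)
    also have "\<dots> = 1 + (phi - 1) / 2" unfolding c(2) pp
      using phi_pos by (simp add: field_simps phi_sq phi_sq_left)
    finally show ?thesis unfolding b_def cos_2_pi_5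
      using c(1) phi_pos by (intro real_sqrt_unique[symmetric]) simp_all
  qed
  have ax: "lvec 0 (-1) 0 0 = (0, - axis 1 1)" "lvec 0 0 (-1) 0 = (0, - axis 2 1)" "lvec 0 0 0 (-1) = (0, - axis 3 1)"
    by (auto simp: lvec_def vec_eq_iff forall_3 vector_3 axis_def)
  have tri: "base_tri = {(0, - axis i 1) | i. True}"
    unfolding base_tri_def ax by (auto simp: exhaust_3) (metis exhaust_3)
  have nrm: "nrm base_vert base_tri s (0, - axis i 1) = (a, (- s * b) *\<^sub>R axis i 1)" for s i
  proof -
    have "nrm base_vert base_tri s (0, - axis i 1) = c *\<^sub>R ((sqrt phi * phi, 0) + (s * (2 * phi + 1)) *\<^sub>R (0, - axis i 1))"
      by (simp only: nrm_def ctr c_def)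
    also have "\<dots> = (c * (sqrt phi * phi), (- s * (c * (2 * phi + 1))) *\<^sub>R axis i 1)"
      by (simp add: mult.left_commute)
    finally show ?thesis unfolding a b .
  qed
  have "cube base_vert base_tri = {nrm base_vert base_tri s (0, - axis i 1) | s i. s = 1 \<or> s = -1}"
    unfolding cube_def tri by blast
  also have "\<dots> = {(a, (- s * b) *\<^sub>R axis i 1) | s i. s = 1 \<or> s = -1}" unfolding nrm ..
  also have "\<dots> = {(a, e *\<^sub>R axis i 1) | e i. e = b \<or> e = - b}" (is "?L = ?R")
  proof (intro equalityI subsetI)
    fix p assume "p \<in> ?L"
    then obtain s i where s: "p = (a, (- s * b) *\<^sub>R axis i 1)" "s = 1 \<or> s = -1" by blast
    then have "- s * b = b \<or> - s * b = - b" by auto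
    then show "p \<in> ?R" using s(1) by blast
  next
    fix p assume "p \<in> ?R"
    then obtain e i where e: "p = (a, e *\<^sub>R axis i 1)" "e = - (-1) * b \<or> e = - 1 * b" by auto
    then show "p \<in> ?L" by blast
  qed
  finally show ?thesis by (simp add: base_cube_def a_def b_def)
qed

lemma honeycomb_cube:
  assumes "Q \<in> honeycomb" shows "\<exists>v K. v \<in> vert \<and> tri v K \<and> Q = cube v K"
  using assms
proof (induction rule: honeycomb.induct)
  case base
  then show ?case using base_vert_vert tri_base base_cube_cube by blast
next
  case (reflect Q n)
  then obtain v K where "v \<in> vert" "tri v K" "Q = cube v K" by blast
  then obtain x K' k where x: "x \<in> vert" "tri x K'" "Q = cube x K'" "k \<in> K'" "n = nrm x K' (-1) k"
    using cube_face_cases reflect.hyps by metis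
  then show ?case using reflection_cube[OF x(1,2,4)] flip_props(5)[OF x(1,2,4)] by blast
qed

section \<open>The icosahedron of directions at a vertex\<close>

lemma adj_rows:
  "adj 0 j \<longleftrightarrow> j = 1 \<or> j = 2 \<or> j = 3 \<or> j = 4 \<or> j = 5"
  "adj (Suc 0) j \<longleftrightarrow> j = 0 \<or> j = 2 \<or> j = 5 \<or> j = 6 \<or> j = 10"
  "adj 2 j \<longleftrightarrow> j = 0 \<or> j = 1 \<or> j = 3 \<or> j = 6 \<or> j = 7"
  "adj 3 j \<longleftrightarrow> j = 0 \<or> j = 2 \<or> j = 4 \<or> j = 7 \<or> j = 8"
  "adj 4 j \<longleftrightarrow> j = 0 \<or> j = 3 \<or> j = 5 \<or> j = 8 \<or> j = 9"
  "adj 5 j \<longleftrightarrow> j = 0 \<or> j = 1 \<or> j = 4 \<or> j = 9 \<or> j = 10"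
  "adj 6 j \<longleftrightarrow> j = 1 \<or> j = 2 \<or> j = 7 \<or> j = 10 \<or> j = 11"
  "adj 7 j \<longleftrightarrow> j = 2 \<or> j = 3 \<or> j = 6 \<or> j = 8 \<or> j = 11"
  "adj 8 j \<longleftrightarrow> j = 3 \<or> j = 4 \<or> j = 7 \<or> j = 9 \<or> j = 11"
  "adj 9 j \<longleftrightarrow> j = 4 \<or> j = 5 \<or> j = 8 \<or> j = 10 \<or> j = 11"
  "adj 10 j \<longleftrightarrow> j = 1 \<or> j = 5 \<or> j = 6 \<or> j = 9 \<or> j = 11"
  "adj 11 j \<longleftrightarrow> j = 6 \<or> j = 7 \<or> j = 8 \<or> j = 9 \<or> j = 10"
  by (auto simp: adj_def ico_table_def)

lemma upt_12: "[0..<12] = [0,1,2,3,4,5,6,7,8,9,10,11::nat]"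
  by code_simp

text \<open>Every clique appears in every order, so cutting a list after a prefix covers all ways to
  split a simplex into planes and descending directions.\<close>

fun cliques :: "nat \<Rightarrow> nat list list" where
  "cliques 0 = [[]]"
| "cliques (Suc n) = concat (map (\<lambda>c. map (\<lambda>i. i # c) (filter (\<lambda>i. list_all (adj i) c) [0..<12])) (cliques n))"

lemma in_cliques: "set l \<subseteq> {..<12} \<Longrightarrow> sorted_wrt adj l \<Longrightarrow> l \<in> set (cliques (length l))"
  by (induction l) (auto simp: list_all_iff)

lemma cliques_4: "cliques (Suc (Suc (Suc (Suc 0)))) = []"
  by (simp add: upt_12 adj_rows)

text \<open>\<open>A\<close> is the set of planes through a vertex and \<open>s\<close> its set of descending directions. Each upper
  neighbour is recorded as \<open>4 * p + q\<close>, where \<open>p\<close> is its number of planes and \<open>q\<close> its number of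
  ascendants.\<close>

definition up_codes :: "nat list \<Rightarrow> nat list \<Rightarrow> nat list" where
  "up_codes A s = map (\<lambda>j. 4 * length (filter (\<lambda>a. a \<noteq> j) A) + Suc (length (filter (adj j) s)))
     (filter (\<lambda>j. j \<notin> set s \<and> list_all (\<lambda>a. j = a \<or> adj j a) A) [0..<12])"

text \<open>Codes 1, 2, 3 are the types E, D, C, codes 5 and 6 are B and A, and 9 is type "1". The
  empty first entries belong to \<open>q = 0\<close>, which occurs only at \<open>V0\<close>, where
  \<open>p = 3\<close>.\<close>

definition code_table :: "nat \<Rightarrow> nat \<Rightarrow> nat list" where
  "code_table p q = (if p = 0 then [[], [1,1,1,1,1,1,2,2,2,2,2], [1,1,1,1,2,2,2,2,3,3], [1,1,1,2,2,2,3,3,3]] ! q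
     else if p = 1 then [[], [2,5,5,6,6], [3,5,6,6]] ! q
     else if p = 2 then [6,6,9]
     else [9,9,9])"

text \<open>The symmetry group of the icosahedron is transitive on ordered cliques of each size;
  hence one sorted list serves all of them and a table indexed by two sizes suffices.\<close>

lemma codes_01: "list_all (\<lambda>c. sort (up_codes [] c) = [1,1,1,1,1,1,2,2,2,2,2]) (cliques (Suc 0))"
  by (simp add: upt_12 adj_rows up_codes_def)

lemma codes_02: "list_all (\<lambda>c. sort (up_codes [] c) = [1,1,1,1,2,2,2,2,3,3]) (cliques (Suc (Suc 0)))"
  by (simp add: upt_12 adj_rows up_codes_def)

lemma codes_03: "list_all (\<lambda>c. sort (up_codes [] c) = [1,1,1,2,2,2,3,3,3]) (cliques (Suc (Suc (Suc 0))))"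
  by (simp add: upt_12 adj_rows up_codes_def)

lemma codes_11: "list_all (\<lambda>c. sort (up_codes (take 1 c) (drop 1 c)) = [2,5,5,6,6]) (cliques (Suc (Suc 0)))"
  by (simp add: upt_12 adj_rows up_codes_def)

lemma codes_12: "list_all (\<lambda>c. sort (up_codes (take 1 c) (drop 1 c)) = [3,5,6,6]) (cliques (Suc (Suc (Suc 0))))"
  by (simp add: upt_12 adj_rows up_codes_def)

lemma codes_21: "list_all (\<lambda>c. sort (up_codes (take 2 c) (drop 2 c)) = [6,6,9]) (cliques (Suc (Suc (Suc 0))))"
  by (simp add: upt_12 adj_rows up_codes_def)

lemma codes_30: "list_all (\<lambda>c. sort (up_codes c []) = [9,9,9]) (cliques (Suc (Suc (Suc 0))))"
  by (simp add: upt_12 adj_rows up_codes_def)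

declare cliques.simps [simp del]

lemma common_neighbours_index:
  "list_all (\<lambda>i. list_all (\<lambda>j. length (filter (\<lambda>x. adj x i \<and> adj x j) [0..<12]) = 2) (ico_table ! i)) [0..<12]"
  by (simp add: upt_12 adj_rows ico_table_def)

text \<open>The neighbours of a vertex form a pentagon, whose diameter is two.\<close>

lemma fan_index:
  "list_all (\<lambda>a. list_all (\<lambda>p. list_all (\<lambda>q. p = q \<or> adj p q \<or>
     list_ex (\<lambda>m. adj a m \<and> adj p m \<and> adj q m) [0..<12]) (ico_table ! a)) (ico_table ! a)) [0..<12]"
  by (simp add: upt_12 adj_rows ico_table_def)

lemma diameter_index:
  "list_all (\<lambda>a. list_all (\<lambda>b. a = b \<or> adj a b \<or>
     list_ex (\<lambda>c. adj a c \<and> (adj c b \<or> list_ex (\<lambda>d. adj c d \<and> adj d b) [0..<12])) [0..<12]) [0..<12]) [0..<12]"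
  by (simp add: upt_12 adj_rows)

lemma adj_irrefl_index: "list_all (\<lambda>a. \<not> adj a a) [0..<12]"
  by (simp add: upt_12 adj_rows)

section \<open>Transfer of the checks to directions\<close>

lemma ico_cases:
  assumes "v \<in> vert"
  obtains f where "dirs v = f ` {..<12}" "inj_on f {..<12}"
    "\<And>i j. i < 12 \<Longrightarrow> j < 12 \<Longrightarrow> mink (f i) (f j) = 0 \<longleftrightarrow> adj i j"
proof -
  obtain f where f: "dirs v = f ` {..<12}"
     "\<forall>i\<in>{..<12}. \<forall>j\<in>{..<12}. i \<noteq> j \<longrightarrow>
        (if adj i j then mink (f i) (f j) = 0 else mink (f i) (f j) \<le> -1)"
    using assms unfolding vert_def icosahedral_def by blast
  have unit: "mink (f i) (f i) = 1" if "i < 12" for i using dirs_unit[of "f i" v] f(1) that by blast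
  have ne: "mink (f i) (f j) \<noteq> 1" if "i < 12" "j < 12" "i \<noteq> j" for i j
    using f(2) that by (cases "adj i j") force+
  have "inj_on f {..<12}" using unit ne by (intro inj_onI) (metis lessThan_iff)
  moreover have "mink (f i) (f j) = 0 \<longleftrightarrow> adj i j" if "i < 12" "j < 12" for i j
  proof (cases "i = j")
    case True
    have "\<not> adj i i" using adj_irrefl_index that(1) by (simp add: list_all_iff)
    then show ?thesis using True unit[OF that(1)] by simp
  next
    case False
    then show ?thesis using f(2) that by (cases "adj i j") force+
  qed
  ultimately show thesis using that f(1) by blast
qed

lemma sorted_wrt_of_pairwise:
  "distinct l \<Longrightarrow> (\<And>x y. x \<in> set l \<Longrightarrow> y \<in> set l \<Longrightarrow> x \<noteq> y \<Longrightarrow> P x y) \<Longrightarrow> sorted_wrt P l"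
  by (induction l) auto

lemma count_list_sort: "count_list (sort l) x = count_list l x"
  by (metis count_mset mset_sort)

definition orth :: "mvec set \<Rightarrow> bool" where
  "orth X \<longleftrightarrow> (\<forall>x\<in>X. \<forall>y\<in>X. x \<noteq> y \<longrightarrow> mink x y = 0)"

lemma orth_D: "orth X \<Longrightarrow> x \<in> X \<Longrightarrow> y \<in> X \<Longrightarrow> x \<noteq> y \<Longrightarrow> mink x y = 0"
  by (simp add: orth_def)

lemma orth_subset: "orth Y \<Longrightarrow> X \<subseteq> Y \<Longrightarrow> orth X" unfolding orth_def by blast

lemma index_lists:
  assumes "A \<subseteq> f ` {..<12::nat}"
  obtains l where "A = f ` set l" "set l \<subseteq> {..<12}" "distinct l"
proof -
  obtain A' where A': "A' \<subseteq> {..<12}" "A = f ` A'" using assms by (meson subset_imageE)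
  moreover have "finite A'" using A'(1) finite_subset by blast
  then obtain l where "set l = A'" "distinct l" using finite_distinct_list by blast
  ultimately show thesis using that by blast
qed

text \<open>Pairwise orthogonal directions form a clique, and the icosahedron graph has none with
  four vertices.\<close>

lemma orth_card_le_3:
  assumes v: "v \<in> vert" and X: "X \<subseteq> dirs v" and o: "orth X" shows "card X \<le> 3"
proof (rule ccontr)
  assume "\<not> card X \<le> 3"
  obtain f where f: "dirs v = f ` {..<12}" "inj_on f {..<12}"
    "\<And>i j. i < 12 \<Longrightarrow> j < 12 \<Longrightarrow> mink (f i) (f j) = 0 \<longleftrightarrow> adj i j" using ico_cases[OF v] by metis
  obtain l where l: "X = f ` set l" "set l \<subseteq> {..<12}" "distinct l" using index_lists X f(1) by metis
  have inj: "inj_on f (set l)" using f(2) l(2) inj_on_subset by blast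
  have "sorted_wrt adj l"
  proof (rule sorted_wrt_of_pairwise[OF l(3)])
    fix i j assume ij: "i \<in> set l" "j \<in> set l" "i \<noteq> j"
    then have "f i \<noteq> f j" using inj by (auto dest: inj_onD)
    then have "mink (f i) (f j) = 0" using o ij l(1) by (simp add: orth_def)
    moreover have "i < 12" "j < 12" using ij l(2) by auto
    ultimately show "adj i j" using f(3) by blast
  qed
  then have "sorted_wrt adj (take 4 l)" by (rule sorted_wrt_take)
  moreover have "set (take 4 l) \<subseteq> {..<12}" using l(2) set_take_subset by fastforce
  ultimately have "take 4 l \<in> set (cliques (length (take 4 l)))" using in_cliques by blast
  moreover have "length (take 4 l) = 4"
    using \<open>\<not> card X \<le> 3\<close> l(1) card_image[OF inj] distinct_card[OF l(3)] by simp
  moreover have "(4::nat) = Suc (Suc (Suc (Suc 0)))" by simp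
  ultimately show False using cliques_4 by simp
qed

lemma up_codes_table:
  assumes "set (la @ ls) \<subseteq> {..<12}" "sorted_wrt adj (la @ ls)" "length la + length ls \<le> 3"
    "ls \<noteq> [] \<or> length la = 3"
  shows "sort (up_codes la ls) = code_table (length la) (length ls)"
proof -
  have cl: "la @ ls \<in> set (cliques (length la + length ls))" using in_cliques[OF assms(1,2)] by simp
  have "(length la = 0 \<and> length ls = 1) \<or> (length la = 0 \<and> length ls = 2) \<or> (length la = 0 \<and> length ls = 3) \<or>
    (length la = 1 \<and> length ls = 1) \<or> (length la = 1 \<and> length ls = 2) \<or> (length la = 2 \<and> length ls = 1) \<or>
    (length la = 3 \<and> length ls = 0)"
  proof -
    define m n where "m = length la" and "n = length ls"
    have "n = 0 \<Longrightarrow> m = 3" "m + n \<le> 3" using assms(3,4) by (auto simp: m_def n_def)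
    then show ?thesis unfolding m_def[symmetric] n_def[symmetric] by presburger
  qed
  then show ?thesis
  proof (elim disjE conjE)
    assume l: "length la = 0" "length ls = 1"
    then have "la @ ls \<in> set (cliques (Suc 0))" using cl by (simp add: numeral_2_eq_2 numeral_3_eq_3)
    from bspec[OF codes_01[unfolded list_all_iff] this] show ?thesis using l by (simp add: code_table_def)
  next
    assume l: "length la = 0" "length ls = 2"
    then have "la @ ls \<in> set (cliques (Suc (Suc 0)))" using cl by (simp add: numeral_2_eq_2 numeral_3_eq_3)
    from bspec[OF codes_02[unfolded list_all_iff] this] show ?thesis using l by (simp add: code_table_def)
  next
    assume l: "length la = 0" "length ls = 3"
    then have "la @ ls \<in> set (cliques (Suc (Suc (Suc 0))))" using cl by (simp add: numeral_2_eq_2 numeral_3_eq_3)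
    from bspec[OF codes_03[unfolded list_all_iff] this] show ?thesis using l by (simp add: code_table_def)
  next
    assume l: "length la = 1" "length ls = 1"
    then have "la @ ls \<in> set (cliques (Suc (Suc 0)))" using cl by (simp add: numeral_2_eq_2 numeral_3_eq_3)
    from bspec[OF codes_11[unfolded list_all_iff] this] show ?thesis using l by (simp add: code_table_def)
  next
    assume l: "length la = 1" "length ls = 2"
    then have "la @ ls \<in> set (cliques (Suc (Suc (Suc 0))))" using cl by (simp add: numeral_2_eq_2 numeral_3_eq_3)
    from bspec[OF codes_12[unfolded list_all_iff] this] show ?thesis using l by (simp add: code_table_def)
  next
    assume l: "length la = 2" "length ls = 1"
    then have "la @ ls \<in> set (cliques (Suc (Suc (Suc 0))))" using cl by (simp add: numeral_2_eq_2 numeral_3_eq_3)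
    from bspec[OF codes_21[unfolded list_all_iff] this] show ?thesis using l by (simp add: code_table_def)
  next
    assume l: "length la = 3" "length ls = 0"
    then have "la @ ls \<in> set (cliques (Suc (Suc (Suc 0))))" using cl by (simp add: numeral_2_eq_2 numeral_3_eq_3)
    from bspec[OF codes_30[unfolded list_all_iff] this] show ?thesis using l by (simp add: code_table_def)
  qed
qed

text \<open>The vertices of the closed star of the simplex \<open>A\<close>. The elements of
  \<open>A\<close> belong to it: they lead off a bounding plane into the octant.\<close>

definition link :: "mvec \<Rightarrow> mvec set \<Rightarrow> mvec set" where
  "link v A = {j \<in> dirs v. \<forall>a\<in>A. j = a \<or> mink j a = 0}"

lemma up_count:
  assumes v: "v \<in> vert" and A: "A \<subseteq> dirs v" and s: "s \<subseteq> dirs v" and d: "A \<inter> s = {}" and o: "orth (A \<union> s)"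
    and ne: "s \<noteq> {} \<or> card A = 3" and q: "1 \<le> q" "q \<le> 4"
  shows "card {j \<in> link v A. j \<notin> s \<and> card (A - {j}) = p \<and> Suc (card {x \<in> s. mink j x = 0}) = q} =
    count_list (code_table (card A) (card s)) (4 * p + q)"
proof -
  obtain f where f: "dirs v = f ` {..<12}" "inj_on f {..<12}"
    "\<And>i j. i < 12 \<Longrightarrow> j < 12 \<Longrightarrow> mink (f i) (f j) = 0 \<longleftrightarrow> adj i j" using ico_cases[OF v] by metis
  obtain la where la: "A = f ` set la" "set la \<subseteq> {..<12}" "distinct la" using index_lists A f(1) by metis
  obtain ls where ls: "s = f ` set ls" "set ls \<subseteq> {..<12}" "distinct ls" using index_lists s f(1) by metis
  have inj: "inj_on f X" if "X \<subseteq> {..<12}" for X using f(2) that inj_on_subset by blast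
  have feq: "f i = f j \<longleftrightarrow> i = j" if "i < 12" "j < 12" for i j
    using f(2) that by (auto dest: inj_onD)
  have cA: "card A = length la" using card_image[OF inj[OF la(2)]] la distinct_card by metis
  have cs: "card s = length ls" using card_image[OF inj[OF ls(2)]] ls distinct_card by metis
  have set: "set (la @ ls) \<subseteq> {..<12}" using la ls by simp
  have "set la \<inter> set ls = {}" using d la(1) ls(1) by blast
  then have dist: "distinct (la @ ls)" using la ls by simp
  have sw: "sorted_wrt adj (la @ ls)"
  proof (rule sorted_wrt_of_pairwise[OF dist])
    fix i j assume ij: "i \<in> set (la @ ls)" "j \<in> set (la @ ls)" "i \<noteq> j"
    then have lt: "i < 12" "j < 12" using set by auto
    then have "f i \<noteq> f j" using feq ij by simp
    moreover have "f i \<in> A \<union> s" "f j \<in> A \<union> s" using ij la(1) ls(1) by auto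
    ultimately have "mink (f i) (f j) = 0" using o by (simp add: orth_def)
    then show "adj i j" using f(3) lt by blast
  qed
  have "finite A" "finite s" using la(1) ls(1) by simp_all
  then have "card (A \<union> s) = card A + card s" using d by (simp add: card_Un_disjoint)
  then have len: "length la + length ls \<le> 3" using orth_card_le_3[OF v _ o] A s cA cs by simp
  have tab: "sort (up_codes la ls) = code_table (card A) (card s)"
    using up_codes_table[OF set sw len] ne ls(1) cA cs by auto
  define P where "P i \<longleftrightarrow> i \<notin> set ls \<and> list_all (\<lambda>a. i = a \<or> adj i a) la" for i
  define c where "c i = 4 * length (filter (\<lambda>a. a \<noteq> i) la) + Suc (length (filter (adj i) ls))" for i
  have iff: "(f i \<in> link v A \<and> f i \<notin> s \<and> card (A - {f i}) = p \<and> Suc (card {x \<in> s. mink (f i) x = 0}) = q)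
      \<longleftrightarrow> P i \<and> c i = 4 * p + q" if i: "i < 12" for i
  proof -
    have 1: "f i \<in> s \<longleftrightarrow> i \<in> set ls" using ls feq i by (auto simp: image_iff)
    have "\<forall>a\<in>set la. a < 12" using la(2) by auto
    then have 2: "f i \<in> link v A \<longleftrightarrow> list_all (\<lambda>a. i = a \<or> adj i a) la"
      using f(1,3) feq i la(1) by (simp add: link_def list_all_iff)
    have "A - {f i} = f ` set (filter (\<lambda>a. a \<noteq> i) la)"
      using la feq i by (auto simp: image_iff)
    moreover have "set (filter (\<lambda>a. a \<noteq> i) la) \<subseteq> {..<12}" using la(2) by auto
    ultimately have 3: "card (A - {f i}) = length (filter (\<lambda>a. a \<noteq> i) la)"
      using card_image[OF inj] distinct_card[OF distinct_filter[OF la(3)]] by metis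
    have "{x \<in> s. mink (f i) x = 0} = f ` {k \<in> set ls. mink (f i) (f k) = 0}" unfolding ls(1) by blast
    also have "{k \<in> set ls. mink (f i) (f k) = 0} = set (filter (adj i) ls)" using ls(2) f(3)[OF i] by auto
    finally have "{x \<in> s. mink (f i) x = 0} = f ` set (filter (adj i) ls)" .
    moreover have "set (filter (adj i) ls) \<subseteq> {..<12}" using ls(2) by auto
    ultimately have 4: "card {x \<in> s. mink (f i) x = 0} = length (filter (adj i) ls)"
      using card_image[OF inj] distinct_card[OF distinct_filter[OF ls(3)]] by metis
    have "length (filter (adj i) ls) \<le> 3" using len length_filter_le[of "adj i" ls] by linarith
    \<comment> \<open>At most three descending directions are adjacent, so the second part of the
      code lies between 1 and 4 and decoding is unique.\<close>
    then have 5: "4 * a + Suc (length (filter (adj i) ls)) = 4 * p + q \<longleftrightarrow> a = p \<and> Suc (length (filter (adj i) ls)) = q" for a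
      using q by presburger
    show ?thesis unfolding 1 2 3 4 P_def c_def 5 by (rule iffI) simp_all
  qed
  have "{j \<in> link v A. j \<notin> s \<and> card (A - {j}) = p \<and> Suc (card {x \<in> s. mink j x = 0}) = q} =
      f ` {i \<in> {..<12}. P i \<and> c i = 4 * p + q}" (is "?L = ?R")
  proof (intro equalityI subsetI)
    fix j assume j: "j \<in> ?L"
    then have "j \<in> dirs v" by (simp add: link_def)
    then obtain i where "i < 12" "j = f i" using f(1) by blast
    then show "j \<in> ?R" using iff[of i] j by blast
  next
    fix j assume "j \<in> ?R"
    then obtain i where "i < 12" "j = f i" "P i \<and> c i = 4 * p + q" by blast
    then show "j \<in> ?L" using iff[of i] by blast
  qed
  then have "card ?L = card {i \<in> {..<12}. P i \<and> c i = 4 * p + q}"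
    using card_image[OF inj, of "{i \<in> {..<12}. P i \<and> c i = 4 * p + q}"] by auto
  also have "{i \<in> {..<12}. P i \<and> c i = 4 * p + q} = set (filter (\<lambda>i. P i \<and> c i = 4 * p + q) [0..<12])" by auto
  also have "card \<dots> = length (filter (\<lambda>i. P i \<and> c i = 4 * p + q) [0..<12])" by (intro distinct_card) simp
  also have "\<dots> = count_list (up_codes la ls) (4 * p + q)"
  proof -
    have "up_codes la ls = map c (filter P [0..<12])" unfolding up_codes_def P_def c_def ..
    moreover have "count_list (map c l) y = length (filter (\<lambda>i. c i = y) l)" for y and l :: "nat list"
      by (induction l) auto
    ultimately show ?thesis by (simp add: conj_commute)
  qed
  also have "\<dots> = count_list (code_table (card A) (card s)) (4 * p + q)"
    using tab count_list_sort by metis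
  finally show ?thesis .
qed

lemma card_common_neighbours:
  assumes v: "v \<in> vert" and i: "i \<in> dirs v" and j: "j \<in> dirs v" and ij: "mink i j = 0"
  shows "card {x \<in> dirs v. mink x i = 0 \<and> mink x j = 0} = 2"
proof -
  obtain f where f: "dirs v = f ` {..<12}" "inj_on f {..<12}"
    "\<And>i j. i < 12 \<Longrightarrow> j < 12 \<Longrightarrow> mink (f i) (f j) = 0 \<longleftrightarrow> adj i j" using ico_cases[OF v] by metis
  obtain a b where ab: "i = f a" "j = f b" "a < 12" "b < 12" using i j f(1) by blast
  have "adj a b" using f(3) ab ij by blast
  then have "length (filter (\<lambda>x. adj x a \<and> adj x b) [0..<12]) = 2"
    using common_neighbours_index ab by (simp add: list_all_iff adj_def)
  moreover have "{x \<in> dirs v. mink x i = 0 \<and> mink x j = 0} = f ` set (filter (\<lambda>x. adj x a \<and> adj x b) [0..<12])"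
  proof -
    have "{x \<in> dirs v. mink x i = 0 \<and> mink x j = 0} = f ` {c \<in> {..<12}. mink (f c) i = 0 \<and> mink (f c) j = 0}"
      unfolding f(1) by blast
    also have "{c \<in> {..<12}. mink (f c) i = 0 \<and> mink (f c) j = 0} = set (filter (\<lambda>x. adj x a \<and> adj x b) [0..<12])"
      using ab f(3) by auto
    finally show ?thesis .
  qed
  moreover have "inj_on f (set (filter (\<lambda>x. adj x a \<and> adj x b) [0..<12]))"
    using f(2) by (rule inj_on_subset) auto
  ultimately show ?thesis using card_image distinct_card[of "filter (\<lambda>x. adj x a \<and> adj x b) [0..<12]"] by fastforce
qed

lemma common_neighbour_cases:
  assumes "v \<in> vert" "i \<in> dirs v" "j \<in> dirs v" "mink i j = 0"
    "x \<in> dirs v" "mink x i = 0" "mink x j = 0" "k \<in> dirs v" "mink k i = 0" "mink k j = 0"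
    "k' \<in> dirs v" "mink k' i = 0" "mink k' j = 0" "k \<noteq> k'"
  shows "x = k \<or> x = k'"
proof -
  let ?C = "{x \<in> dirs v. mink x i = 0 \<and> mink x j = 0}"
  have c: "card ?C = 2" using card_common_neighbours[OF assms(1-4)] .
  have "finite ?C" using finite_dirs[OF assms(1)] by simp
  moreover have "{k, k'} \<subseteq> ?C" using assms by simp
  moreover have "card {k, k'} = 2" using assms(14) by simp
  ultimately have "{k, k'} = ?C" using c by (intro card_subset_eq) simp_all
  then show ?thesis using assms(5-7) by blast
qed

lemma fan_diameter:
  assumes v: "v \<in> vert" and n: "a \<in> dirs v" "p \<in> dirs v" "q \<in> dirs v" "mink a p = 0" "mink a q = 0"
  shows "p = q \<or> mink p q = 0 \<or> (\<exists>m\<in>dirs v. mink a m = 0 \<and> mink p m = 0 \<and> mink q m = 0)"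
proof -
  obtain f where f: "dirs v = f ` {..<12}" "inj_on f {..<12}"
    "\<And>i j. i < 12 \<Longrightarrow> j < 12 \<Longrightarrow> mink (f i) (f j) = 0 \<longleftrightarrow> adj i j" using ico_cases[OF v] by metis
  obtain i j k where ab: "a = f i" "p = f j" "q = f k" "i < 12" "j < 12" "k < 12" using n f(1) by blast
  have "adj i j" "adj i k" using f(3) ab n by blast+
  then have "j = k \<or> adj j k \<or> (\<exists>m<12. adj i m \<and> adj j m \<and> adj k m)"
  proof -
    assume ij: "adj i j" and ik: "adj i k"
    have F: "\<forall>a\<in>set [0..<12]. \<forall>p\<in>set (ico_table ! a). \<forall>q\<in>set (ico_table ! a). p = q \<or> adj p q \<or>
       (\<exists>m\<in>set [0..<12]. adj a m \<and> adj p m \<and> adj q m)"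
      using fan_index unfolding list_all_iff list_ex_iff .
    have "i \<in> set [0..<12]" using ab(4) by simp
    from F[rule_format, OF this, of j k] ij ik show ?thesis unfolding adj_def[of i j] adj_def[of i k] by auto
  qed
  then show ?thesis
  proof (elim disjE exE conjE)
    assume "j = k" then show ?thesis using ab by simp
  next
    assume "adj j k" then show ?thesis using ab f(3) by simp
  next
    fix m assume "m < 12" "adj i m" "adj j m" "adj k m"
    then have "f m \<in> dirs v" "mink a (f m) = 0" "mink p (f m) = 0" "mink q (f m) = 0" using ab f(1,3) by auto
    then show ?thesis by blast
  qed
qed

lemma ico_diameter:
  assumes v: "v \<in> vert" and n: "a \<in> dirs v" "b \<in> dirs v"
  shows "a = b \<or> mink a b = 0 \<or> (\<exists>c\<in>dirs v. mink a c = 0 \<and> mink c b = 0) \<or>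
    (\<exists>c\<in>dirs v. \<exists>d\<in>dirs v. mink a c = 0 \<and> mink c d = 0 \<and> mink d b = 0)"
proof -
  obtain f where f: "dirs v = f ` {..<12}" "inj_on f {..<12}"
    "\<And>i j. i < 12 \<Longrightarrow> j < 12 \<Longrightarrow> mink (f i) (f j) = 0 \<longleftrightarrow> adj i j" using ico_cases[OF v] by metis
  obtain i j where ab: "a = f i" "b = f j" "i < 12" "j < 12" using n f(1) by blast
  have "i = j \<or> adj i j \<or> (\<exists>c<12. adj i c \<and> (adj c j \<or> (\<exists>d<12. adj c d \<and> adj d j)))"
  proof -
    have F: "\<forall>a\<in>set [0..<12]. \<forall>b\<in>set [0..<12]. a = b \<or> adj a b \<or>
       (\<exists>c\<in>set [0..<12]. adj a c \<and> (adj c b \<or> (\<exists>d\<in>set [0..<12]. adj c d \<and> adj d b)))"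
      using diameter_index unfolding list_all_iff list_ex_iff .
    have "i \<in> set [0..<12]" "j \<in> set [0..<12]" using ab(3,4) by simp_all
    from F[rule_format, OF this] show ?thesis by auto
  qed
  then show ?thesis
  proof (elim disjE exE conjE)
    assume "i = j" then show ?thesis using ab by simp
  next
    assume "adj i j" then show ?thesis using ab f(3) by simp
  next
    fix c assume "c < 12" "adj i c" "adj c j"
    then have "f c \<in> dirs v" "mink a (f c) = 0" "mink (f c) b = 0" using ab f(1,3) by auto
    then show ?thesis by blast
  next
    fix c d assume "c < 12" "adj i c" "d < 12" "adj c d" "adj d j"
    then have "f c \<in> dirs v" "f d \<in> dirs v" "mink a (f c) = 0" "mink (f c) (f d) = 0" "mink (f d) b = 0"
      using ab f(1,3) by auto
    then show ?thesis by blast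
  qed
qed

lemma dirs_neighbour_exists:
  assumes v: "v \<in> vert" and a: "a \<in> dirs v" shows "\<exists>p\<in>dirs v. mink a p = 0"
proof -
  obtain f where f: "dirs v = f ` {..<12}" "inj_on f {..<12}"
    "\<And>i j. i < 12 \<Longrightarrow> j < 12 \<Longrightarrow> mink (f i) (f j) = 0 \<longleftrightarrow> adj i j" using ico_cases[OF v] by metis
  obtain b where b: "b \<in> dirs v" "a \<noteq> b"
  proof -
    have "f 0 \<noteq> f 1" using f(2) by (auto dest: inj_onD)
    moreover have "f 0 \<in> dirs v" "f 1 \<in> dirs v" using f(1) by auto
    ultimately show thesis using that by metis
  qed
  show ?thesis using ico_diameter[OF v a b(1)] b by blast
qed

lemma orth_dirs_neq: "x \<in> dirs v \<Longrightarrow> mink x y = 0 \<Longrightarrow> x \<noteq> y"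
  using dirs_unit[of x v] by auto

section \<open>Triangles and stars in the icosahedron\<close>

lemma tri_of_three:
  assumes "i \<in> dirs v" "j \<in> dirs v" "k \<in> dirs v" "mink i j = 0" "mink i k = 0" "mink j k = 0"
  shows "tri v {i, j, k}"
proof -
  have "i \<noteq> j" "i \<noteq> k" "j \<noteq> k" using assms orth_dirs_neq by blast+
  then have "card {i, j, k} = 3" by simp
  moreover have "mink x y = 0" if "x \<in> {i, j, k}" "y \<in> {i, j, k}" "x \<noteq> y" for x y
    using that assms(4-6) mink_commute[of j i] mink_commute[of k i] mink_commute[of k j] by auto
  ultimately show ?thesis using assms(1-3) by (simp add: tri_def)
qed

lemma tri_orth: "tri v K \<longleftrightarrow> K \<subseteq> dirs v \<and> card K = 3 \<and> orth K"
  by (simp add: tri_def orth_def)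

lemma edge_in_tri:
  assumes v: "v \<in> vert" and n: "i \<in> dirs v" "j \<in> dirs v" "mink i j = 0"
  shows "\<exists>K. tri v K \<and> i \<in> K \<and> j \<in> K"
proof -
  have "{x \<in> dirs v. mink x i = 0 \<and> mink x j = 0} \<noteq> {}"
    using card_common_neighbours[OF v n] by (metis card.empty zero_neq_numeral)
  then obtain k where "k \<in> dirs v" "mink k i = 0" "mink k j = 0" by blast
  then have "tri v {i, j, k}" using n mink_commute[of k i] mink_commute[of k j] by (intro tri_of_three) auto
  then show ?thesis by blast
qed

lemma orth_extends:
  assumes v: "v \<in> vert" and X: "X \<subseteq> dirs v" "orth X" "X \<noteq> {}"
  shows "\<exists>K. tri v K \<and> X \<subseteq> K"
proof -
  have fin: "finite X" using X(1) finite_dirs[OF v] finite_subset by blast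
  have "card X \<le> 3" using orth_card_le_3[OF v X(1,2)] .
  moreover have "card X \<noteq> 0" using X(3) fin by simp
  ultimately consider "card X = 1" | "card X = 2" | "card X = 3" by linarith
  then show ?thesis
  proof cases
    case 1
    then obtain a where a: "X = {a}" by (rule card_1_singletonE)
    then obtain p where p: "p \<in> dirs v" "mink a p = 0" using dirs_neighbour_exists[OF v] X(1) by blast
    then show ?thesis using edge_in_tri[OF v _ p(1,2)] X(1) a by blast
  next
    case 2
    then obtain a b where ab: "X = {a, b}" "a \<noteq> b" by (auto simp: card_2_iff)
    then have "mink a b = 0" using X(2) by (simp add: orth_def)
    then show ?thesis using edge_in_tri[OF v] X(1) ab(1) by blast
  next
    case 3
    then show ?thesis using X tri_orth by blast
  qed
qed

text \<open>A triangle inside the star that missed some \<open>a\<close> would form four mutually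
  orthogonal directions with it.\<close>

lemma tri_contains:
  assumes v: "v \<in> vert" and A: "A \<subseteq> dirs v" and K: "tri v K" "K \<subseteq> link v A" shows "A \<subseteq> K"
proof
  fix a assume a: "a \<in> A"
  show "a \<in> K"
  proof (rule ccontr)
    assume "a \<notin> K"
    then have "card (insert a K) = 4" using K(1) tri_finite[OF K(1)] by (simp add: tri_def)
    moreover have "insert a K \<subseteq> dirs v" using K(1) A a by (auto simp: tri_def)
    moreover have "orth (insert a K)" unfolding orth_def
    proof (intro ballI impI)
      fix x y assume xy: "x \<in> insert a K" "y \<in> insert a K" "x \<noteq> y"
      have z: "mink z a = 0" if "z \<in> K" for z using that K(2) a \<open>a \<notin> K\<close> by (auto simp: link_def)
      show "mink x y = 0"
        using xy z[of x] z[of y] mink_commute[of a y] tri_orthogonal[OF K(1), of x y]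
        by (cases "x = a"; cases "y = a") auto
    qed
    ultimately show False using orth_card_le_3[OF v, of "insert a K"] by simp
  qed
qed

lemma link_contains:
  assumes "tri v K" "A \<subseteq> K" shows "K \<subseteq> link v A"
  unfolding link_def using tri_dirs[OF assms(1)] tri_orthogonal[OF assms(1)] assms(2) by blast

lemma link_in_tri:
  assumes v: "v \<in> vert" and A: "A \<subseteq> dirs v" "orth A" and j: "j \<in> link v A"
  shows "\<exists>K. tri v K \<and> K \<subseteq> link v A \<and> j \<in> K"
proof -
  have jn: "j \<in> dirs v" using j by (simp add: link_def)
  have "orth (insert j A)" unfolding orth_def
  proof (intro ballI impI)
    fix x y assume xy: "x \<in> insert j A" "y \<in> insert j A" "x \<noteq> y"
    have z: "mink j z = 0" if "z \<in> A" "j \<noteq> z" for z using that j by (auto simp: link_def)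
    show "mink x y = 0"
    proof (cases "x = j \<or> y = j")
      case True
      then show ?thesis using xy z[of x] z[of y] mink_commute[of x j] by auto
    next
      case False
      then show ?thesis using xy A(2) unfolding orth_def by blast
    qed
  qed
  then obtain K where K: "tri v K" "insert j A \<subseteq> K" using orth_extends[OF v, of "insert j A"] A(1) jn by auto
  then show ?thesis using link_contains[OF K(1), of A] by auto
qed

text \<open>\<open>closed\<close> passes from a triangle to the other one at the same edge; the proof walks around the
  fan of a common vertex, and from fan to fan if there is no plane.\<close>

lemma tri_connected:
  assumes v: "v \<in> vert" and A: "A \<subseteq> dirs v" "orth A"
    and K: "tri v K" "K \<subseteq> link v A" "K \<in> R" and K': "tri v K'" "K' \<subseteq> link v A"
    and closed: "\<And>K k. K \<in> R \<Longrightarrow> tri v K \<Longrightarrow> K \<subseteq> link v A \<Longrightarrow> k \<in> K \<Longrightarrow>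
      insert (flip v K k) (K - {k}) \<subseteq> link v A \<Longrightarrow> insert (flip v K k) (K - {k}) \<in> R"
  shows "K' \<in> R"
proof -
  define T where "T = {K. tri v K \<and> K \<subseteq> link v A}"
  have edge: "M' \<in> R" if M: "M \<in> R" "M \<in> T" "M' \<in> T" "x \<in> M" "y \<in> M" "x \<in> M'" "y \<in> M'" "x \<noteq> y" for M M' x y
  proof (cases "M = M'")
    case True then show ?thesis using M by simp
  next
    case False
    have t: "tri v M" "tri v M'" using M by (auto simp: T_def)
    have split: "\<exists>k. N = {x, y, k} \<and> k \<noteq> x \<and> k \<noteq> y" if "tri v N" "x \<in> N" "y \<in> N" for N
    proof -
      have "card (N - {x, y}) = 1" using that M(8) tri_finite[OF that(1)] by (simp add: tri_def card_Diff_subset)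
      then obtain k where "N - {x, y} = {k}" by (rule card_1_singletonE)
      then show ?thesis using that by blast
    qed
    obtain k where k: "M = {x, y, k}" "k \<noteq> x" "k \<noteq> y" using split[OF t(1)] M by blast
    obtain k' where k': "M' = {x, y, k'}" "k' \<noteq> x" "k' \<noteq> y" using split[OF t(2)] M by blast
    have kk: "k \<noteq> k'" using False k k' by blast
    have Mk: "k \<in> M" "M - {k} = {x, y}" using k by auto
    let ?f = "flip v M k"
    have "?f \<in> dirs v" "mink ?f x = 0" "mink ?f y = 0" "?f \<noteq> k"
      using flip_props[OF v t(1) Mk(1)] Mk by auto
    moreover have "x \<in> dirs v" "y \<in> dirs v" "k \<in> dirs v" "k' \<in> dirs v"
      using tri_dirs[OF t(1)] tri_dirs[OF t(2)] k k' by auto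
    moreover have "mink x y = 0" "mink k x = 0" "mink k y = 0"
      using tri_orthogonal[OF t(1)] k M(8) by auto
    moreover have "mink k' x = 0" "mink k' y = 0" using tri_orthogonal[OF t(2)] k' by auto
    \<comment> \<open>An edge lies in exactly two triangles, so the flip of \<open>k\<close> can
      only be \<open>k'\<close>.\<close>
    ultimately have "?f = k \<or> ?f = k'" using kk by (intro common_neighbour_cases[OF v, of x y]) auto
    then have "?f = k'" using \<open>?f \<noteq> k\<close> by simp
    then have "insert ?f (M - {k}) = M'" using Mk k' by auto
    then show ?thesis using closed[OF M(1) t(1) _ Mk(1)] M(2,3) by (simp add: T_def)
  qed
  have KT: "K \<in> T" "K' \<in> T" using K K' by (auto simp: T_def)
  have sub: "A \<subseteq> K" "A \<subseteq> K'" using tri_contains[OF v A(1)] K K' by auto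
  have fin: "finite A" using A(1) finite_dirs[OF v] finite_subset by blast
  have fan: "M' \<in> R" if M: "M \<in> R" "M \<in> T" "M' \<in> T" "a \<in> M" "a \<in> M'" "A \<subseteq> {a}" for M M' a
  proof -
    have t: "tri v M" "tri v M'" using M by (auto simp: T_def)
    have a: "a \<in> dirs v" using tri_dirs[OF t(1) M(4)] .
    have inT: "N \<in> T" if "tri v N" "a \<in> N" for N using link_contains[OF that(1), of A] that M(6) by (auto simp: T_def)
    have other: "\<exists>p. p \<in> N \<and> p \<noteq> a" if "tri v N" "a \<in> N" for N
    proof -
      have "card (N - {a}) = 2" using that by (simp add: tri_def)
      then have "N - {a} \<noteq> {}" by (metis card.empty zero_neq_numeral)
      then show ?thesis by blast
    qed
    obtain p where p: "p \<in> M" "p \<noteq> a" using other[OF t(1) M(4)] by blast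
    obtain q where q: "q \<in> M'" "q \<noteq> a" using other[OF t(2) M(5)] by blast
    have n: "p \<in> dirs v" "q \<in> dirs v" "mink a p = 0" "mink a q = 0"
      using tri_dirs[OF t(1)] tri_dirs[OF t(2)] tri_orthogonal[OF t(1) M(4)] tri_orthogonal[OF t(2) M(5)] p q by auto
    from fan_diameter[OF v a n] show ?thesis
    proof (elim disjE bexE conjE)
      assume "p = q" then show ?thesis using edge[OF M(1-3), of a p] M p q by blast
    next
      assume "mink p q = 0"
      then have N: "tri v {a, p, q}" using a n by (intro tri_of_three)
      have "{a, p, q} \<in> R" by (rule edge[OF M(1,2) inT[OF N], of a p]) (use M p in auto)
      then show ?thesis by (rule edge[OF _ inT[OF N] M(3), of a q]) (use M q in auto)
    next
      fix m assume m: "m \<in> dirs v" "mink a m = 0" "mink p m = 0" "mink q m = 0"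
      have N: "tri v {a, p, m}" "tri v {a, q, m}" using a n m by (auto intro: tri_of_three)
      have am: "a \<noteq> m" using orth_dirs_neq a m(2) by blast
      have "{a, p, m} \<in> R" by (rule edge[OF M(1,2) inT[OF N(1)], of a p]) (use M p in auto)
      then have "{a, q, m} \<in> R" by (rule edge[OF _ inT[OF N(1)] inT[OF N(2)], of a m]) (use am in auto)
      then show ?thesis by (rule edge[OF _ inT[OF N(2)] M(3), of a q]) (use M q in auto)
    qed
  qed
  consider "2 \<le> card A" | a where "A = {a}" | "A = {}"
  proof -
    have "card A = 0 \<or> card A = 1 \<or> 2 \<le> card A" by linarith
    then show thesis using that fin card_1_singletonE by (metis card_0_eq)
  qed
  then show ?thesis
  proof cases
    case 1
    then obtain B where B: "B \<subseteq> A" "card B = 2" using obtain_subset_with_card_n by metis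
    then obtain x y where "B = {x, y}" "x \<noteq> y" by (auto simp: card_2_iff)
    then show ?thesis using edge[OF K(3) KT, of x y] sub B by blast
  next
    case (2 a)
    then show ?thesis using fan[OF K(3) KT, of a] sub by blast
  next
    case 3
    have inT: "tri v N \<Longrightarrow> N \<in> T" for N using link_contains[of v N A] 3 by (auto simp: T_def)
    have fan': "M' \<in> R" if "M \<in> R" "tri v M" "tri v M'" "a \<in> M" "a \<in> M'" for M M' a
      using fan[OF that(1) inT[OF that(2)] inT[OF that(3)] that(4,5)] 3 by simp
    have move: "\<exists>M. M \<in> R \<and> tri v M \<and> b \<in> M" if M: "M \<in> R" "tri v M" "a \<in> M" "b \<in> dirs v" "mink a b = 0" for M a b
    proof -
      obtain N where "tri v N" "a \<in> N" "b \<in> N" using edge_in_tri[OF v tri_dirs[OF M(2,3)] M(4,5)] by blast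
      then show ?thesis using fan'[OF M(1,2)] M(3) by blast
    qed
    have ne: "K \<noteq> {}" "K' \<noteq> {}" using K(1) K'(1) by (auto simp: tri_def)
    then obtain a b where ab: "a \<in> K" "b \<in> K'" by blast
    have n: "a \<in> dirs v" "b \<in> dirs v" using ab tri_dirs K(1) K'(1) by auto
    have "\<exists>M. M \<in> R \<and> tri v M \<and> b \<in> M"
      using ico_diameter[OF v n]
    proof (elim disjE bexE conjE)
      assume "a = b" then show ?thesis using ab K by blast
    next
      assume "mink a b = 0" then show ?thesis using move[OF K(3,1) ab(1) n(2)] by blast
    next
      fix c assume "c \<in> dirs v" "mink a c = 0" "mink c b = 0"
      then show ?thesis using move[OF K(3,1) ab(1)] move[OF _ _ _ n(2)] by meson
    next
      fix c d assume c: "c \<in> dirs v" "d \<in> dirs v" "mink a c = 0" "mink c d = 0" "mink d b = 0"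
      obtain M where "M \<in> R" "tri v M" "c \<in> M" using move[OF K(3,1) ab(1) c(1,3)] by blast
      then obtain M where "M \<in> R" "tri v M" "d \<in> M" using move[OF _ _ _ c(2,4)] by blast
      then show ?thesis using move[OF _ _ _ n(2) c(5)] by blast
    qed
    then show ?thesis using fan' K'(1) ab(2) by blast
  qed
qed

section \<open>Distances\<close>

definition honey_edges :: "(mvec \<times> mvec) set" where
  "honey_edges = {(v, step v j) | v j. v \<in> vert \<and> j \<in> dirs v}"

lemma honey_edges_I: "v \<in> vert \<Longrightarrow> j \<in> dirs v \<Longrightarrow> (v, step v j) \<in> honey_edges"
  unfolding honey_edges_def by blast

lemma honey_edges_cases:
  assumes "(v, w) \<in> honey_edges"
  obtains j where "v \<in> vert" "j \<in> dirs v" "w = step v j"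
  using assms unfolding honey_edges_def by blast

lemma honey_edges_reflection:
  assumes h: "h \<in> mirrors" and e: "(v, w) \<in> honey_edges" shows "(reflection h v, reflection h w) \<in> honey_edges"
proof -
  obtain j where j: "v \<in> vert" "j \<in> dirs v" "w = step v j" using e by (rule honey_edges_cases)
  have "reflection h w = step (reflection h v) (reflection h j)"
    using j(3) by (simp add: step_def linear_add[OF reflection_linear] linear_scale[OF reflection_linear])
  moreover have "reflection h j \<in> dirs (reflection h v)" using j(2) dirs_reflection[OF h] by blast
  ultimately show ?thesis using honey_edges_I reflection_vert[OF j(1) h] by metis
qed

lemma edge_crossing_back:
  assumes "v \<in> vert" "j \<in> dirs v" "h \<in> mirrors" "0 < mink v h" "mink (step v j) h < 0"
  shows "j = - h"
proof -
  have "mink v (- h) < 0" "0 < mink (step v j) (- h)" using assms(4,5) by (simp_all add: mink_simps)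
  then show ?thesis
    using edge_crosses_one_mirror[OF vert_hyp3[OF assms(1)] assms(2) mirrors_minus[OF assms(3)]] by simp
qed

text \<open>Folding: reflect the part of a path behind its last crossing of a mirror.\<close>

lemma fold_path:
  assumes "(V, w) \<in> honey_edges ^^ n" "V \<in> vert" "h \<in> mirrors" "0 < mink V h" "mink w h < 0"
  shows "\<exists>m. n = Suc m \<and> (V, reflection h w) \<in> honey_edges ^^ m"
  using assms
proof (induction n arbitrary: w)
  case 0
  then show ?case by simp
next
  case (Suc n)
  then obtain z where z: "(V, z) \<in> honey_edges ^^ n" "(z, w) \<in> honey_edges" by (auto elim: relpow_Suc_E)
  obtain j where j: "z \<in> vert" "j \<in> dirs z" "w = step z j" using z(2) by (rule honey_edges_cases)
  have "mink z h \<noteq> 0" using vert_off_mirror[OF j(1) Suc.prems(3)] .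
  then consider "mink z h < 0" | "0 < mink z h" by linarith
  then show ?case
  proof cases
    case 1
    then obtain m where m: "n = Suc m" "(V, reflection h z) \<in> honey_edges ^^ m"
      using Suc.IH[OF z(1) Suc.prems(2-4)] by blast
    then have "(V, reflection h w) \<in> honey_edges ^^ n"
      using relpow_Suc_I[OF m(2) honey_edges_reflection[OF Suc.prems(3) z(2)]] by simp
    then show ?thesis by blast
  next
    case 2
    \<comment> \<open>The last edge is itself the crossing, so \<open>h\<close> is its bisector and
      folding removes this edge.\<close>
    then have "j = - h" using edge_crossing_back[OF j(1,2) Suc.prems(3)] Suc.prems(5) j(3) by simp
    then have "w = reflection h z" using j step_eq_reflection[OF j(2)] by (simp add: reflection_def mink_simps)
    moreover have "mink h h = 1" using Suc.prems(3) by (simp add: mirrors_def)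
    ultimately have "reflection h w = z" using reflection_invol by simp
    then show ?thesis using z(1) by blast
  qed
qed

text \<open>Two vertices next to the same mirror: their connecting paths run parallel to it.\<close>

lemma descent_orthogonal:
  assumes w: "w \<in> vert" and V: "V \<in> vert" and a: "a \<in> dirs w" "a \<in> dirs V" and j: "j \<in> dirs w" "0 < mink V j"
  shows "mink j a = 0"
proof (rule ccontr)
  assume no: "mink j a \<noteq> 0"
  have "j \<noteq> a" using dirs_mink[OF a(2)] j(2) sh_pos by auto
  then have le: "mink j a \<le> -1" using dirs_dichotomy[OF w j(1) a(1)] no by blast
  \<comment> \<open>\<open>V\<close> is pushed across \<open>a\<close>. As an edge crosses only its
    own bisector, the new point is still behind \<open>j\<close>; it is then behind both mirrors and
    \<open>w\<close> before both, which disjointness forbids.\<close>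
  let ?p = "step V a"
  have p: "?p \<in> vert" using step_vert[OF V a(2)] .
  have pa: "0 < mink ?p a" using dirs_mink[OF a(2)] dirs_unit[OF a(2)] sh_pos by (simp add: mink_step)
  have jm: "j \<in> mirrors" using j(1) dirs_mirrors by blast
  have "mink ?p j \<noteq> 0" using vert_off_mirror[OF p jm] .
  moreover have "\<not> mink ?p j < 0"
  proof
    assume "mink ?p j < 0"
    then have "a = - j" using edge_crossing_back[OF V a(2) jm j(2)] by simp
    then show False using dirs_mink[OF a(1)] dirs_mink[OF j(1)] sh_pos by (simp add: mink_simps)
  qed
  ultimately have pj: "0 < mink ?p j" by linarith
  have neg: "mink w j < 0" "mink w a < 0" using dirs_mink[OF a(1)] dirs_mink[OF j(1)] sh_pos by simp_all
  show False
    using disjoint_half_spaces[OF vert_hyp3[OF p] vert_hyp3[OF w] dirs_unit[OF j(1)] dirs_unit[OF a(1)] le neg pj pa] .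
qed

lemma step_inject: "step w i = step w j \<longleftrightarrow> i = j"
  using sh_pos by (simp add: step_def)

locale corner =
  fixes V :: mvec and K0 :: "mvec set"
  assumes V_vert: "V \<in> vert" and K0_tri: "tri V K0"
begin

abbreviation "Q \<equiv> cube V K0"

definition reach :: "mvec set" where "reach = {w. (V, w) \<in> honey_edges\<^sup>*}"

text \<open>Distance in the whole honeycomb, where every mirror acts; \<open>level_eq\<close> shows
  that it agrees with the distance inside the octant.\<close>

definition dst :: "mvec \<Rightarrow> nat" where "dst w = (LEAST n. (V, w) \<in> honey_edges ^^ n)"

lemma reach_vert: "w \<in> reach \<Longrightarrow> w \<in> vert"
  unfolding reach_def mem_Collect_eq
proof (induction rule: rtrancl_induct)
  case base then show ?case using V_vert .
next
  case (step y z)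
  then show ?case using step_vert by (metis honey_edges_cases)
qed

lemma V_reach: "V \<in> reach" by (simp add: reach_def)

lemma reach_step: "w \<in> reach \<Longrightarrow> j \<in> dirs w \<Longrightarrow> step w j \<in> reach"
  using honey_edges_I[OF reach_vert, of w j] rtrancl_into_rtrancl[of V w honey_edges "step w j"] by (simp add: reach_def)

lemma dst_path: "w \<in> reach \<Longrightarrow> (V, w) \<in> honey_edges ^^ dst w"
  unfolding dst_def reach_def mem_Collect_eq by (metis LeastI_ex rtrancl_imp_relpow)

lemma dst_le: "(V, w) \<in> honey_edges ^^ n \<Longrightarrow> dst w \<le> n"
  unfolding dst_def by (rule Least_le)

lemma dst_0: "w \<in> reach \<Longrightarrow> dst w = 0 \<longleftrightarrow> w = V"
  using dst_path[of w] dst_le[of V 0] by auto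

lemma dst_step_le:
  assumes "w \<in> reach" "j \<in> dirs w" shows "dst (step w j) \<le> Suc (dst w)"
  by (rule dst_le[OF relpow_Suc_I[OF dst_path[OF assms(1)] honey_edges_I[OF reach_vert[OF assms(1)] assms(2)]]])

text \<open>A shortest path to \<open>w\<close> crosses the bisector \<open>j\<close>; folding it
  there yields a path to the neighbour with one edge less.\<close>

lemma dst_down:
  assumes w: "w \<in> reach" and j: "j \<in> dirs w" "0 < mink V j" shows "dst w = Suc (dst (step w j))"
proof -
  have neg: "mink w j < 0" using dirs_mink[OF j(1)] sh_pos by simp
  obtain m where m: "dst w = Suc m" "(V, reflection j w) \<in> honey_edges ^^ m"
    using fold_path[OF dst_path[OF w] V_vert dirs_mirrors[OF j(1)] j(2) neg] by blast
  then have "dst (step w j) \<le> m" using dst_le step_eq_reflection[OF j(1)] by simp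
  moreover have "dst w \<le> Suc (dst (step w j))"
    using dst_step_le[OF reach_step[OF w j(1)] step_back(1)[OF j(1)]] step_back(2)[OF j(1)] by simp
  ultimately show ?thesis using m(1) by linarith
qed

lemma dst_up:
  assumes w: "w \<in> reach" and j: "j \<in> dirs w" "\<not> 0 < mink V j" shows "dst (step w j) = Suc (dst w)"
proof -
  have "mink V j \<noteq> 0" using vert_off_mirror[OF V_vert dirs_mirrors[OF j(1)]] .
  then have "0 < mink V (- j)" using j(2) by (simp add: mink_simps)
  then show ?thesis
    using dst_down[OF reach_step[OF w j(1)] step_back(1)[OF j(1)]] step_back(2)[OF j(1)] by simp
qed

definition desc :: "mvec \<Rightarrow> mvec set" where "desc w = {j \<in> dirs w. 0 < mink V j}"

text \<open>The last edge of a shortest path, traversed backwards, descends.\<close>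

lemma desc_nonempty:
  assumes w: "w \<in> reach" "w \<noteq> V" shows "desc w \<noteq> {}"
proof -
  obtain n where n: "dst w = Suc n" using dst_0[OF w(1)] w(2) by (cases "dst w") auto
  then obtain z where z: "(V, z) \<in> honey_edges ^^ n" "(z, w) \<in> honey_edges" using dst_path[OF w(1)] by (auto elim: relpow_Suc_E)
  obtain i where i: "z \<in> vert" "i \<in> dirs z" "w = step z i" using z(2) by (rule honey_edges_cases)
  have j: "- i \<in> dirs w" "step w (- i) = z" using step_back[OF i(2)] i(3) by auto
  have "0 < mink V (- i)"
  proof (rule ccontr)
    assume "\<not> 0 < mink V (- i)"
    then have "dst z = Suc (dst w)" using dst_up[OF w(1) j(1)] j(2) by simp
    then show False using dst_le[OF z(1)] n by simp
  qed
  then show ?thesis using j(1) unfolding desc_def by blast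
qed

lemma desc_dirs: "desc w \<subseteq> dirs w" by (simp add: desc_def)

text \<open>\<open>V\<close> is behind every descending bisector, so no two of them can have
  disjoint far sides.\<close>

lemma desc_orth:
  assumes w: "w \<in> vert" shows "orth (desc w)"
  unfolding orth_def
proof (intro ballI impI)
  fix i j assume ij: "i \<in> desc w" "j \<in> desc w" "i \<noteq> j"
  then have n: "i \<in> dirs w" "j \<in> dirs w" "0 < mink V i" "0 < mink V j" by (auto simp: desc_def)
  have neg: "mink w i < 0" "mink w j < 0" using dirs_mink[OF n(1)] dirs_mink[OF n(2)] sh_pos by simp_all
  have "\<not> mink i j \<le> -1"
    using disjoint_half_spaces[OF vert_hyp3[OF V_vert] vert_hyp3[OF w] dirs_unit[OF n(1)] dirs_unit[OF n(2)] _ neg n(3,4)]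
    by blast
  then show "mink i j = 0" using dirs_dichotomy[OF w n(1,2)] ij(3) by blast
qed

section \<open>The octant\<close>

text \<open>The plane through \<open>V\<close> belonging to \<open>a \<in> K0\<close> consists of the vertices directly in front
  of the mirror \<open>a\<close>, and the octant lies behind this mirror except for these vertices.\<close>

definition oct :: "mvec set" where
  "oct = {w \<in> reach. \<forall>a\<in>K0. 0 < mink w a \<or> mink w a = - sh}"

definition planes :: "mvec \<Rightarrow> mvec set" where "planes w = {a \<in> K0. mink w a = - sh}"

lemma oct_reach: "w \<in> oct \<Longrightarrow> w \<in> reach" by (simp add: oct_def)

lemma oct_vert: "w \<in> oct \<Longrightarrow> w \<in> vert" using oct_reach reach_vert by blast

lemma K0_mirrors: "a \<in> K0 \<Longrightarrow> a \<in> mirrors" using K0_tri tri_dirs dirs_mirrors by blast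

lemma planes_dirs: "planes w \<subseteq> dirs w" using K0_mirrors unfolding planes_def dirs_def by blast

lemma planes_K0: "planes w \<subseteq> K0" unfolding planes_def by blast

lemma K0_orth: "orth K0" using K0_tri tri_orth by blast

lemma planes_orth: "orth (planes w)" using orth_subset[OF K0_orth planes_K0] .

lemma V_planes: "planes V = K0" unfolding planes_def using tri_dirs[OF K0_tri] dirs_mink by blast

lemma V_oct: "V \<in> oct" unfolding oct_def using V_reach tri_dirs[OF K0_tri] dirs_mink by blast

lemma oct_neg: "w \<in> oct \<Longrightarrow> a \<in> K0 \<Longrightarrow> mink w a \<le> 0 \<Longrightarrow> a \<in> planes w"
  unfolding oct_def planes_def by fastforce

text \<open>No edge overshoots: one that crosses a mirror \<open>a\<close> of the corner towards the
  front has \<open>a\<close> as its bisector and ends directly in front of it.\<close>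

lemma oct_step:
  assumes w: "w \<in> oct" and j: "j \<in> link w (planes w)" shows "step w j \<in> oct"
proof -
  have jn: "j \<in> dirs w" using j by (simp add: link_def)
  have wv: "w \<in> vert" using oct_vert[OF w] .
  have "0 < mink (step w j) a \<or> mink (step w j) a = - sh" if a: "a \<in> K0" for a
  proof (cases "a \<in> planes w")
    case True
    then have wa: "mink w a = - sh" by (simp add: planes_def)
    have "j = a \<or> mink j a = 0" using j True by (simp add: link_def)
    then show ?thesis
    proof
      assume "j = a"
      then show ?thesis using wa dirs_unit[OF jn] sh_pos by (simp add: mink_step)
    next
      assume "mink j a = 0"
      then show ?thesis using wa by (simp add: mink_step)
    qed
  next
    case False
    then have pos: "0 < mink w a" using w a by (auto simp: oct_def planes_def)
    show ?thesis
    proof (cases "mink (step w j) a < 0")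
      case True
      then have ja: "j = - a" using edge_crossing_back[OF wv jn K0_mirrors[OF a] pos] by simp
      then have "mink w a = sh" using dirs_mink[OF jn] by (simp add: mink_simps)
      moreover have "mink a a = 1" using K0_mirrors[OF a] by (simp add: mirrors_def)
      ultimately show ?thesis using ja by (simp add: mink_step mink_simps)
    next
      case False
      then show ?thesis using vert_off_mirror[OF step_vert[OF wv jn] K0_mirrors[OF a]] by linarith
    qed
  qed
  then show ?thesis using reach_step[OF oct_reach[OF w] jn] by (simp add: oct_def)
qed

lemma planes_step:
  assumes w: "w \<in> oct" and k: "k \<in> link w (planes w)" and a: "a \<in> planes (step w k)"
  shows "a \<in> planes w \<or> k = - a"
proof (rule ccontr)
  assume no: "\<not> (a \<in> planes w \<or> k = - a)"
  have aK: "a \<in> K0" "mink (step w k) a = - sh" using a by (auto simp: planes_def)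
  have "0 < mink w a" using oct_neg[OF w aK(1)] no by force
  moreover have "mink (step w k) a < 0" using aK sh_pos by simp
  ultimately show False
    using edge_crossing_back[OF oct_vert[OF w] _ K0_mirrors[OF aK(1)]] k no by (simp add: link_def)
qed

text \<open>A cube of the octant is admissible from each of its corners: along \<open>k\<close> the
  only plane that can be gained is \<open>- k\<close>, and the plane \<open>k\<close> is
  left.\<close>

lemma link_step:
  assumes w: "w \<in> oct" and K: "tri w K" "K \<subseteq> link w (planes w)" and k: "k \<in> K"
  shows "insert (- k) (K - {k}) \<subseteq> link (step w k) (planes (step w k))"
proof
  fix j assume j: "j \<in> insert (- k) (K - {k})"
  have kL: "k \<in> link w (planes w)" using K(2) k by blast
  have "j \<in> dirs (step w k)" using tri_dirs[OF tri_step[OF oct_vert[OF w] K(1) k] j] .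
  moreover have "j = a \<or> mink j a = 0" if a: "a \<in> planes (step w k)" for a
  proof (cases "k = - a")
    case True
    then show ?thesis using j tri_orthogonal[OF K(1), of j k] k by (auto simp: mink_simps)
  next
    case False
    then have aw: "a \<in> planes w" using planes_step[OF w kL a] by blast
    have ka: "k \<noteq> a"
    proof
      assume "k = a"
      then have "mink (step w k) a = sh" using aw dirs_unit[OF tri_dirs[OF K(1) k]] by (simp add: mink_step planes_def)
      then show False using a sh_pos by (simp add: planes_def)
    qed
    show ?thesis
    proof (cases "j = - k")
      case True
      have "mink k a = 0" using kL aw ka by (auto simp: link_def)
      then show ?thesis using True by (simp add: mink_simps)
    next
      case False
      then have "j \<in> link w (planes w)" using j K(2) by blast
      then show ?thesis using aw by (simp add: link_def)
    qed
  qed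
  ultimately show "j \<in> link (step w k) (planes (step w k))" by (simp add: link_def)
qed

text \<open>A cube of the octant with a chosen corner, described by mirrors.
  \<open>octant_flag\<close> brings the inductively generated cubes into this form, and
  \<open>octant_at_vertex\<close> leads back.\<close>

definition flag :: "mvec \<Rightarrow> mvec set \<Rightarrow> bool" where
  "flag w K \<longleftrightarrow> w \<in> oct \<and> tri w K \<and> K \<subseteq> link w (planes w)"

lemma flag_vert: "flag w K \<Longrightarrow> w \<in> vert" and flag_tri: "flag w K \<Longrightarrow> tri w K"
  by (auto simp: flag_def oct_vert)

lemma flag_step: "flag w K \<Longrightarrow> k \<in> K \<Longrightarrow> flag (step w k) (insert (- k) (K - {k}))"
  unfolding flag_def using oct_step tri_step[OF oct_vert] link_step by blast

lemma flag_verts: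
  assumes "flag w K" "x \<in> cube_verts (cube w K)"
  obtains K' where "flag x K'" "cube w K = cube x K'"
proof -
  obtain J where J: "J \<subseteq> K" "x = w + (2 * sh) *\<^sub>R \<Sum>J"
    using assms(2) cube_verts_cube[OF flag_vert[OF assms(1)] flag_tri[OF assms(1)]] by blast
  have "finite J" using J(1) tri_finite[OF flag_tri[OF assms(1)]] finite_subset by blast
  then have "\<exists>K'. flag (w + (2 * sh) *\<^sub>R \<Sum>J) K' \<and> cube (w + (2 * sh) *\<^sub>R \<Sum>J) K' = cube w K"
    using assms(1) J(1)
  proof (induction J arbitrary: w K rule: finite_induct)
    case empty
    then show ?case by auto
  next
    case (insert j J)
    let ?w = "step w j" and ?K = "insert (- j) (K - {j})"
    have j: "j \<in> K" using insert.prems by blast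
    have "flag ?w ?K" "J \<subseteq> ?K" using flag_step[OF insert.prems(1) j] insert by auto
    from insert.IH[OF this] obtain K' where
      "flag (?w + (2 * sh) *\<^sub>R \<Sum>J) K'" "cube (?w + (2 * sh) *\<^sub>R \<Sum>J) K' = cube w K"
      using cube_step[OF flag_tri[OF insert.prems(1)] j] by auto
    moreover have "?w + (2 * sh) *\<^sub>R \<Sum>J = w + (2 * sh) *\<^sub>R \<Sum>(insert j J)"
      using insert.hyps by (simp add: step_def algebra_simps)
    ultimately show ?case by auto
  qed
  then show thesis using that J(2) by metis
qed

lemma flag_face_cases:
  assumes "flag w K" "m \<in> cube w K"
  obtains x K' k where "flag x K'" "cube w K = cube x K'" "k \<in> K'" "m = nrm x K' (-1) k"
proof -
  note t = flag_tri[OF assms(1)]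
  obtain s k where sk: "m = nrm w K s k" "k \<in> K" "s = 1 \<or> s = -1" using assms(2) by (auto simp: cube_def)
  show thesis
  proof (cases "s = -1")
    case True
    then show thesis using that[of w K k] assms sk by simp
  next
    case False
    have "m = nrm (step w k) (insert (- k) (K - {k})) (-1) (- k)"
      using False sk by (simp add: nrm_step[OF t sk(2)] nrm_minus)
    then show thesis
      using that[of "step w k" "insert (- k) (K - {k})" "- k"] flag_step[OF assms(1) sk(2)] cube_step[OF t sk(2)] by simp
  qed
qed

section \<open>Bounding planes as layers of cubes\<close>

definition plane_normal :: "mvec \<Rightarrow> mvec" where "plane_normal a = nrm V K0 (-1) a"

lemma corner_faces_eq: "corner_faces Q V = plane_normal ` K0"
  unfolding corner_faces_def plane_normal_def
  using corner_zero_normals[OF vert_hyp3[OF V_vert] K0_tri empty_subsetI] by simp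

lemma plane_normal_inj: "inj_on plane_normal K0"
  unfolding plane_normal_def using nrm_inject[OF K0_tri] by (intro inj_onI) blast

lemma vertex_in_face:
  assumes "w \<in> vert" "tri w K" "k \<in> K" shows "w \<in> face (cube w K) (nrm w K (-1) k)"
  using cube_vertex[OF assms(1,2)] nrm_vertex_iff[OF assms, of "-1"] by (simp add: face_def cube_verts_def)

lemma step_in_face:
  assumes "w \<in> vert" "tri w K" "k \<in> K" "i \<in> K" "i \<noteq> k" shows "step w i \<in> face (cube w K) (nrm w K (-1) k)"
proof -
  have "mink (w + (2 * sh) *\<^sub>R \<Sum>{i}) (nrm w K (-1) k) = 0"
    using corner_nrm(2)[OF vert_hyp3[OF assms(1)] assms(2) _ assms(3), of "{i}" "-1"] assms(4,5) by simp
  then show ?thesis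
    using cube_vertex_step[OF assms(1,2,4)] by (simp add: face_def cube_verts_def step_def)
qed

text \<open>Reflections in side faces fix the direction \<open>a\<close>, so it is carried through
  the whole layer and its mirror bisects every cube.\<close>

lemma layer_shape:
  assumes "(R, m) \<in> layer Q (plane_normal a)" "a \<in> K0"
  shows "\<exists>y K. y \<in> vert \<and> tri y K \<and> a \<in> K \<and> R = cube y K \<and> m = nrm y K (-1) a"
  using assms(1)
proof (induction rule: layer.induct)
  case base
  then show ?case using V_vert K0_tri assms(2) unfolding plane_normal_def by blast
next
  case (reflect R m k)
  then obtain y K where y: "y \<in> vert" "tri y K" "a \<in> K" "R = cube y K" "m = nrm y K (-1) a" by blast
  obtain s b where b: "k = nrm y K s b" "b \<in> K" "s = 1 \<or> s = -1" using reflect.hyps(2) y(4) by (auto simp: cube_def)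
  \<comment> \<open>For \<open>a = b\<close> the faces \<open>k\<close> and \<open>m\<close> would
    be opposite, hence disjoint.\<close>
  have ab: "a \<noteq> b"
  proof
    assume "a = b"
    then have "s = 1" using b reflect.hyps(3) y(5) by auto
    obtain p where "p \<in> face R k" "p \<in> face R m" using reflect.hyps(4) by blast
    then have p: "p \<in> hyp3" "mink p k = 0" "mink p m = 0" by (auto simp: face_def solid_def)
    have "mink p (ctr y K) = 0"
      using p(2,3) unfolding b(1) y(5) nrm_zero_iff \<open>a = b\<close> \<open>s = 1\<close> by (simp add: algebra_simps)
    then show False using ctr_neg[OF vert_hyp3[OF y(1)] y(2) p(1)] by simp
  qed
  \<comment> \<open>A corner on the face \<open>k\<close> is chosen; moving along \<open>b\<close>,
    which differs from \<open>a\<close>, does not leave the face \<open>m\<close>.\<close>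
  obtain x K' b' where x: "x \<in> vert" "tri x K'" "a \<in> K'" "b' \<in> K'" "a \<noteq> b'" "R = cube x K'"
     "m = nrm x K' (-1) a" "k = nrm x K' (-1) b'"
  proof (cases "s = -1")
    case True
    then show thesis using that[of y K b] y b ab by simp
  next
    case False
    let ?K = "insert (- b) (K - {b})"
    have "k = nrm (step y b) ?K (-1) (- b)" using False b by (simp add: nrm_step[OF y(2) b(2)] nrm_minus)
    moreover have "m = nrm (step y b) ?K (-1) a" using y(5) by (simp add: nrm_step[OF y(2) b(2)])
    moreover have "a \<noteq> - b"
    proof
      assume "a = - b"
      then have "mink y a = - mink y b" by (simp add: mink_simps)
      then show False using dirs_mink[OF tri_dirs[OF y(2,3)]] dirs_mink[OF tri_dirs[OF y(2) b(2)]] sh_pos by simp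
    qed
    ultimately show thesis
      using that[of "step y b" ?K "- b"] step_vert[OF y(1) tri_dirs[OF y(2) b(2)]]
        tri_step[OF y(1,2) b(2)] cube_step[OF y(2) b(2)] y(3,4) ab by simp
  qed
  let ?K = "insert (flip x K' b') (K' - {b'})"
  have "reflection k m = nrm x ?K (-1) a"
    using reflection_nrm_nrm[OF x(1,2,4), of "-1" a] reflection_nrm(2)[OF x(1,2,4), of a] x by simp
  moreover have "reflection k ` R = cube x ?K" using reflection_cube[OF x(1,2,4)] x by simp
  ultimately show ?case using x(1,3,5) flip_props(5)[OF x(1,2,4)] by blast
qed

text \<open>On a square of the layer the product with \<open>a\<close> is a positive multiple of the
  product with the centre of the cube, and that is negative on the hyperboloid.\<close>

lemma plane_square_neg:
  assumes "p \<in> \<Union> (plane_squares Q (plane_normal a))" "a \<in> K0" shows "mink p a < 0"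
proof -
  obtain R m where R: "(R, m) \<in> layer Q (plane_normal a)" "p \<in> face R m"
    using assms(1) by (auto simp: plane_squares_def)
  obtain y K where y: "y \<in> vert" "tri y K" "a \<in> K" "R = cube y K" "m = nrm y K (-1) a"
    using layer_shape[OF R(1) assms(2)] by blast
  have p: "p \<in> hyp3" "mink p m = 0" using R(2) by (auto simp: face_def solid_def)
  have "mink p (ctr y K) = (2 * phi + 1) * mink p a" using p(2) unfolding y(5) nrm_zero_iff by (simp add: algebra_simps)
  then have "(2 * phi + 1) * mink p a < 0" using ctr_neg[OF vert_hyp3[OF y(1)] y(2) p(1)] by simp
  then show ?thesis using phi_pos by (simp add: mult_less_0_iff)
qed

text \<open>The cubes at \<open>w\<close> with an edge along \<open>a\<close> form a fan around this
  edge, and neighbours in the fan are mirror images in side faces.\<close>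

lemma layer_fan:
  assumes w: "w \<in> vert" and a: "a \<in> dirs w" and K: "tri w K" "a \<in> K" and K': "tri w K'" "a \<in> K'"
    and L: "(cube w K, nrm w K (-1) a) \<in> layer Q n"
  shows "(cube w K', nrm w K' (-1) a) \<in> layer Q n"
proof -
  define R where "R = {K. (cube w K, nrm w K (-1) a) \<in> layer Q n}"
  have "K' \<in> R"
  proof (rule tri_connected[OF w, of "{a}" K])
    show "{a} \<subseteq> dirs w" "orth {a}" using a by (auto simp: orth_def)
    show "tri w K" "K \<in> R" "tri w K'" using K K' L by (auto simp: R_def)
    show "K \<subseteq> link w {a}" "K' \<subseteq> link w {a}" using link_contains K K' by auto
    fix M k assume M: "M \<in> R" "tri w M" "M \<subseteq> link w {a}" "k \<in> M" "insert (flip w M k) (M - {k}) \<subseteq> link w {a}"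
    have aM: "a \<in> M" using tri_contains[OF w _ M(2,3)] a by blast
    have t: "tri w (insert (flip w M k) (M - {k}))" using flip_props(5)[OF w M(2,4)] .
    have "a \<in> insert (flip w M k) (M - {k})" using tri_contains[OF w _ t M(5)] a by blast
    then have ak: "a \<noteq> k" using flip_props(4)[OF w M(2,4)] aM by auto
    let ?m = "nrm w M (-1) a" and ?k = "nrm w M (-1) k"
    have "?k \<in> cube w M" using M(4) unfolding cube_def by blast
    moreover have "?k \<noteq> ?m" using nrm_inject[OF M(2,4) aM, of "-1" "-1"] ak by blast
    moreover have "face (cube w M) ?k \<inter> face (cube w M) ?m \<noteq> {}"
      using vertex_in_face[OF w M(2,4)] vertex_in_face[OF w M(2) aM] by blast
    ultimately have "(reflection ?k ` cube w M, reflection ?k ?m) \<in> layer Q n"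
      using M(1) layer.reflect unfolding R_def by blast
    moreover have "reflection ?k ?m = nrm w (insert (flip w M k) (M - {k})) (-1) a"
      using reflection_nrm_nrm[OF w M(2,4), of "-1" a] reflection_nrm(2)[OF w M(2,4), of a] aM ak by simp
    ultimately show "insert (flip w M k) (M - {k}) \<in> R"
      using reflection_cube[OF w M(2,4)] by (simp add: R_def)
  qed
  then show ?thesis by (simp add: R_def)
qed

text \<open>Induction on the distance from \<open>V\<close>: by \<open>descent_orthogonal\<close> a
  descent from \<open>w\<close> runs parallel to \<open>a\<close>, so the lower neighbour is again
  directly in front of \<open>a\<close>. A cube containing this edge is in the layer, and the fan
  around \<open>a\<close> supplies the others at \<open>w\<close>.\<close>

lemma layer_complete:
  assumes "w \<in> reach" "a \<in> K0" "mink w a = - sh" "tri w K" "a \<in> K"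
  shows "(cube w K, nrm w K (-1) a) \<in> layer Q (plane_normal a)"
  using assms
proof (induction "dst w" arbitrary: w K)
  case 0
  then have w: "w = V" using dst_0 by simp
  have "(cube V K0, nrm V K0 (-1) a) \<in> layer Q (plane_normal a)"
    unfolding plane_normal_def by (rule layer.base)
  then show ?case using layer_fan[OF V_vert _ K0_tri] 0 tri_dirs[OF K0_tri] unfolding w by blast
next
  case (Suc n)
  have wv: "w \<in> vert" using reach_vert Suc.prems by blast
  have an: "a \<in> dirs w" using Suc.prems tri_dirs by blast
  have "w \<noteq> V" using dst_0[OF Suc.prems(1)] Suc.hyps(2) by auto
  then obtain j where j: "j \<in> dirs w" "0 < mink V j" using desc_nonempty[OF Suc.prems(1)] by (auto simp: desc_def)
  have ja: "mink j a = 0"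
    using descent_orthogonal[OF wv V_vert an tri_dirs[OF K0_tri Suc.prems(2)] j] .
  let ?y = "step w j"
  obtain M where M: "tri w M" "j \<in> M" "a \<in> M" using edge_in_tri[OF wv j(1) an ja] by blast
  have "j \<noteq> a" using ja orth_dirs_neq[OF j(1)] by blast
  then have aM: "a \<in> insert (- j) (M - {j})" using M by blast
  have "n = dst ?y" using dst_down[OF Suc.prems(1) j] Suc.hyps(2) by simp
  moreover have "mink ?y a = - sh" using ja Suc.prems(3) by (simp add: mink_step)
  ultimately have "(cube ?y (insert (- j) (M - {j})), nrm ?y (insert (- j) (M - {j})) (-1) a) \<in> layer Q (plane_normal a)"
    using Suc.hyps(1) reach_step[OF Suc.prems(1) j(1)] Suc.prems(2) tri_step[OF wv M(1,2)] aM by blast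
  then have "(cube w M, nrm w M (-1) a) \<in> layer Q (plane_normal a)"
    unfolding cube_step[OF M(1,2)] nrm_step[OF M(1,2)] .
  then show ?case using layer_fan[OF wv an M(1,3) Suc.prems(4,5)] by blast
qed

lemma flip_common:
  assumes w: "w \<in> vert" and K: "tri w K" "k \<in> K" and a: "a \<in> dirs w"
    and o: "\<And>i. i \<in> K - {k} \<Longrightarrow> mink a i = 0"
  shows "a = k \<or> a = flip w K k"
proof -
  have "card (K - {k}) = 2" using K by (simp add: tri_def)
  then obtain i j where ij: "K - {k} = {i, j}" "i \<noteq> j" by (auto simp: card_2_iff)
  then have m: "i \<in> K" "j \<in> K" "i \<noteq> k" "j \<noteq> k" by blast+
  note f = flip_props[OF w K]
  have "flip w K k \<noteq> k" using f(4) K(2) by auto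
  then show ?thesis
    using common_neighbour_cases[OF w tri_dirs[OF K(1) m(1)] tri_dirs[OF K(1) m(2)] _ a _ _ tri_dirs[OF K] _ _ f(1)]
      tri_orthogonal[OF K(1) m(1,2) ij(2)] tri_orthogonal[OF K(1) K(2) m(1)] tri_orthogonal[OF K(1) K(2) m(2)]
      f(3)[of i] f(3)[of j] o[of i] o[of j] m by auto
qed

text \<open>Crossing a face could leave the star of the planes only if the direction given up is
  itself a plane; then the face is a square of that plane and must not be crossed.\<close>

lemma octant_flag:
  assumes "R \<in> octant Q V" shows "\<exists>w K. flag w K \<and> R = cube w K"
  using assms
proof (induction rule: octant.induct)
  case base
  have "K0 \<subseteq> link V (planes V)" using link_contains[OF K0_tri, of "planes V"] V_planes by simp
  then show ?case using V_oct K0_tri unfolding flag_def by blast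
next
  case (cross R m)
  then obtain w K where "flag w K" "R = cube w K" by blast
  then obtain x K' k where x: "flag x K'" "R = cube x K'" "k \<in> K'" "m = nrm x K' (-1) k"
    using flag_face_cases cross.hyps(2) by metis
  have v: "x \<in> vert" and t: "tri x K'" and xP: "x \<in> oct" and L: "K' \<subseteq> link x (planes x)"
    using x(1) flag_vert[OF x(1)] by (auto simp: flag_def)
  let ?f = "flip x K' k" let ?K = "insert (flip x K' k) (K' - {k})"
  have "?f \<in> link x (planes x)"
  proof (rule ccontr)
    assume "?f \<notin> link x (planes x)"
    then obtain a where a: "a \<in> planes x" "?f \<noteq> a" "mink ?f a \<noteq> 0"
      using flip_props(1)[OF v t x(3)] unfolding link_def by blast
    have an: "a \<in> dirs x" "a \<in> K0" "mink x a = - sh" using a(1) planes_dirs[of x] by (auto simp: planes_def)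
    have "mink a i = 0" if i: "i \<in> K' - {k}" for i
    proof -
      have "i \<noteq> a" using flip_props(3)[OF v t x(3) i] a(3) by blast
      moreover have "i \<in> link x (planes x)" using L i by blast
      ultimately have "mink i a = 0" using a(1) unfolding link_def by blast
      then show ?thesis using mink_commute by simp
    qed
    then have "a = k" using flip_common[OF v t x(3) an(1)] a(2) by blast
    then have "(R, m) \<in> layer Q (plane_normal a)"
      using layer_complete[OF oct_reach[OF xP] an(2,3) t] x(2-4) by simp
    then have "face R m \<in> plane_squares Q (plane_normal a)" unfolding plane_squares_def by blast
    then show False using cross.hyps(3) corner_faces_eq an(2) by blast
  qed
  then have "flag x ?K" using xP L flip_props(5)[OF v t x(3)] unfolding flag_def by blast
  then show ?case using reflection_cube[OF v t x(3)] x(2,4) by blast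
qed

text \<open>If the crossed face were a square of the plane \<open>a\<close>, then \<open>a\<close>
  would be orthogonal to \<open>K - {k}\<close>, hence equal to \<open>k\<close> or to its flip.
  Both of these lie in the star of \<open>a\<close>, but their product is \<open>- phi\<close>, not
  0.\<close>

lemma octant_closed:
  assumes f: "flag w K" and k: "k \<in> K" and L: "insert (flip w K k) (K - {k}) \<subseteq> link w (planes w)"
    and R: "cube w K \<in> octant Q V"
  shows "cube w (insert (flip w K k) (K - {k})) \<in> octant Q V"
proof -
  have v: "w \<in> vert" and t: "tri w K" and wP: "w \<in> oct" and KL: "K \<subseteq> link w (planes w)"
    using f flag_vert[OF f] by (auto simp: flag_def)
  let ?m = "nrm w K (-1) k" and ?f = "flip w K k"
  have "face (cube w K) ?m \<notin> plane_squares Q n" if n: "n \<in> corner_faces Q V" for n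
  proof
    assume sq: "face (cube w K) ?m \<in> plane_squares Q n"
    obtain a where a: "a \<in> K0" "n = plane_normal a" using n corner_faces_eq by blast
    have neg: "mink p a < 0" if "p \<in> face (cube w K) ?m" for p
      using plane_square_neg[of p a] that sq a by blast
    have aA: "a \<in> planes w" using oct_neg[OF wP a(1)] neg[OF vertex_in_face[OF v t k]] by simp
    then have an: "a \<in> dirs w" "mink w a = - sh" using planes_dirs[of w] by (auto simp: planes_def)
    have "mink a i = 0" if i: "i \<in> K - {k}" for i
    proof -
      have "step w i \<in> oct" using oct_step[OF wP] KL i by blast
      moreover have "mink (step w i) a < 0" using neg[OF step_in_face[OF v t k]] i by blast
      ultimately have "mink (step w i) a = - sh" using oct_neg[of "step w i" a] a(1) by (simp add: planes_def)
      then show ?thesis using an(2) sh_pos mink_commute[of a i] by (simp add: mink_step)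
    qed
    then have ak: "a = k \<or> a = ?f" using flip_common[OF v t k an(1)] by blast
    have fk: "mink ?f k = - phi" "?f \<noteq> k" using flip_props(2,4)[OF v t k] k by auto
    have "?f = a \<or> mink ?f a = 0" "k = a \<or> mink k a = 0" using L KL k aA unfolding link_def by blast+
    then show False using ak fk phi_pos mink_commute[of k ?f] by auto
  qed
  moreover have "?m \<in> cube w K" using k unfolding cube_def by blast
  ultimately have "reflection ?m ` cube w K \<in> octant Q V" using R octant.cross by blast
  then show ?thesis using reflection_cube[OF v t k] by simp
qed

text \<open>The admissible triangles at \<open>w\<close> are connected by flips within the star, and
  such flips cross no square of a bounding plane; so one cube of the octant at \<open>w\<close>
  yields all.\<close>

lemma octant_at_vertex:
  assumes "R \<in> octant Q V" "w \<in> cube_verts R" "tri w K" "K \<subseteq> link w (planes w)"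
  shows "cube w K \<in> octant Q V"
proof -
  obtain w' K' where "flag w' K'" "R = cube w' K'" using octant_flag[OF assms(1)] by blast
  then obtain M where M: "flag w M" "R = cube w M" using flag_verts assms(2) by metis
  have wP: "w \<in> oct" and v: "w \<in> vert" using M(1) flag_vert[OF M(1)] by (auto simp: flag_def)
  define T where "T = {K. cube w K \<in> octant Q V}"
  have "K \<in> T"
  proof (rule tri_connected[OF v planes_dirs planes_orth, of M])
    show "tri w M" "M \<subseteq> link w (planes w)" using M(1) by (auto simp: flag_def)
    show "M \<in> T" using M(2) assms(1) by (simp add: T_def)
    show "tri w K" "K \<subseteq> link w (planes w)" by fact+
    fix N k assume "N \<in> T" "tri w N" "N \<subseteq> link w (planes w)" "k \<in> N" "insert (flip w N k) (N - {k}) \<subseteq> link w (planes w)"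
    then show "insert (flip w N k) (N - {k}) \<in> T"
      using octant_closed[of w N k] wP unfolding T_def flag_def by blast
  qed
  then show ?thesis by (simp add: T_def)
qed

section \<open>The graph of the octant\<close>

abbreviation "GV \<equiv> GP_verts Q V"
abbreviation "GE \<equiv> GP_edges Q V"

lemma GV_oct: "w \<in> GV \<Longrightarrow> w \<in> oct"
proof -
  assume "w \<in> GV"
  then obtain R where R: "R \<in> octant Q V" "w \<in> cube_verts R" by (auto simp: GP_verts_def)
  obtain w' K' where "flag w' K'" "R = cube w' K'" using octant_flag[OF R(1)] by blast
  then obtain M where "flag w M" using flag_verts R(2) by metis
  then show "w \<in> oct" by (simp add: flag_def)
qed

lemma V_GV: "V \<in> GV"
  unfolding GP_verts_def using octant.base cube_vertex[OF V_vert K0_tri] by blast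

lemma GE_iff:
  assumes w: "w \<in> GV" shows "(w, u) \<in> GE \<longleftrightarrow> (\<exists>j\<in>link w (planes w). u = step w j)"
proof
  assume "(w, u) \<in> GE"
  then obtain R where R: "R \<in> octant Q V" "(w, u) \<in> cube_edges R" by (auto simp: GP_edges_def)
  obtain w' K' where "flag w' K'" "R = cube w' K'" using octant_flag[OF R(1)] by blast
  then obtain M where M: "flag w M" "R = cube w M" using flag_verts cube_edges_verts[OF R(2)] by metis
  then obtain k where "k \<in> M" "u = step w k" using cube_edges_cube[OF flag_vert flag_tri] R(2) by blast
  then show "\<exists>j\<in>link w (planes w). u = step w j" using M(1) unfolding flag_def by blast
next
  assume "\<exists>j\<in>link w (planes w). u = step w j"
  then obtain j where j: "j \<in> link w (planes w)" "u = step w j" by blast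
  have v: "w \<in> vert" using oct_vert[OF GV_oct[OF w]] .
  obtain K where K: "tri w K" "K \<subseteq> link w (planes w)" "j \<in> K" using link_in_tri[OF v planes_dirs planes_orth j(1)] by blast
  obtain R where "R \<in> octant Q V" "w \<in> cube_verts R" using w by (auto simp: GP_verts_def)
  then have "cube w K \<in> octant Q V" using octant_at_vertex K by blast
  moreover have "(w, u) \<in> cube_edges (cube w K)" using cube_edges_cube[OF v K(1)] K(3) j(2) by blast
  ultimately show "(w, u) \<in> GE" unfolding GP_edges_def by blast
qed

lemma GE_GV: "(w, u) \<in> GE \<Longrightarrow> w \<in> GV \<and> u \<in> GV"
  unfolding GP_edges_def GP_verts_def using cube_edges_verts by blast

lemma cube_edges_sym: "(w, u) \<in> cube_edges R \<Longrightarrow> (u, w) \<in> cube_edges R"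
  unfolding cube_edges_def by (auto simp: conj_commute)

lemma GE_sym: "(w, u) \<in> GE \<Longrightarrow> (u, w) \<in> GE"
  unfolding GP_edges_def using cube_edges_sym by blast

text \<open>Convexity of the octant: a plane \<open>a\<close> at \<open>w\<close> is also next to
  \<open>V\<close>, so every descent runs parallel to it.\<close>

lemma desc_link:
  assumes w: "w \<in> oct" shows "desc w \<subseteq> link w (planes w)"
proof
  fix j assume "j \<in> desc w"
  then have j: "j \<in> dirs w" "0 < mink V j" by (auto simp: desc_def)
  have "mink j a = 0" if a: "a \<in> planes w" for a
    using descent_orthogonal[OF oct_vert[OF w] V_vert _ _ j] a planes_dirs planes_K0 tri_dirs[OF K0_tri] by blast
  then show "j \<in> link w (planes w)" using j(1) by (simp add: link_def)
qed

lemma GE_path: "(V, w) \<in> GE ^^ n \<Longrightarrow> (V, w) \<in> honey_edges ^^ n"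
proof (induction n arbitrary: w)
  case 0 then show ?case by simp
next
  case (Suc n)
  then obtain z where z: "(V, z) \<in> GE ^^ n" "(z, w) \<in> GE" by (auto elim: relpow_Suc_E)
  have "z \<in> GV" using GE_GV[OF z(2)] by blast
  then obtain j where j: "j \<in> link z (planes z)" "w = step z j" using GE_iff z(2) by blast
  have "(z, w) \<in> honey_edges" using honey_edges_I[OF oct_vert[OF GV_oct[OF \<open>z \<in> GV\<close>]]] j by (simp add: link_def)
  then show ?case using relpow_Suc_I[OF Suc.IH[OF z(1)]] by blast
qed

lemma GV_step: "w \<in> GV \<Longrightarrow> j \<in> link w (planes w) \<Longrightarrow> step w j \<in> GV"
  using GE_iff GE_GV by blast

lemma dst_GE_path: "w \<in> GV \<Longrightarrow> (V, w) \<in> GE ^^ dst w"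
proof (induction "dst w" arbitrary: w)
  case 0
  then have "w = V" using dst_0[OF oct_reach[OF GV_oct]] by simp
  then show ?case using 0 by simp
next
  case (Suc n)
  have r: "w \<in> reach" "w \<in> oct" using GV_oct[OF Suc.prems] oct_reach by blast+
  have "w \<noteq> V" using dst_0[OF r(1)] Suc.hyps(2) by auto
  then obtain j where j: "j \<in> desc w" using desc_nonempty[OF r(1)] by blast
  then have jL: "j \<in> link w (planes w)" using desc_link[OF r(2)] by blast
  have n: "n = dst (step w j)" using dst_down[OF r(1), of j] j Suc.hyps(2) by (simp add: desc_def)
  have "(V, step w j) \<in> GE ^^ n" using Suc.hyps(1)[OF n GV_step[OF Suc.prems jL]] n by simp
  moreover have "(step w j, w) \<in> GE" using GE_sym GE_iff[OF Suc.prems] jL by blast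
  ultimately show ?case using relpow_Suc_I[of V "step w j" n GE w] Suc.hyps(2) by simp
qed

text \<open>Octant paths are honeycomb paths, and descents from an octant vertex stay in the octant;
  so the two distances coincide.\<close>

lemma level_eq: "level Q V n = {w \<in> GV. dst w = n}"
proof (intro equalityI subsetI)
  fix w assume "w \<in> level Q V n"
  then have w: "w \<in> GV" "(V, w) \<in> GE ^^ n" "\<forall>m<n. (V, w) \<notin> GE ^^ m" by (auto simp: level_def)
  have "dst w \<le> n" using dst_le[OF GE_path[OF w(2)]] .
  moreover have "\<not> dst w < n" using w(3) dst_GE_path[OF w(1)] by blast
  ultimately show "w \<in> {w \<in> GV. dst w = n}" using w(1) by simp
next
  fix w assume "w \<in> {w \<in> GV. dst w = n}"
  then have w: "w \<in> GV" "dst w = n" by auto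
  have "(V, w) \<notin> GE ^^ m" if "m < n" for m using dst_le[OF GE_path, of w m] w(2) that by auto
  then show "w \<in> level Q V n" using w dst_GE_path[OF w(1)] by (simp add: level_def)
qed

lemma dst_link:
  assumes "w \<in> GV" "j \<in> link w (planes w)"
  shows "j \<in> desc w \<Longrightarrow> dst w = Suc (dst (step w j))" "j \<notin> desc w \<Longrightarrow> dst (step w j) = Suc (dst w)"
proof -
  have r: "w \<in> reach" using oct_reach[OF GV_oct[OF assms(1)]] .
  have j: "j \<in> dirs w" using assms(2) by (simp add: link_def)
  show "j \<in> desc w \<Longrightarrow> dst w = Suc (dst (step w j))" using dst_down[OF r j] by (simp add: desc_def)
  show "j \<notin> desc w \<Longrightarrow> dst (step w j) = Suc (dst w)" using dst_up[OF r j] j by (simp add: desc_def)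
qed

section \<open>Neighbours on adjacent levels\<close>

lemma lower_neighbours:
  assumes w: "w \<in> GV" "dst w = Suc n" shows "{u \<in> level Q V n. (u, w) \<in> GE} = step w ` desc w"
proof (intro equalityI subsetI)
  fix u assume "u \<in> {u \<in> level Q V n. (u, w) \<in> GE}"
  then have u: "dst u = n" "(w, u) \<in> GE" using GE_sym by (auto simp: level_eq)
  then obtain j where j: "j \<in> link w (planes w)" "u = step w j" using GE_iff[OF w(1)] by blast
  have "j \<in> desc w" using dst_link(2)[OF w(1) j(1)] u(1) j(2) w(2) by (rule_tac ccontr) simp
  then show "u \<in> step w ` desc w" using j(2) by blast
next
  fix u assume "u \<in> step w ` desc w"
  then obtain j where j: "j \<in> desc w" "u = step w j" by blast
  have jL: "j \<in> link w (planes w)" using desc_link[OF GV_oct[OF w(1)]] j(1) by blast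
  have "(w, u) \<in> GE" using GE_iff[OF w(1)] jL j(2) by blast
  moreover have "dst u = n" using dst_link(1)[OF w(1) jL j(1)] w(2) j(2) by simp
  ultimately show "u \<in> {u \<in> level Q V n. (u, w) \<in> GE}" using GE_sym GE_GV by (auto simp: level_eq)
qed

lemma card_step_image: "card (step w ` X) = card X"
  by (intro card_image inj_onI) (simp add: step_inject)

lemma card_ascendants:
  assumes "w \<in> level Q V n" "1 \<le> n" shows "card (ascendants Q V n w) = card (desc w)"
proof -
  obtain m where m: "n = Suc m" using assms(2) by (cases n) auto
  have "w \<in> GV" "dst w = Suc m" using assms(1) m by (auto simp: level_eq)
  then show ?thesis using lower_neighbours card_step_image by (simp add: ascendants_def m)
qed

lemma planes_at_eq:
  assumes w: "w \<in> GV" shows "planes_at Q V w = plane_normal ` planes w"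
proof -
  have wP: "w \<in> oct" and v: "w \<in> vert" using GV_oct[OF w] oct_vert by blast+
  have "w \<in> \<Union> (plane_squares Q (plane_normal a)) \<longleftrightarrow> a \<in> planes w" if a: "a \<in> K0" for a
  proof
    assume "w \<in> \<Union> (plane_squares Q (plane_normal a))"
    then have "mink w a < 0" using plane_square_neg a by blast
    then show "a \<in> planes w" using oct_neg[OF wP a] by simp
  next
    assume aA: "a \<in> planes w"
    obtain K where K: "tri w K" "{a} \<subseteq> K" using orth_extends[OF v, of "{a}"] aA planes_dirs[of w] by (auto simp: orth_def)
    have "(cube w K, nrm w K (-1) a) \<in> layer Q (plane_normal a)"
      using layer_complete[OF oct_reach[OF wP] a _ K(1)] aA K(2) by (simp add: planes_def)
    moreover have "w \<in> face (cube w K) (nrm w K (-1) a)" using vertex_in_face[OF v K(1)] K(2) by blast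
    ultimately show "w \<in> \<Union> (plane_squares Q (plane_normal a))" unfolding plane_squares_def by blast
  qed
  then have "planes_at Q V w = plane_normal ` {a \<in> K0. a \<in> planes w}"
    unfolding planes_at_def corner_faces_eq by blast
  also have "{a \<in> K0. a \<in> planes w} = planes w" using planes_K0 by blast
  finally show ?thesis .
qed

lemma card_planes_at: "w \<in> GV \<Longrightarrow> card (planes_at Q V w) = card (planes w)"
  using planes_at_eq card_image[OF inj_on_subset[OF plane_normal_inj planes_K0]] by simp

lemma finite_planes: "finite (planes w)" using planes_K0 tri_finite[OF K0_tri] finite_subset by blast

lemma finite_desc: "w \<in> vert \<Longrightarrow> finite (desc w)"
  using desc_dirs finite_dirs finite_subset by blast

lemma planes_desc_disjoint: "planes w \<inter> desc w = {}"
proof -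
  have "a \<notin> desc w" if "a \<in> planes w" for a
    using that planes_K0[of w] dirs_mink[OF tri_dirs[OF K0_tri, of a]] sh_pos by (auto simp: desc_def)
  then show ?thesis by blast
qed

lemma planes_desc_orth:
  assumes w: "w \<in> oct" shows "orth (planes w \<union> desc w)"
proof -
  have x: "mink j a = 0" if ja: "j \<in> desc w" "a \<in> planes w" for j a
  proof -
    have "j \<in> link w (planes w)" "j \<noteq> a" using ja desc_link[OF w] planes_desc_disjoint[of w] by auto
    then show ?thesis using ja(2) by (auto simp: link_def)
  qed
  show ?thesis unfolding orth_def
  proof (intro ballI impI)
    fix i j assume ij: "i \<in> planes w \<union> desc w" "j \<in> planes w \<union> desc w" "i \<noteq> j"
    show "mink i j = 0"
    proof (cases "i \<in> planes w")
      case True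
      then show ?thesis using ij orth_D[OF planes_orth[of w], of i j] x[of j i] mink_commute[of i j] by auto
    next
      case False
      then show ?thesis using ij orth_D[OF desc_orth[OF oct_vert[OF w]], of i j] x[of i j] by auto
    qed
  qed
qed

text \<open>A new plane \<open>a\<close> could be entered only through \<open>j = - a\<close>, and
  that direction descends because \<open>V\<close> is directly in front of \<open>a\<close>.\<close>

lemma planes_up:
  assumes w: "w \<in> GV" and j: "j \<in> link w (planes w)" "j \<notin> desc w" shows "planes (step w j) = planes w - {j}"
proof (intro equalityI subsetI)
  have jn: "j \<in> dirs w" using j by (simp add: link_def)
  fix a assume a: "a \<in> planes (step w j)"
  have aK: "a \<in> K0" using a planes_K0 by blast
  have "j \<noteq> - a"
  proof
    assume "j = - a"
    then have "mink V j = sh" using dirs_mink[OF tri_dirs[OF K0_tri aK]] by (simp add: mink_simps)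
    then show False using j(2) jn sh_pos by (simp add: desc_def)
  qed
  then have "a \<in> planes w" using planes_step[OF GV_oct[OF w] j(1) a] by blast
  moreover have "a \<noteq> j"
  proof
    assume "a = j"
    then have "mink (step w j) a = sh" using dirs_mink[OF jn] dirs_unit[OF jn] by (simp add: mink_step)
    then show False using a sh_pos by (simp add: planes_def)
  qed
  ultimately show "a \<in> planes w - {j}" by blast
next
  fix a assume "a \<in> planes w - {j}"
  then have a: "a \<in> planes w" "a \<noteq> j" by auto
  then have "mink j a = 0" using j(1) by (auto simp: link_def)
  then show "a \<in> planes (step w j)" using a(1) by (simp add: planes_def mink_step)
qed

text \<open>At the upper end \<open>- j\<close> descends, and descending directions are pairwise
  orthogonal; the others are therefore orthogonal to \<open>j\<close> and are already descending
  directions at \<open>w\<close>.\<close>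

lemma desc_up:
  assumes w: "w \<in> GV" and j: "j \<in> link w (planes w)" "j \<notin> desc w"
  shows "card (desc (step w j)) = Suc (card {x \<in> desc w. mink j x = 0})"
proof -
  have v: "w \<in> vert" using oct_vert[OF GV_oct[OF w]] .
  have jn: "j \<in> dirs w" using j by (simp add: link_def)
  have V0: "0 < mink V (- j)"
    using j(2) jn vert_off_mirror[OF V_vert dirs_mirrors[OF jn]] by (simp add: desc_def mink_simps)
  have bk: "- j \<in> dirs (step w j)" "step (step w j) (- j) = w" using step_back[OF jn] by auto
  have "desc (step w j) = insert (- j) {x \<in> desc w. mink j x = 0}"
  proof (intro equalityI subsetI)
    fix y assume y: "y \<in> desc (step w j)"
    show "y \<in> insert (- j) {x \<in> desc w. mink j x = 0}"
    proof (cases "y = - j")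
      case False
      have "- j \<in> desc (step w j)" using bk V0 by (simp add: desc_def)
      then have o: "mink (- j) y = 0" using orth_D[OF desc_orth[OF step_vert[OF v jn]] _ y] False by auto
      have "y \<in> dirs (step (step w j) (- j))" using dirs_step_orthogonal[OF bk(1) _ o] y by (simp add: desc_def)
      then show ?thesis using o y bk(2) by (simp add: desc_def mink_simps)
    qed simp
  next
    fix y assume "y \<in> insert (- j) {x \<in> desc w. mink j x = 0}"
    then show "y \<in> desc (step w j)"
    proof
      assume "y = - j" then show ?thesis using bk V0 by (simp add: desc_def)
    next
      assume "y \<in> {x \<in> desc w. mink j x = 0}"
      then have "y \<in> dirs w" "mink j y = 0" "0 < mink V y" by (auto simp: desc_def)
      then show ?thesis using dirs_step_orthogonal[OF jn] by (simp add: desc_def)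
    qed
  qed
  moreover have "- j \<notin> desc w"
  proof
    assume "- j \<in> desc w"
    then have "- j \<in> dirs w" by (simp add: desc_def)
    then show False using dirs_mink[of "- j" w] dirs_mink[OF jn] sh_pos by (simp add: mink_simps)
  qed
  ultimately show ?thesis using finite_desc[OF v] by simp
qed

section \<open>Counting\<close>

text \<open>Besides the types A to E this covers type "1", which is \<open>p = 2\<close> with
  \<open>q = 1\<close>.\<close>

definition kind :: "nat \<Rightarrow> nat \<Rightarrow> nat \<Rightarrow> mvec set" where
  "kind n p q = {w \<in> level Q V n. card (planes w) = p \<and> card (desc w) = q}"

lemma finite_level: "finite (level Q V n)"
proof (induction n)
  case 0
  have "level Q V 0 \<subseteq> {V}" using dst_0[OF oct_reach[OF GV_oct]] by (auto simp: level_eq)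
  then show ?case using finite_subset by blast
next
  case (Suc n)
  have "level Q V (Suc n) \<subseteq> (\<Union>u\<in>level Q V n. step u ` dirs u)"
  proof
    fix w assume "w \<in> level Q V (Suc n)"
    then have w: "w \<in> GV" "dst w = Suc n" by (auto simp: level_eq)
    have r: "w \<in> reach" using oct_reach[OF GV_oct[OF w(1)]] .
    have "w \<noteq> V" using dst_0[OF r] w(2) by auto
    then have "step w ` desc w \<noteq> {}" using desc_nonempty[OF r] by simp
    then obtain u where u: "u \<in> level Q V n" "(u, w) \<in> GE" using lower_neighbours[OF w] by blast
    then obtain j where "j \<in> link u (planes u)" "w = step u j" using GE_iff[of u w] GE_GV by blast
    then show "w \<in> (\<Union>u\<in>level Q V n. step u ` dirs u)" using u(1) unfolding link_def by blast
  qed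
  moreover have "finite (dirs u)" if "u \<in> level Q V n" for u
    using that finite_dirs[OF oct_vert[OF GV_oct]] by (simp add: level_eq)
  ultimately show ?case using Suc finite_subset by (metis (no_types, lifting) finite_UN finite_imageI)
qed

lemma upper_neighbours:
  assumes w: "w \<in> level Q V n" and ne: "desc w \<noteq> {} \<or> card (planes w) = 3" and q: "1 \<le> q" "q \<le> 4"
  shows "card {u \<in> kind (Suc n) p q. (w, u) \<in> GE} = count_list (code_table (card (planes w)) (card (desc w))) (4 * p + q)"
proof -
  have wG: "w \<in> GV" "dst w = n" using w by (auto simp: level_eq)
  have wP: "w \<in> oct" and v: "w \<in> vert" using GV_oct[OF wG(1)] oct_vert by blast+
  have "{u \<in> kind (Suc n) p q. (w, u) \<in> GE} = step w ` {j \<in> link w (planes w). j \<notin> desc w \<and> card (planes w - {j}) = p \<and>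
      Suc (card {x \<in> desc w. mink j x = 0}) = q}" (is "?L = step w ` ?R")
  proof (intro equalityI subsetI)
    fix u assume "u \<in> ?L"
    then have u: "dst u = Suc n" "card (planes u) = p" "card (desc u) = q" "(w, u) \<in> GE" by (auto simp: kind_def level_eq)
    then obtain j where j: "j \<in> link w (planes w)" "u = step w j" using GE_iff[OF wG(1)] by blast
    have js: "j \<notin> desc w" using dst_link(1)[OF wG(1) j(1)] u(1) wG(2) j(2) by auto
    then have "j \<in> ?R" using j u planes_up[OF wG(1) j(1) js] desc_up[OF wG(1) j(1) js] by simp
    then show "u \<in> step w ` ?R" using j(2) by blast
  next
    fix u assume "u \<in> step w ` ?R"
    then obtain j where j: "j \<in> link w (planes w)" "j \<notin> desc w" "card (planes w - {j}) = p"
      "Suc (card {x \<in> desc w. mink j x = 0}) = q" "u = step w j" by blast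
    have "(w, u) \<in> GE" using GE_iff[OF wG(1)] j by blast
    moreover have "u \<in> GV" using GV_step[OF wG(1) j(1)] j(5) by simp
    moreover have "dst u = Suc n" using dst_link(2)[OF wG(1) j(1,2)] wG(2) j(5) by simp
    ultimately show "u \<in> ?L"
      using planes_up[OF wG(1) j(1,2)] desc_up[OF wG(1) j(1,2)] j by (simp add: kind_def level_eq)
  qed
  then have "card ?L = card ?R" using card_step_image by simp
  also have "\<dots> = count_list (code_table (card (planes w)) (card (desc w))) (4 * p + q)"
    by (rule up_count[OF v planes_dirs desc_dirs planes_desc_disjoint planes_desc_orth[OF wP] ne q])
  finally show ?thesis .
qed

text \<open>The edges from level \<open>n\<close> into one kind on the next level, counted from both
  ends: an upper end contributes \<open>q\<close>, a lower end contributes a multiplicity in the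
  table.\<close>

lemma double_count:
  assumes q: "1 \<le> q" "q \<le> 4" and ne: "\<And>w. w \<in> level Q V n \<Longrightarrow> desc w \<noteq> {} \<or> card (planes w) = 3"
  shows "q * card (kind (Suc n) p q) =
    (\<Sum>w\<in>level Q V n. count_list (code_table (card (planes w)) (card (desc w))) (4 * p + q))"
proof -
  have fX: "finite (kind (Suc n) p q)" using finite_level by (simp add: kind_def)
  have "card {w \<in> level Q V n. (w, u) \<in> GE} = q" if "u \<in> kind (Suc n) p q" for u
    using that lower_neighbours[of u n] card_step_image by (simp add: kind_def level_eq)
  then have "(\<Sum>w\<in>level Q V n. card {u \<in> kind (Suc n) p q. (w, u) \<in> GE}) = (\<Sum>u\<in>kind (Suc n) p q. q)"
    by (intro sum_multicount_gen[OF finite_level fX]) blast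
  then show ?thesis using upper_neighbours[OF _ ne q] by simp
qed

lemma level_0: "level Q V 0 = {V}"
  using dst_0[OF oct_reach[OF GV_oct]] V_GV dst_0[OF V_reach] by (auto simp: level_eq)

lemma desc_V: "desc V = {}"
proof -
  have "j \<notin> desc V" for j using dirs_mink[of j V] sh_pos by (auto simp: desc_def)
  then show ?thesis by blast
qed

lemma kind_1:
  assumes "1 \<le> q" "q \<le> 4" shows "q * card (kind 1 p q) = count_list [9, 9, 9] (4 * p + q)"
proof -
  have c: "card (planes V) = 3" using V_planes K0_tri by (simp add: tri_def)
  then show ?thesis using double_count[OF assms, of 0 p] by (simp add: level_0 desc_V code_table_def)
qed

text \<open>Planes and descending directions together form a simplex, so \<open>p + q\<close> is at
  most 3, and \<open>q\<close> is positive away from \<open>V\<close>.\<close>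

definition states :: "(nat \<times> nat) set" where "states = {(0, 1), (0, 2), (0, 3), (1, 1), (1, 2), (2, 1)}"

lemma level_states:
  assumes w: "w \<in> level Q V n" "1 \<le> n" shows "desc w \<noteq> {}" "(card (planes w), card (desc w)) \<in> states"
proof -
  have wG: "w \<in> GV" "dst w = n" using w by (auto simp: level_eq)
  have wP: "w \<in> oct" using GV_oct[OF wG(1)] .
  have v: "w \<in> vert" using oct_vert[OF wP] .
  have "w \<noteq> V" using dst_0[OF V_reach] wG(2) w(2) by auto
  then show s: "desc w \<noteq> {}" using desc_nonempty[OF oct_reach[OF wP]] by blast
  have "card (planes w \<union> desc w) \<le> 3"
    using orth_card_le_3[OF v _ planes_desc_orth[OF wP]] planes_dirs desc_dirs by blast
  then have le: "card (planes w) + card (desc w) \<le> 3"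
    using card_Un_disjoint[OF finite_planes finite_desc[OF v] planes_desc_disjoint] by simp
  have "card (desc w) \<noteq> 0" using s finite_desc[OF v] by simp
  then show "(card (planes w), card (desc w)) \<in> states" using le unfolding states_def by auto
qed

lemma recurrence:
  assumes q: "1 \<le> q" "q \<le> 4" and n: "1 \<le> n"
  shows "q * card (kind (Suc n) p q) =
    (\<Sum>(p', q')\<in>states. card (kind n p' q') * count_list (code_table p' q') (4 * p + q))"
proof -
  let ?g = "\<lambda>w. (card (planes w), card (desc w))"
  let ?h = "\<lambda>w. count_list (code_table (card (planes w)) (card (desc w))) (4 * p + q)"
  have "q * card (kind (Suc n) p q) = (\<Sum>w\<in>level Q V n. ?h w)"
    using double_count[OF q] level_states(1)[OF _ n] by blast
  also have "\<dots> = (\<Sum>y\<in>states. \<Sum>w\<in>{w \<in> level Q V n. ?g w = y}. ?h w)"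
  proof (rule sum.group[symmetric, OF finite_level])
    show "finite states" by (simp add: states_def)
    show "?g ` level Q V n \<subseteq> states" using level_states(2)[OF _ n] by blast
  qed
  also have "\<dots> = (\<Sum>(p', q')\<in>states. card (kind n p' q') * count_list (code_table p' q') (4 * p + q))"
  proof (rule sum.cong[OF refl], clarify)
    fix p' q' :: nat
    have "{w \<in> level Q V n. ?g w = (p', q')} = kind n p' q'" by (auto simp: kind_def)
    moreover have "(\<Sum>w\<in>kind n p' q'. ?h w) = (\<Sum>w\<in>kind n p' q'. count_list (code_table p' q') (4 * p + q))"
      by (intro sum.cong) (auto simp: kind_def)
    ultimately show "(\<Sum>w\<in>{w \<in> level Q V n. ?g w = (p', q')}. ?h w) = card (kind n p' q') * count_list (code_table p' q') (4 * p + q)"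
      by simp
  qed
  finally show ?thesis .
qed

lemma types_kind:
  assumes "1 \<le> n"
  shows "type_A Q V n = kind n 1 2" "type_B Q V n = kind n 1 1"
    "type_C Q V n = kind n 0 3" "type_D Q V n = kind n 0 2" "type_E Q V n = kind n 0 1"
proof -
  have p: "card (planes_at Q V w) = card (planes w)" "planes_at Q V w = {} \<longleftrightarrow> card (planes w) = 0"
    "card (ascendants Q V n w) = card (desc w)" if "w \<in> level Q V n" for w
  proof -
    have "w \<in> GV" using that by (simp add: level_eq)
    then show "card (planes_at Q V w) = card (planes w)" "planes_at Q V w = {} \<longleftrightarrow> card (planes w) = 0"
      using card_planes_at planes_at_eq finite_planes[of w] by simp_all
    show "card (ascendants Q V n w) = card (desc w)" using card_ascendants[OF that assms] .
  qed
  show "type_A Q V n = kind n 1 2" unfolding type_A_def kind_def by (intro Collect_cong conj_cong refl) (simp_all add: p)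
  show "type_B Q V n = kind n 1 1" unfolding type_B_def kind_def by (intro Collect_cong conj_cong refl) (simp_all add: p)
  show "type_C Q V n = kind n 0 3" unfolding type_C_def kind_def by (intro Collect_cong conj_cong refl) (simp_all add: p)
  show "type_D Q V n = kind n 0 2" unfolding type_D_def kind_def by (intro Collect_cong conj_cong refl) (simp_all add: p)
  show "type_E Q V n = kind n 0 1" unfolding type_E_def kind_def by (intro Collect_cong conj_cong refl) (simp_all add: p)
qed

text \<open>The left factor is the number of ascendants; the coefficient of a kind is the
  multiplicity of \<open>4 * p + q\<close> in its row of \<open>code_table\<close>.\<close>

lemma kind_recurrences:
  assumes n: "1 \<le> n"
  shows "2 * card (kind (n + 1) 1 2) = 2 * card (kind n 1 2) + 2 * card (kind n 1 1) + 2 * card (kind n 2 1)"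
    "card (kind (n + 1) 1 1) = card (kind n 1 2) + 2 * card (kind n 1 1)"
    "3 * card (kind (n + 1) 0 3) = card (kind n 1 2) + 3 * card (kind n 0 3) + 2 * card (kind n 0 2)"
    "2 * card (kind (n + 1) 0 2) = card (kind n 1 1) + 3 * card (kind n 0 3) + 4 * card (kind n 0 2) + 5 * card (kind n 0 1)"
    "card (kind (n + 1) 0 1) = 3 * card (kind n 0 3) + 4 * card (kind n 0 2) + 6 * card (kind n 0 1)"
    "card (kind (n + 1) 2 1) = card (kind n 2 1)"
  using recurrence[of 2 n 1] recurrence[of 1 n 1] recurrence[of 3 n 0] recurrence[of 2 n 0]
    recurrence[of 1 n 0] recurrence[of 1 n 2] n
  by (simp_all add: states_def code_table_def)

text \<open>Code 9 occurs once in the row of type "1" and in no other row of a positive level, so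
  the three lines neither branch nor end. This is the summand 3 in the recurrence for type
  A.\<close>

lemma card_kind_2_1: "1 \<le> n \<Longrightarrow> card (kind n 2 1) = 3"
proof (induction n rule: nat_induct_at_least)
  case base
  then show ?case using kind_1[of 1 2] by simp
next
  case (Suc n)
  then show ?case using kind_recurrences(6)[of n] by simp
qed

lemma kind_initial: "card (kind 1 1 2) = 0" "card (kind 1 1 1) = 0" "card (kind 1 0 3) = 0" "card (kind 1 0 2) = 0" "card (kind 1 0 1) = 0"
  using kind_1[of 2 1] kind_1[of 1 1] kind_1[of 3 0] kind_1[of 2 0] kind_1[of 1 0] by simp_all

lemma num_kind:
  assumes "1 \<le> n"
  shows "num_A Q V n = card (kind n 1 2)" "num_B Q V n = card (kind n 1 1)" "num_C Q V n = card (kind n 0 3)"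
    "num_D Q V n = card (kind n 0 2)" "num_E Q V n = card (kind n 0 1)"
  by (simp_all add: num_A_def num_B_def num_C_def num_D_def num_E_def types_kind[OF assms])

end

theorem theorem1:
  fixes Q0 :: "mvec set" and V0 :: mvec
  assumes "Q0 \<in> honeycomb" and "V0 \<in> cube_verts Q0"
  shows "num_A Q0 V0 1 = 0 \<and> num_B Q0 V0 1 = 0 \<and> num_C Q0 V0 1 = 0 \<and>
           num_D Q0 V0 1 = 0 \<and> num_E Q0 V0 1 = 0 \<and>
         (\<forall>n\<ge>1.
           num_A Q0 V0 (n + 1) = num_A Q0 V0 n + num_B Q0 V0 n + 3 \<and>
           num_B Q0 V0 (n + 1) = num_A Q0 V0 n + 2 * num_B Q0 V0 n \<and>
           num_C Q0 V0 (n + 1) = 1 / 3 * num_A Q0 V0 n + num_C Q0 V0 n + 2 / 3 * num_D Q0 V0 n \<and>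
           num_D Q0 V0 (n + 1) = 1 / 2 * num_B Q0 V0 n + 3 / 2 * num_C Q0 V0 n
             + 2 * num_D Q0 V0 n + 5 / 2 * num_E Q0 V0 n \<and>
           num_E Q0 V0 (n + 1) = 3 * num_C Q0 V0 n + 4 * num_D Q0 V0 n + 6 * num_E Q0 V0 n)"
proof -
  obtain v K where "v \<in> vert" "tri v K" "Q0 = cube v K" using honeycomb_cube[OF assms(1)] by blast
  \<comment> \<open>The honeycomb supplies some corner of the cube; its description is moved to the
    prescribed corner \<open>V0\<close>.\<close>
  then obtain K0 where K0: "V0 \<in> vert" "tri V0 K0" "Q0 = cube V0 K0" using cube_verts_cases assms(2) by metis
  interpret corner V0 K0 using K0 by unfold_locales
  have rec: "num_A Q0 V0 (n + 1) = num_A Q0 V0 n + num_B Q0 V0 n + 3 \<and>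
      num_B Q0 V0 (n + 1) = num_A Q0 V0 n + 2 * num_B Q0 V0 n \<and>
      num_C Q0 V0 (n + 1) = 1 / 3 * num_A Q0 V0 n + num_C Q0 V0 n + 2 / 3 * num_D Q0 V0 n \<and>
      num_D Q0 V0 (n + 1) = 1 / 2 * num_B Q0 V0 n + 3 / 2 * num_C Q0 V0 n
        + 2 * num_D Q0 V0 n + 5 / 2 * num_E Q0 V0 n \<and>
      num_E Q0 V0 (n + 1) = 3 * num_C Q0 V0 n + 4 * num_D Q0 V0 n + 6 * num_E Q0 V0 n"
    if n: "1 \<le> n" for n
  proof -
    have n1: "1 \<le> n + 1" by simp
    note eqs = kind_recurrences[OF n, THEN arg_cong[where f = real]]
    show ?thesis unfolding K0(3) num_kind[OF n] num_kind[OF n1]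
      using eqs card_kind_2_1[OF n] by simp
  qed
  show ?thesis using rec kind_initial unfolding K0(3) by (simp add: num_kind)
qed

end
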